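(* Let $2\le n\le 4$ be an integer, let $a,p_1,p_2,b$ be nonzero complex constants, and let $f$ be an entire solution of the equation $$f^n(z)+a(f'(z))^n=p_1e^{bz}+p_2e^{-bz}.$$ Then $n=2$ or $n=4$, and the following holds. (i) When $n=4$: $f(z)=k_1e^{\frac{b}{2}z}+k_2e^{-\frac{b}{2}z}$ and $a\left(\frac{b}{2}\right)^4=-1$, where $k_1,k_2$ are constants with $8k_1^3k_2=p_1$ and $8k_2^3k_1=p_2$. (ii) When $n=2$: (1) If $9ab^2\neq -4$, then the equation $f^2(z)+a(f'(z))^2=p_1e^{bz}+p_2e^{-bz}$ has entire solutions if and only if $ab^2+1=0$ or $ab^2-4=0$. Moreover, if $ab^2+1=0$, then $f(z)=t_1e^{bz}+t_2e^{-bz}+r$, where $r$ is one of the four roots of $r^4=-p_1p_2$ and $2t_1r=p_1$, $2t_2r=p_2$; and if $ab^2-4=0$, then $f(z)=l_1e^{\frac{bz}{2}}+l_2e^{-\frac{bz}{2}}$, where $l_1$ is a square root of $\frac{p_1}{2}$ and $l_2$ is a square root of $\frac{p_2}{2}$. (2) If $9ab^2=-4$, then either $f(z)=l_1e^{-\frac{3}{2}bz}+l_2e^{\frac{1}{2}bz}$, where $l_2^2=\frac{9}{8}p_1$ and $l_1^2=\frac{p_2^2}{8p_1}$, or $f(z)=l_3e^{\frac{3}{2}bz}+l_4e^{-\frac{1}{2}bz}$, where $l_4^2=\frac{9}{8}p_2$ and $l_3^2=\frac{p_1^2}{8p_2}$.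
   Context: $f^n$ denotes the $n$-th power of $f$ and $f'$ its derivative; "entire" means holomorphic on all of $\mathbb{C}$. *)

theory Defs
  imports "HOL-Complex_Analysis.Complex_Analysis"
begin

definition entire_solution ::
  "nat \<Rightarrow> complex \<Rightarrow> complex \<Rightarrow> complex \<Rightarrow> complex \<Rightarrow> (complex \<Rightarrow> complex) \<Rightarrow> bool" where
  "entire_solution n a p1 p2 b f \<longleftrightarrow>
     f holomorphic_on UNIV \<and>
     (\<forall>z. (f z) ^ n + a * (deriv f z) ^ n = p1 * exp (b * z) + p2 * exp (- (b * z)))"

end

theory Submission
  imports Defs
begin

text \<open>An affine substitution and a scaling turn the equation into \<open>f ^ n + a * f' ^ n = cosh z\<close>.
  A Gronwall estimate along rays shows that \<open>f\<close> has exponential type, and differentiating the equation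
  shows that \<open>f'\<close> divides \<open>sinh\<close> in the ring of entire functions of exponential type. So \<open>f'\<close> has simple
  zeros, all in \<open>\<i>\<pi>\<int>\<close>, and infinitely many of them, since otherwise \<open>f'\<close> would grow too slowly along
  one half of the real axis.

  If two solutions agree at a common zero of their derivatives, comparing orders of vanishing shows that
  they coincide, except for \<open>n = 2\<close> and \<open>a = - 2 (p - 1) / p\<^sup>2\<close>, where \<open>p\<close> is the order of contact.
  Outside this exception \<open>f\<close> inherits symmetries (translations for \<open>n \<ge> 3\<close>, point reflections for
  \<open>n = 2\<close>) from pairs of zeros of \<open>f'\<close>. These zeros therefore form an arithmetic progression, \<open>f'\<close> is an
  exponential times a hyperbolic sine, and comparing coefficients of exponentials determines \<open>f\<close>.

  For \<open>n = 2\<close> and \<open>a = - c\<^sup>2\<close> with \<open>c\<close> real, the reflection of \<open>f\<close> in the imaginary axis is another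
  solution. The functions \<open>f'\<close>, \<open>g = f + c f'\<close> and \<open>h = f - c f'\<close> have all their zeros on that axis, so the
  reflection multiplies each of them by an exponential. This gives a linear relation between \<open>g\<close> and
  \<open>h\<close> which, together with \<open>g h = cosh z\<close>, leaves only explicit solutions.\<close>

section \<open>Entire functions of exponential type\<close>

text \<open>Exponential type takes the place of value distribution theory: without zeros such a
  function is \<open>exp (l * z + m)\<close>, so two functions with the same simple zeros differ by
  such a factor once their quotient is known to be of exponential type. Divisibility into sinh
  supplies this: if \<open>P * K\<close> is sinh, then \<open>H / P = H * K / sinh\<close>, and sinh
  is bounded below away from its zeros. In degree two the symmetry can really fail. For normalised
  \<open>a = -4/9\<close>, the exceptional value with \<open>p = 3\<close>, multiples of
  \<open>exp (-3/2 * z) + 3 * exp (z/2)\<close> solve the equation and are not even about 0,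
  although 0 is a critical point. This is why all negative real \<open>a\<close> get a separate
  argument, in which \<open>- a\<close> is the square of a real number and the left-hand side splits
  into two factors dividing cosh. Translations serve for \<open>n >= 3\<close> because a point
  reflection changes the sign of \<open>a\<close> when \<open>n\<close> is odd. Point reflections
  serve for \<open>n = 2\<close> because they preserve the second derivative at their centre, so
  that the order of contact alone determines \<open>a\<close>.\<close>

definition exp_type :: "(complex \<Rightarrow> complex) \<Rightarrow> bool" where
  "exp_type f \<longleftrightarrow> (\<exists>C. \<forall>z. norm (f z) \<le> exp (C * (1 + norm z)))"

text \<open>A multiplicative constant can be moved into the exponent because
  \<open>A <= exp \<bar>A\<bar>\<close> and the summand 1 in \<open>1 + norm z\<close> leaves room
  for it.\<close>

lemma exp_typeI:
  assumes "\<And>z. norm (f z) \<le> A * exp (C * (1 + norm z))"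
  shows "exp_type f"
proof -
  have "norm (f z) \<le> exp ((\<bar>A\<bar> + C) * (1 + norm z))" for z
  proof -
    have "A \<le> exp \<bar>A\<bar>"
      using exp_ge_add_one_self[of "\<bar>A\<bar>"] by linarith
    also have "\<dots> \<le> exp (\<bar>A\<bar> * (1 + norm z))"
      by (simp add: mult_le_cancel_left1)
    finally have "A * exp (C * (1 + norm z)) \<le> exp (\<bar>A\<bar> * (1 + norm z)) * exp (C * (1 + norm z))"
      by (rule mult_right_mono) simp
    then show ?thesis
      using assms[of z] by (simp add: exp_add[symmetric] algebra_simps)
  qed
  then show ?thesis unfolding exp_type_def by blast
qed

lemma exp_typeE:
  assumes "exp_type f"
  obtains C where "C \<ge> 0" "\<And>z. norm (f z) \<le> exp (C * (1 + norm z))"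
proof -
  obtain C where C: "\<And>z. norm (f z) \<le> exp (C * (1 + norm z))"
    using assms unfolding exp_type_def by blast
  have "norm (f z) \<le> exp (\<bar>C\<bar> * (1 + norm z))" for z
    by (rule order_trans[OF C]) (simp add: mult_right_mono)
  then show ?thesis using that[of "\<bar>C\<bar>"] by simp
qed

lemma exp_type_mult:
  assumes "exp_type f" "exp_type g"
  shows "exp_type (\<lambda>z. f z * g z)"
proof -
  obtain C D where C: "\<And>z. norm (f z) \<le> exp (C * (1 + norm z))"
    and D: "\<And>z. norm (g z) \<le> exp (D * (1 + norm z))"
    using assms unfolding exp_type_def by blast
  have "norm (f z * g z) \<le> exp ((C + D) * (1 + norm z))" for z
    using mult_mono[OF C[of z] D[of z]] by (simp add: norm_mult exp_add[symmetric] algebra_simps)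
  then show ?thesis unfolding exp_type_def by blast
qed

lemma exp_type_add:
  assumes "exp_type f" "exp_type g"
  shows "exp_type (\<lambda>z. f z + g z)"
proof -
  obtain C where C: "C \<ge> 0" "\<And>z. norm (f z) \<le> exp (C * (1 + norm z))"
    using exp_typeE[OF assms(1)] by blast
  obtain D where D: "D \<ge> 0" "\<And>z. norm (g z) \<le> exp (D * (1 + norm z))"
    using exp_typeE[OF assms(2)] by blast
  have "norm (f z + g z) \<le> 2 * exp ((C + D) * (1 + norm z))" for z
  proof -
    have "exp (C * (1 + norm z)) \<le> exp ((C + D) * (1 + norm z))"
         "exp (D * (1 + norm z)) \<le> exp ((C + D) * (1 + norm z))"
      using C(1) D(1) by (auto intro!: mult_right_mono)
    then show ?thesis
      using norm_triangle_ineq[of "f z" "g z"] C(2)[of z] D(2)[of z] by linarith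
  qed
  then show ?thesis by (rule exp_typeI)
qed

lemma exp_type_const: "exp_type (\<lambda>z. c)"
  by (rule exp_typeI[where A="norm c" and C=0]) simp

lemma exp_type_cmult: "exp_type f \<Longrightarrow> exp_type (\<lambda>z. c * f z)"
  using exp_type_mult[OF exp_type_const[of c]] by simp

lemma exp_type_diff: "exp_type f \<Longrightarrow> exp_type g \<Longrightarrow> exp_type (\<lambda>z. f z - g z)"
  using exp_type_add[OF _ exp_type_cmult[of g "-1"], of f] by simp

lemma exp_type_power: "exp_type f \<Longrightarrow> exp_type (\<lambda>z. f z ^ k)"
  by (induction k) (auto intro: exp_type_mult exp_type_const)

lemma exp_type_affine:
  assumes "exp_type f"
  shows "exp_type (\<lambda>z. f (\<alpha> * z + \<beta>))"
proof -
  obtain C where C: "C \<ge> 0" "\<And>z. norm (f z) \<le> exp (C * (1 + norm z))"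
    using exp_typeE[OF assms(1)] by blast
  have "norm (f (\<alpha> * z + \<beta>)) \<le> exp ((C * (1 + norm \<alpha> + norm \<beta>)) * (1 + norm z))" for z
  proof -
    have "norm (\<alpha> * z + \<beta>) \<le> norm \<alpha> * norm z + norm \<beta>"
      using norm_triangle_ineq[of "\<alpha> * z" \<beta>] by (simp add: norm_mult)
    moreover have "norm z \<ge> 0" "norm \<alpha> \<ge> 0" "norm \<beta> * norm z \<ge> 0" by simp_all
    ultimately have "1 + norm (\<alpha> * z + \<beta>) \<le> (1 + norm \<alpha> + norm \<beta>) * (1 + norm z)"
      unfolding distrib_left distrib_right by linarith
    then have "C * (1 + norm (\<alpha> * z + \<beta>)) \<le> C * ((1 + norm \<alpha> + norm \<beta>) * (1 + norm z))"
      by (rule mult_left_mono) (rule C(1))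
    then show ?thesis
      using C(2)[of "\<alpha> * z + \<beta>"] by (smt (verit) exp_le_cancel_iff mult.assoc)
  qed
  then show ?thesis unfolding exp_type_def by blast
qed

text \<open>Cauchy's estimate on the unit circle about \<open>z\<close>: the norm of the argument
  grows by at most 1 there, which costs only the factor \<open>exp C\<close>.\<close>

lemma exp_type_deriv:
  assumes "f holomorphic_on UNIV" "exp_type f"
  shows "exp_type (deriv f)"
proof -
  obtain C where C: "C \<ge> 0" "\<And>z. norm (f z) \<le> exp (C * (1 + norm z))"
    using exp_typeE[OF assms(2)] by blast
  have "norm (deriv f z) \<le> exp C * exp (C * (1 + norm z))" for z
  proof -
    have "norm ((deriv ^^ 1) f z) \<le> fact 1 * exp (C * (2 + norm z)) / 1 ^ 1"
    proof (rule Cauchy_inequality)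
      show "norm (f x) \<le> exp (C * (2 + norm z))" if "norm (z - x) = 1" for x
      proof -
        have "norm x \<le> norm z + 1"
          using that by (smt (verit) norm_minus_commute norm_triangle_sub)
        then have "C * (1 + norm x) \<le> C * (2 + norm z)"
          using C(1) by (intro mult_left_mono) auto
        then show ?thesis using C(2)[of x] by (smt (verit) exp_le_cancel_iff)
      qed
    qed (use assms(1) in \<open>auto intro: holomorphic_on_subset holomorphic_on_imp_continuous_on\<close>)
    then show ?thesis by (simp add: exp_add[symmetric] algebra_simps)
  qed
  then show ?thesis by (rule exp_typeI)
qed

lemma cosh_complex_of_real: "cosh (complex_of_real x) = complex_of_real (cosh x)"
  by (simp add: cosh_field_def exp_of_real flip: of_real_minus)

lemma norm_cosh_sinh_le:
  fixes z :: complex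
  shows "norm (cosh z) \<le> exp (norm z)" "norm (sinh z) \<le> exp (norm z)"
proof -
  have "norm (exp z) \<le> exp (norm z)" "norm (exp (-z)) \<le> exp (norm z)"
    using norm_exp[of z] norm_exp[of "-z"] by simp_all
  then have "norm (exp z + exp (-z)) \<le> 2 * exp (norm z)" "norm (exp z - exp (-z)) \<le> 2 * exp (norm z)"
    using norm_triangle_ineq[of "exp z" "exp (-z)"] norm_triangle_ineq4[of "exp z" "exp (-z)"] by linarith+
  then show "norm (cosh z) \<le> exp (norm z)" "norm (sinh z) \<le> exp (norm z)"
    by (simp_all add: cosh_field_def sinh_field_def norm_divide)
qed

text \<open>The logarithm \<open>q\<close> of \<open>Q\<close> has real part of at most linear
  growth. A Borel-Caratheodory estimate turns this into linear growth of the modulus, and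
  Liouville's theorem makes \<open>q\<close> affine.\<close>

lemma entire_nonvanishing_exp_type:
  assumes hol: "Q holomorphic_on UNIV" and nz: "\<And>z. Q z \<noteq> 0" and "exp_type Q"
  obtains l m where "\<And>z. Q z = exp (l * z + m)"
proof -
  obtain q where q: "q holomorphic_on UNIV" "\<And>z. Q z = exp (q z)"
    using holomorphic_logarithm_exists[of UNIV Q 0] hol nz by (metis UNIV_I convex_UNIV open_UNIV)
  obtain C where C: "C \<ge> 0" "\<And>z. norm (Q z) \<le> exp (C * (1 + norm z))"
    using exp_typeE[OF assms(3)] by blast
  define p where "p = (\<lambda>z. q z - q 0)"
  define C' where "C' = C + norm (q 0) + 1"
  have C'0: "C' > 0" using C(1) by (simp add: C'_def add_nonneg_pos)
  have p0: "p 0 = 0" and hp: "p holomorphic_on UNIV"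
    unfolding p_def using q(1) by (auto intro!: holomorphic_intros)
  have rep: "Re (p z) < C' * (1 + norm z)" for z
  proof -
    have "Re (q z) \<le> C * (1 + norm z)"
      using C(2)[of z] by (simp add: q(2))
    moreover have "- Re (q 0) \<le> norm (q 0)"
      using abs_Re_le_cmod[of "q 0"] by linarith
    moreover have "norm (q 0) * norm z \<ge> 0" "norm z \<ge> 0" by simp_all
    ultimately show ?thesis
      unfolding p_def C'_def distrib_left distrib_right minus_complex.sel by linarith
  qed
  have bound: "norm (p z) \<le> 2 * C' * (1 + 2 * norm z)" if "z \<noteq> 0" for z
  proof -
    \<comment> \<open>With this radius \<open>z\<close> corresponds to a point of modulus 1/2 in the
      unit disc, and the Schwarz lemma gains the factor 1/2 that allows solving for
      \<open>norm (p z)\<close>.\<close>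
    define R where "R = 2 * norm z"
    define M where "M = C' * (1 + R)"
    have R0: "R > 0" using that by (simp add: R_def)
    have M0: "M > 0" using R0 C'0 by (simp add: M_def)
    have reM: "Re (p (of_real R * w)) < M" if "norm w < 1" for w
    proof -
      have "norm (of_real R * w) \<le> R"
        using that R0 by (simp add: norm_mult)
      then have "C' * (1 + norm (of_real R * w)) \<le> C' * (1 + R)"
        using C'0 by (intro mult_left_mono) auto
      then show ?thesis using rep[of "of_real R * w"] unfolding M_def by linarith
    qed
    have lt: "norm (p (of_real R * w)) < norm (2 * of_real M - p (of_real R * w))" if "norm w < 1" for w
    proof -
      define s where "s = p (of_real R * w)"
      have "Re s < M" using reM[OF that] by (simp add: s_def)
      then have "M * Re s < M * M" using M0 by simp
      then have "(norm s)\<^sup>2 < (norm (2 * of_real M - s))\<^sup>2"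
        unfolding cmod_power2 by (simp add: power2_eq_square algebra_simps)
      then show ?thesis unfolding s_def using power2_less_imp_less norm_ge_zero by blast
    qed
    \<comment> \<open>The Moebius map \<open>s / (2 * M - s)\<close> sends the half plane
      \<open>Re s < M\<close> into the unit disc and fixes 0.\<close>
    define \<phi> where "\<phi> = (\<lambda>w. p (of_real R * w) / (2 * of_real M - p (of_real R * w)))"
    have pol: "(\<lambda>w. p (of_real R * w)) holomorphic_on ball 0 1"
      using holomorphic_on_compose_gen[of "\<lambda>w. of_real R * w" "ball 0 1" p UNIV] hp
      by (auto simp: o_def intro!: holomorphic_intros)
    have "norm (\<phi> (z / of_real R)) \<le> norm (z / of_real R)"
    proof (rule Schwarz_Lemma(1))
      have "2 * of_real M - p (of_real R * w) \<noteq> 0" if "w \<in> ball 0 1" for w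
        using lt[of w] that by force
      then show "\<phi> holomorphic_on ball 0 1"
        unfolding \<phi>_def using pol by (intro holomorphic_intros) auto
      show "\<phi> 0 = 0" by (simp add: \<phi>_def p0)
      show "norm (\<phi> w) < 1" if "norm w < 1" for w
        using lt[OF that] by (auto simp: \<phi>_def norm_divide divide_less_eq)
      show "norm (z / of_real R) < 1"
        using that by (simp add: norm_divide R_def)
    qed
    also have "norm (z / of_real R) = 1/2" using that by (simp add: norm_divide R_def)
    finally have "norm (p z) \<le> norm (2 * of_real M - p z) / 2"
      using R0 lt[of "z / of_real R"] that by (auto simp: \<phi>_def norm_divide divide_le_eq R_def split: if_splits)
    also have "\<dots> \<le> (2 * M + norm (p z)) / 2"
      using norm_triangle_ineq4[of "2 * of_real M" "p z"] M0 by simp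
    finally show ?thesis by (simp add: M_def R_def)
  qed
  have lin: "p z = (\<Sum>k\<le>1. (deriv ^^ k) p 0 / fact k * z ^ k)" for z
  proof (rule Liouville_polynomial[OF hp, where A=1 and B="6 * C'"])
    fix z :: complex assume z: "1 \<le> norm z"
    have "norm (p z) \<le> 2 * C' * (1 + 2 * norm z)" by (rule bound) (use z in auto)
    also have "\<dots> \<le> 2 * C' * (3 * norm z)"
      using C'0 z by (intro mult_left_mono) auto
    finally show "norm (p z) \<le> 6 * C' * norm z ^ 1" by simp
  qed
  have "p z = deriv p 0 * z" for z
    using lin[of z] by (simp add: p0)
  then have "Q z = exp (deriv p 0 * z + q 0)" for z
    unfolding q(2) by (metis p_def diff_eq_eq)
  then show ?thesis by (rule that)
qed

section \<open>Divisors of the hyperbolic sine\<close>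

lemma sinh_eq_0_iff:
  fixes z :: complex
  shows "sinh z = 0 \<longleftrightarrow> (\<exists>k::int. z = \<i> * of_real (of_int k * pi))"
proof -
  have "sinh z = 0 \<longleftrightarrow> exp (2 * z) = 1"
    unfolding sinh_zero_iff exp_double power2_eq_1_iff by simp
  also have "\<dots> \<longleftrightarrow> (\<exists>k::int. z = \<i> * of_real (of_int k * pi))"
    unfolding exp_eq_1 by (auto simp: complex_eq_iff)
  finally show ?thesis .
qed

lemma entire_affine:
  assumes "f holomorphic_on UNIV"
  shows "(\<lambda>z. f (\<alpha> * z + \<beta>)) holomorphic_on UNIV"
proof -
  have "(\<lambda>z. \<alpha> * z + \<beta>) holomorphic_on UNIV" by (intro holomorphic_intros)
  from holomorphic_on_compose_gen[OF this assms] show ?thesis by (simp add: o_def)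
qed

lemma deriv_affine:
  fixes f :: "complex \<Rightarrow> complex"
  assumes "f holomorphic_on UNIV"
  shows "deriv (\<lambda>z. f (\<alpha> * z + \<beta>)) z = \<alpha> * deriv f (\<alpha> * z + \<beta>)"
proof -
  have "(f has_field_derivative deriv f (\<alpha> * z + \<beta>)) (at (\<alpha> * z + \<beta>))"
    using assms by (rule holomorphic_derivI) auto
  then have "((\<lambda>z. f (\<alpha> * z + \<beta>)) has_field_derivative deriv f (\<alpha> * z + \<beta>) * \<alpha>) (at z)"
    by (rule DERIV_chain2) (auto intro!: derivative_eq_intros)
  then show ?thesis by (simp add: DERIV_imp_deriv)
qed

text \<open>Where \<open>\<bar>Re z\<bar> >= 1\<close>, sinh has modulus at least 1 and can be
  divided out directly. In the remaining strip the maximum principle carries a bound from circles on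
  which sinh stays away from 0.\<close>

lemma exp_type_sinh_cancel:
  assumes hol: "Q holomorphic_on UNIV" and "exp_type (\<lambda>z. sinh z * Q z)"
  shows "exp_type Q"
proof -
  obtain C where C: "C \<ge> 0" "\<And>z. norm (sinh z * Q z) \<le> exp (C * (1 + norm z))"
    using exp_typeE[OF assms(2)] by blast
  have pi: "pi > 3" "pi < 3.2" using pi_gt3 pi_less_4 pi_approx by auto
  \<comment> \<open>The radius 3 is below pi, so the circle about a zero of sinh meets no other
    zero, and above \<open>1 + pi/2\<close>, so the discs of this radius about the zeros cover the
    strip \<open>\<bar>Re z\<bar> < 1\<close>.\<close>
  obtain w0 :: complex where w0: "norm w0 = 3" "\<And>w::complex. norm w = 3 \<Longrightarrow> norm (sinh w0) \<le> norm (sinh w)"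
  proof -
    have "continuous_on (sphere (0::complex) 3) (\<lambda>w. norm (sinh w))"
      by (intro continuous_intros)
    then show ?thesis
      using that continuous_attains_inf[of "sphere (0::complex) 3" "\<lambda>w. norm (sinh w)"] by auto
  qed
  define c where "c = norm (sinh w0)"
  have "sinh w0 \<noteq> 0"
  proof
    assume "sinh w0 = 0"
    then obtain k :: int where k: "w0 = \<i> * of_real (of_int k * pi)"
      unfolding sinh_eq_0_iff by blast
    then have *: "\<bar>of_int k\<bar> * pi = 3" using w0(1) by (simp add: norm_mult abs_mult)
    then have "k \<noteq> 0" by auto
    then have "\<bar>of_int k\<bar> \<ge> (1::real)" by linarith
    then have "\<bar>of_int k\<bar> * pi \<ge> 1 * pi" by (intro mult_right_mono) auto
    then show False using * pi by linarith
  qed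
  then have c0: "c > 0" by (simp add: c_def)
  have "norm (Q z) \<le> (1 + exp (6 * C) / c) * exp (C * (1 + norm z))" for z
  proof (cases "\<bar>Re z\<bar> \<ge> 1")
    case True
    have "\<bar>norm (exp z) - norm (exp (-z))\<bar> \<le> norm (exp z - exp (-z))"
      by (rule norm_triangle_ineq3)
    then have "\<bar>sinh (Re z)\<bar> \<le> norm (sinh z)"
      by (simp add: sinh_field_def norm_divide)
    moreover have "\<bar>Re z\<bar> \<le> \<bar>sinh (Re z)\<bar>" using real_le_abs_sinh[of "Re z"] by (simp add: sinh_field_def exp_minus)
    ultimately have "1 \<le> norm (sinh z)" using True by linarith
    then have "1 * norm (Q z) \<le> norm (sinh z) * norm (Q z)" by (intro mult_right_mono) auto
    also have "\<dots> \<le> 1 * exp (C * (1 + norm z))" using C(2)[of z] by (simp add: norm_mult)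
    also have "\<dots> \<le> (1 + exp (6 * C) / c) * exp (C * (1 + norm z))"
      using c0 by (intro mult_right_mono) auto
    finally show ?thesis by simp
  next
    case False
    \<comment> \<open>\<open>z0\<close> is the zero of sinh nearest to the height of
      \<open>z\<close>. As \<open>cosh z0\<close> is 1 or -1, the lower bound \<open>c\<close> found
      on the circle about 0 also holds about \<open>z0\<close>.\<close>
    define k where "k = round (Im z / pi)"
    define z0 where "z0 = \<i> * of_real (of_int k * pi)"
    have "\<bar>Im z / pi - of_int k\<bar> \<le> 1/2"
      using of_int_round_abs_le[of "Im z / pi"] by (simp add: k_def abs_minus_commute)
    then have "\<bar>Im z / pi - of_int k\<bar> * pi \<le> 1/2 * pi" by (intro mult_right_mono) auto
    also have "\<bar>Im z / pi - of_int k\<bar> * pi = \<bar>(Im z / pi - of_int k) * pi\<bar>" by (simp add: abs_mult)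
    also have "(Im z / pi - of_int k) * pi = Im z - of_int k * pi" by (simp add: left_diff_distrib)
    finally have im: "\<bar>Im z - of_int k * pi\<bar> \<le> pi / 2" by simp
    have d: "norm (z - z0) < 3"
      using cmod_le[of "z - z0"] im False pi by (simp add: z0_def)
    have "norm (Q z) \<le> exp (6 * C) / c * exp (C * (1 + norm z))"
    proof (rule maximum_modulus_frontier[of Q "ball z0 3"])
      show "z \<in> ball z0 3" using d by (simp add: dist_norm norm_minus_commute)
      fix w assume "w \<in> frontier (ball z0 3)"
      then have w: "norm (w - z0) = 3" by (simp add: dist_norm norm_minus_commute)
      have "sinh w = sinh (w - z0) * cosh z0 + cosh (w - z0) * sinh z0"
        by (metis diff_add_cancel sinh_add)
      moreover have "sinh z0 = 0" unfolding sinh_eq_0_iff z0_def by blast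
      ultimately have sw: "sinh w = sinh (w - z0) * cosh z0" and "cosh z0 ^ 2 = 1"
        by (simp_all add: cosh_square_eq)
      then have "norm (cosh z0) = 1" by (auto simp: power2_eq_1_iff)
      then have "c \<le> norm (sinh w)" using w0(2)[OF w] by (simp add: sw norm_mult c_def)
      then have "c * norm (Q w) \<le> norm (sinh w * Q w)" by (simp add: norm_mult mult_right_mono)
      also have "\<dots> \<le> exp (C * (1 + norm w))" by (rule C(2))
      also have "\<dots> \<le> exp (6 * C + C * (1 + norm z))"
      proof -
        have "norm w \<le> norm (w - z0) + norm (z - z0) + norm z"
          by norm
        then have "norm w \<le> 6 + norm z" using w d by linarith
        then have "C * (1 + norm w) \<le> C * (7 + norm z)" using C(1) by (intro mult_left_mono) auto
        then show ?thesis by (simp add: algebra_simps)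
      qed
      finally have "c * norm (Q w) \<le> exp (6 * C) * exp (C * (1 + norm z))"
        by (simp only: exp_add)
      then show "norm (Q w) \<le> exp (6 * C) / c * exp (C * (1 + norm z))"
        using c0 by (simp only: times_divide_eq_left pos_le_divide_eq mult.commute[of c])
    qed (use hol in \<open>auto intro: holomorphic_on_subset holomorphic_on_imp_continuous_on\<close>)
    also have "\<dots> \<le> (1 + exp (6 * C) / c) * exp (C * (1 + norm z))"
      by (intro mult_right_mono) auto
    finally show ?thesis .
  qed
  then show ?thesis by (rule exp_typeI)
qed

text \<open>At a zero \<open>z0\<close> of \<open>P\<close> numerator and denominator are both
  divided by \<open>z - z0\<close>. The zero is simple, so the reduced denominator is nonzero and
  the singularity is removable with value \<open>deriv H z0 / deriv P z0\<close>.\<close>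

lemma entire_quotient:
  assumes H: "H holomorphic_on UNIV" and P: "P holomorphic_on UNIV"
    and zeros: "\<And>z. P z = 0 \<Longrightarrow> H z = 0 \<and> deriv P z \<noteq> 0"
  obtains Q where "Q holomorphic_on UNIV" "\<And>z. H z = P z * Q z"
proof -
  define Q where "Q = (\<lambda>z. if P z = 0 then deriv H z / deriv P z else H z / P z)"
  have "\<exists>U. open U \<and> z0 \<in> U \<and> Q holomorphic_on U" for z0
  proof (cases "P z0 = 0")
    case False
    have "open {z. P z \<noteq> 0}"
      using P by (auto intro!: open_Collect_neq holomorphic_on_imp_continuous_on)
    moreover have "Q holomorphic_on {z. P z \<noteq> 0}"
      by (rule holomorphic_transform[of "\<lambda>z. H z / P z"])
        (use H P in \<open>auto simp: Q_def intro!: holomorphic_intros intro: holomorphic_on_subset\<close>)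
    ultimately show ?thesis using False by blast
  next
    case True
    define h where "h = (\<lambda>z. if z = z0 then deriv H z0 else (H z - H z0) / (z - z0))"
    define p where "p = (\<lambda>z. if z = z0 then deriv P z0 else (P z - P z0) / (z - z0))"
    have hol: "h holomorphic_on UNIV" "p holomorphic_on UNIV"
      unfolding h_def p_def using H P by (auto intro!: pole_lemma_open)
    have "open {z. p z \<noteq> 0}"
      using hol(2) by (auto intro!: open_Collect_neq holomorphic_on_imp_continuous_on)
    moreover have "Q holomorphic_on {z. p z \<noteq> 0}"
    proof (rule holomorphic_transform[of "\<lambda>z. h z / p z"])
      show "(\<lambda>z. h z / p z) holomorphic_on {z. p z \<noteq> 0}"
        using hol by (auto intro!: holomorphic_intros intro: holomorphic_on_subset)
      show "h z / p z = Q z" if "z \<in> {z. p z \<noteq> 0}" for z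
        using that True zeros[of z0] by (auto simp: h_def p_def Q_def)
    qed
    moreover have "p z0 \<noteq> 0" using zeros[OF True] by (simp add: p_def)
    ultimately show ?thesis by blast
  qed
  then have "Q holomorphic_on UNIV"
    by (metis (no_types, lifting) UNIV_I analytic_on_open analytic_on_holomorphic analytic_on_analytic_at open_UNIV holomorphic_on_open
        field_differentiable_def)
  moreover have "H z = P z * Q z" for z
    using zeros[of z] by (auto simp: Q_def)
  ultimately show ?thesis using that by blast
qed

lemma deriv_mult_entire:
  assumes "f holomorphic_on UNIV" "g holomorphic_on UNIV"
  shows "deriv (\<lambda>z. f z * g z) z = f z * deriv g z + deriv f z * g z"
  using assms by (intro deriv_mult) (auto simp: holomorphic_on_def)

text \<open>The quotient \<open>Q\<close> of \<open>H\<close> by \<open>P\<close> has no zeros,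
  since those of \<open>H\<close> and \<open>P\<close> agree and are simple. Its exponential type
  comes from \<open>sinh * Q = K * H\<close>, after a change of variable that turns
  \<open>\<alpha> * z + \<beta>\<close> into the argument of sinh.\<close>

lemma quotient_is_exp:
  assumes H: "H holomorphic_on UNIV" "exp_type H" and P: "P holomorphic_on UNIV"
    and K: "exp_type K" "\<And>z. P z * K z = sinh (\<alpha> * z + \<beta>)" and "\<alpha> \<noteq> 0"
    and iff: "\<And>z. H z = 0 \<longleftrightarrow> P z = 0"
    and simple: "\<And>z. P z = 0 \<Longrightarrow> deriv P z \<noteq> 0 \<and> deriv H z \<noteq> 0"
  obtains l m where "\<And>z. H z = P z * exp (l * z + m)"
proof -
  obtain Q where Q: "Q holomorphic_on UNIV" "\<And>z. H z = P z * Q z"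
    using entire_quotient[OF H(1) P] iff simple by metis
  have nz: "Q z \<noteq> 0" for z
  proof (cases "P z = 0")
    case True
    have "deriv H z = P z * deriv Q z + deriv P z * Q z"
      using deriv_mult_entire[OF P Q(1)] Q(2) by presburger
    then show ?thesis using True simple by auto
  next
    case False
    then show ?thesis using Q(2) iff by force
  qed
  define q where "q = (\<lambda>w. Q (1 / \<alpha> * w + (- \<beta> / \<alpha>)))"
  have q: "q holomorphic_on UNIV"
    unfolding q_def by (rule entire_affine[OF Q(1)])
  have "sinh w * q w = (\<lambda>z. K z * H z) (1 / \<alpha> * w + (- \<beta> / \<alpha>))" for w
  proof -
    have "w = \<alpha> * (1 / \<alpha> * w + (- \<beta> / \<alpha>)) + \<beta>" using \<open>\<alpha> \<noteq> 0\<close> by (simp add: field_simps)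
    then have "sinh w = P (1 / \<alpha> * w + (- \<beta> / \<alpha>)) * K (1 / \<alpha> * w + (- \<beta> / \<alpha>))"
      using K(2) by metis
    then show ?thesis by (simp add: q_def Q(2))
  qed
  moreover have "exp_type (\<lambda>w. (\<lambda>z. K z * H z) (1 / \<alpha> * w + (- \<beta> / \<alpha>)))"
    by (rule exp_type_affine[OF exp_type_mult[OF K(1) H(2)]])
  ultimately have "exp_type (\<lambda>w. sinh w * q w)" by presburger
  then have "exp_type q" using exp_type_sinh_cancel[OF q] by blast
  then have "exp_type (\<lambda>z. q (\<alpha> * z + \<beta>))" by (rule exp_type_affine)
  moreover have "q (\<alpha> * z + \<beta>) = Q z" for z
    using \<open>\<alpha> \<noteq> 0\<close> by (simp add: q_def add_divide_distrib)
  ultimately have "exp_type Q" by simp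
  then show ?thesis
    using entire_nonvanishing_exp_type[OF Q(1) nz] Q(2) that by metis
qed

section \<open>Exponential sums and orders of zeros\<close>

lemma entire_deriv: "f holomorphic_on UNIV \<Longrightarrow> deriv f holomorphic_on UNIV"
  by (rule holomorphic_deriv) auto

text \<open>Induction on the set of exponents: after division by \<open>exp (m * z)\<close> the term
  of \<open>m\<close> is constant, and differentiation removes it while multiplying the other
  coefficients by the nonzero numbers \<open>l - m\<close>.\<close>

lemma exp_independent_set:
  assumes "finite A" "\<And>z::complex. (\<Sum>l\<in>A. c l * exp (l * z)) = 0"
  shows "\<forall>l\<in>A. c l = 0"
  using assms
proof (induction A arbitrary: c rule: finite_induct)
  case (insert m A)
  have eq: "(\<Sum>l\<in>A. c l * exp ((l - m) * z)) = - c m" for z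
  proof -
    have "(\<Sum>l\<in>insert m A. c l * exp (l * z)) * exp (- (m * z)) = 0"
      using insert.prems by simp
    then have "c m * exp (m * z) * exp (- (m * z)) + (\<Sum>l\<in>A. c l * exp (l * z) * exp (- (m * z))) = 0"
      using insert.hyps by (simp add: distrib_right sum_distrib_right)
    then have "c m * (exp (m * z) * exp (- (m * z))) + (\<Sum>l\<in>A. c l * exp ((l - m) * z)) = 0"
      by (simp add: mult.assoc exp_add[symmetric] left_diff_distrib)
    then show ?thesis by (simp add: exp_add[symmetric] eq_neg_iff_add_eq_0 add.commute)
  qed
  have "(\<Sum>l\<in>A. c l * (l - m) * exp (l * z)) = 0" for z
  proof -
    have "((\<lambda>z. \<Sum>l\<in>A. c l * exp ((l - m) * z)) has_field_derivative
        (\<Sum>l\<in>A. c l * (exp ((l - m) * z) * (l - m)))) (at z)"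
      by (auto intro!: derivative_eq_intros sum.cong)
    moreover have "((\<lambda>z. \<Sum>l\<in>A. c l * exp ((l - m) * z)) has_field_derivative 0) (at z)"
      unfolding eq by simp
    ultimately have "(\<Sum>l\<in>A. c l * (exp ((l - m) * z) * (l - m))) = 0"
      by (rule DERIV_unique)
    moreover have "c l * (l - m) * exp (l * z) = exp (m * z) * (c l * (exp ((l - m) * z) * (l - m)))" for l
    proof -
      have "exp (l * z) = exp (m * z) * exp ((l - m) * z)"
        by (simp add: exp_add[symmetric] algebra_simps)
      then show ?thesis by simp
    qed
    ultimately show ?thesis by (simp only: sum_distrib_left[symmetric] mult_zero_right)
  qed
  then have "\<forall>l\<in>A. c l * (l - m) = 0" by (rule insert.IH)
  then have A: "\<forall>l\<in>A. c l = 0" using insert.hyps by auto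
  with eq[of 0] have "c m = 0" by simp
  with A show ?case by simp
qed auto

text \<open>A list may repeat exponents, so it can be written down before it is known which
  exponents coincide for particular parameters; the conclusion adds up the coefficients that meet at
  \<open>m\<close>.\<close>

lemma exp_independent:
  assumes "\<And>z::complex. (\<Sum>(c, l)\<leftarrow>xs. c * exp (l * z)) = 0"
  shows "(\<Sum>(c, l)\<leftarrow>xs. if l = m then c else 0) = 0"
proof -
  define A where "A = insert m (snd ` set xs)"
  have A: "finite A" "m \<in> A" "snd ` set xs \<subseteq> A" by (auto simp: A_def)
  have "(\<Sum>(c, l)\<leftarrow>xs. c * exp (l * z)) = (\<Sum>k\<in>A. (\<Sum>(c, l)\<leftarrow>xs. if l = k then c else 0) * exp (k * z))"
    for z
    using A(3)
  proof (induction xs)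
    case (Cons x xs)
    obtain c l where x: "x = (c, l)" by force
    have "(\<Sum>k\<in>A. (if l = k then c else 0) * exp (k * z)) = (\<Sum>k\<in>A. if l = k then c * exp (k * z) else 0)"
      by (rule sum.cong) auto
    also have "\<dots> = c * exp (l * z)"
      using A(1) Cons.prems by (simp add: x)
    finally show ?case
      using Cons by (simp add: x distrib_right sum.distrib)
  qed auto
  then have "\<forall>k\<in>A. (\<Sum>(c, l)\<leftarrow>xs. if l = k then c else 0) = 0"
    using exp_independent_set[OF A(1), of "\<lambda>k. \<Sum>(c, l)\<leftarrow>xs. if l = k then c else 0"] assms by simp
  then show ?thesis using A(2) by blast
qed

text \<open>If \<open>u\<close> vanishes to order \<open>p\<close> at \<open>z0\<close>, then
  \<open>deriv u / u\<close> behaves like \<open>p / (z - z0)\<close>, while \<open>V\<close>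
  behaves like \<open>deriv V z0 * (z - z0)\<close>. The conclusion compares leading coefficients in
  the equation.\<close>

lemma zero_order_balance:
  assumes hol: "u holomorphic_on UNIV" "U holomorphic_on UNIV" "V holomorphic_on UNIV"
    and eq: "\<And>z. u z * U z = - a * (deriv u z * V z)"
    and z0: "u z0 = 0" "V z0 = 0" and nz: "u z1 \<noteq> 0"
  obtains p :: nat where "p \<ge> 1" "U z0 = - a * of_nat p * deriv V z0"
proof -
  have "\<not> u constant_on UNIV" using z0(1) nz unfolding constant_on_def by (metis UNIV_I)
  then obtain g r n where n: "0 < n" "0 < r" "g holomorphic_on ball z0 r"
      and ug: "\<And>w. w \<in> ball z0 r \<Longrightarrow> u w = (w - z0) ^ n * g w"
      and gnz: "\<And>w. w \<in> ball z0 r \<Longrightarrow> g w \<noteq> 0"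
    using holomorphic_factor_zero_nonconstant[OF hol(1) open_UNIV connected_UNIV UNIV_I z0(1)] by metis
  define V1 where "V1 = (\<lambda>z. if z = z0 then deriv V z0 else (V z - V z0) / (z - z0))"
  have V1: "V1 holomorphic_on UNIV"
    unfolding V1_def using hol(3) by (intro pole_lemma_open) auto
  have VV1: "V w = (w - z0) * V1 w" for w by (simp add: V1_def z0)
  have du: "deriv u w = of_nat n * (w - z0) ^ (n - 1) * g w + (w - z0) ^ n * deriv g w"
    if w: "w \<in> ball z0 r" for w
  proof -
    have "(g has_field_derivative deriv g w) (at w)"
      using n(3) w by (intro holomorphic_derivI[of g "ball z0 r"]) auto
    then have "((\<lambda>w. (w - z0) ^ n * g w) has_field_derivative
        of_nat n * (w - z0) ^ (n - 1) * g w + (w - z0) ^ n * deriv g w) (at w)"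
      by (auto intro!: derivative_eq_intros)
    then have "(u has_field_derivative
        of_nat n * (w - z0) ^ (n - 1) * g w + (w - z0) ^ n * deriv g w) (at w)"
      by (rule has_field_derivative_transform_within_open[of _ _ _ "ball z0 r"]) (use w ug in auto)
    then show ?thesis by (rule DERIV_imp_deriv)
  qed
  \<comment> \<open>\<open>D\<close> is the equation with the common factor
    \<open>(w - z0) ^ n\<close> removed. It vanishes for \<open>w\<close> near but different from
    \<open>z0\<close>, hence by continuity also at \<open>z0\<close>.\<close>
  define D where "D = (\<lambda>w. g w * U w + a * ((of_nat n * g w + (w - z0) * deriv g w) * V1 w))"
  have "D w = 0" if w: "w \<in> ball z0 r" "w \<noteq> z0" for w
  proof -
    have pow: "(w - z0) ^ n = (w - z0) ^ (n - 1) * (w - z0)"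
      using n(1) by (metis power_minus_mult)
    have "(w - z0) ^ n * D w = 0"
      using eq[of w] unfolding D_def ug[OF w(1)] du[OF w(1)] VV1[of w] pow by (simp add: algebra_simps)
    then show ?thesis using w(2) by simp
  qed
  then have "eventually (\<lambda>w. D w = 0) (at z0)"
    using n(2) unfolding eventually_at by (metis dist_commute mem_ball)
  then have "(D \<longlongrightarrow> 0) (at z0)" by (rule tendsto_eventually)
  moreover have "(D \<longlongrightarrow> D z0) (at z0)"
  proof -
    have "D holomorphic_on ball z0 r"
      unfolding D_def using n(3) hol V1
      by (auto intro!: holomorphic_intros intro: holomorphic_on_subset)
    then have "isCont D z0"
      using n(2) holomorphic_on_imp_continuous_on continuous_on_eq_continuous_at[of "ball z0 r" D] by auto
    then show ?thesis by (simp add: isCont_def)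
  qed
  ultimately have "D z0 = 0" using LIM_unique by blast
  then have "g z0 * (U z0 + a * of_nat n * deriv V z0) = 0"
    by (simp add: D_def V1_def algebra_simps)
  then have "U z0 = - a * of_nat n * deriv V z0"
    using gnz[of z0] n(2) by (simp add: eq_neg_iff_add_eq_0)
  then show ?thesis using that[of n] n(1) by simp
qed

text \<open>Each zero is divided out at the price of one power of \<open>1 + norm z\<close>, until a
  function without zeros remains. The single factor \<open>exp (l * z)\<close> matters: it is
  bounded on one half of the real axis.\<close>

lemma finite_zeros_bound:
  assumes "H holomorphic_on UNIV" "exp_type H" "finite {z. H z = 0}"
    and "\<And>z. H z = 0 \<Longrightarrow> deriv H z \<noteq> 0"
  shows "\<exists>C k l. \<forall>z. norm (H z) \<le> C * (1 + norm z) ^ k * norm (exp (l * z))"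
  using assms
proof (induction "card {z. H z = 0}" arbitrary: H)
  case 0
  then have "H z \<noteq> 0" for z by simp
  then obtain l m where "\<And>z. H z = exp (l * z + m)"
    using entire_nonvanishing_exp_type[OF 0(2) _ 0(3)] by blast
  then have "norm (H z) \<le> norm (exp m) * (1 + norm z) ^ 0 * norm (exp (l * z))" for z
    by (simp add: exp_add norm_mult)
  then show ?case by blast
next
  case (Suc n)
  then obtain z0 where z0: "H z0 = 0"
    by (metis (mono_tags, lifting) card_eq_0_iff empty_Collect_eq nat.distinct(1))
  define K where "K = (\<lambda>z. if z = z0 then deriv H z0 else (H z - H z0) / (z - z0))"
  have K: "K holomorphic_on UNIV"
    unfolding K_def using Suc.prems(1) by (intro pole_lemma_open) auto
  have HK: "H z = (z - z0) * K z" for z by (simp add: K_def z0)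
  have Kz0: "K z0 \<noteq> 0" using Suc.prems(4)[OF z0] by (simp add: K_def)
  have zK: "{z. K z = 0} = {z. H z = 0} - {z0}"
    using Kz0 HK by auto
  obtain C where C: "C \<ge> 0" "\<And>z. norm (H z) \<le> exp (C * (1 + norm z))"
    using exp_typeE[OF Suc.prems(2)] by blast
  have "norm (K z) \<le> exp (2 * C) * exp (C * (1 + norm z))" for z
  proof (cases "norm (z - z0) \<ge> 1")
    case True
    then have "1 * norm (K z) \<le> norm (z - z0) * norm (K z)" by (intro mult_right_mono) auto
    also have "\<dots> \<le> 1 * exp (C * (1 + norm z))" using C(2)[of z] by (simp add: HK norm_mult)
    also have "\<dots> \<le> exp (2 * C) * exp (C * (1 + norm z))"
      using C(1) by (intro mult_right_mono) auto
    finally show ?thesis by simp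
  next
    case False
    show ?thesis
    \<comment> \<open>Close to \<open>z0\<close> division by \<open>z - z0\<close> gives no bound;
      the maximum principle imports one from the circle where \<open>z - z0\<close> has modulus
      1.\<close>
    proof (rule maximum_modulus_frontier[of K "ball z0 1"])
      show "z \<in> ball z0 1" using False by (simp add: dist_norm norm_minus_commute)
      fix w assume "w \<in> frontier (ball z0 1)"
      then have w: "norm (w - z0) = 1" by (simp add: dist_norm norm_minus_commute)
      have "norm w \<le> norm (w - z0) + norm (z - z0) + norm z" by norm
      then have "norm w \<le> 2 + norm z" using w False by linarith
      then have "C * (1 + norm w) \<le> C * (3 + norm z)" using C(1) by (intro mult_left_mono) auto
      then have "exp (C * (1 + norm w)) \<le> exp (2 * C) * exp (C * (1 + norm z))"
        by (simp add: exp_add[symmetric] algebra_simps)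
      then show "norm (K w) \<le> exp (2 * C) * exp (C * (1 + norm z))"
        using C(2)[of w] w by (simp add: HK norm_mult)
    qed (use K in \<open>auto intro: holomorphic_on_subset holomorphic_on_imp_continuous_on\<close>)
  qed
  then have "exp_type K" by (rule exp_typeI)
  moreover have "deriv K z \<noteq> 0" if "K z = 0" for z
  proof -
    have "H = (\<lambda>z. (z - z0) * K z)" using HK by blast
    then have "deriv H z = (z - z0) * deriv K z + deriv (\<lambda>z. z - z0) z * K z"
      using deriv_mult_entire[of "\<lambda>z. z - z0" K z] K by (simp add: holomorphic_intros)
    then have "deriv H z = (z - z0) * deriv K z" using that by simp
    then show ?thesis using Suc.prems(4)[of z] HK[of z] that by auto
  qed
  moreover have "n = card {z. K z = 0}"
    using Suc.hyps(2) z0 Suc.prems(3) unfolding zK by (simp add: card_Diff_singleton)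
  moreover have "finite {z. K z = 0}" using Suc.prems(3) unfolding zK by simp
  ultimately obtain C k l where b: "\<And>z. norm (K z) \<le> C * (1 + norm z) ^ k * norm (exp (l * z))"
    using Suc.hyps(1)[of K] K by blast
  have "norm (H z) \<le> (1 + norm z0) * C * (1 + norm z) ^ Suc k * norm (exp (l * z))" for z
  proof -
    have "norm (z - z0) \<le> (1 + norm z0) * (1 + norm z)"
      using norm_triangle_ineq4[of z z0] mult_nonneg_nonneg[OF norm_ge_zero[of z0] norm_ge_zero[of z]]
      unfolding distrib_left distrib_right by linarith
    then have "norm (z - z0) * norm (K z) \<le> ((1 + norm z0) * (1 + norm z)) * (C * (1 + norm z) ^ k * norm (exp (l * z)))"
      by (intro mult_mono b) auto
    then show ?thesis by (simp add: HK norm_mult mult_ac)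
  qed
  then show ?case by blast
qed

section \<open>The normalised equation\<close>

lemma power_not_dominates_cosh:
  fixes D :: real
  shows "\<exists>x\<ge>0. D * (1 + x) ^ m < cosh x"
proof -
  have "((\<lambda>x::real. (1 + x) ^ m / cosh x) \<longlongrightarrow> 0) at_top"
  proof -
    have lim: "((\<lambda>x::real. 2 * 2 ^ m * (x ^ m / exp x)) \<longlongrightarrow> 2 * 2 ^ m * 0) at_top"
      by (intro tendsto_intros tendsto_power_div_exp_0)
    show ?thesis
    proof (rule Lim_null_comparison[where g="\<lambda>x. 2 * 2 ^ m * (x ^ m / exp x)"])
      show "eventually (\<lambda>x::real. norm ((1 + x) ^ m / cosh x) \<le> 2 * 2 ^ m * (x ^ m / exp x)) at_top"
        using eventually_ge_at_top[of 1]
      proof eventually_elim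
        case (elim x)
        have "(1 + x) ^ m \<le> (2 * x) ^ m" using elim by (intro power_mono) auto
        moreover have "exp x / 2 \<le> cosh x" by (simp add: cosh_field_def)
        ultimately have "(1 + x) ^ m / cosh x \<le> (2 * x) ^ m / (exp x / 2)"
          using elim by (intro frac_le) auto
        then show ?case using elim by (simp add: power_mult_distrib mult_ac)
      qed
    qed (use lim in simp)
  qed
  then have "((\<lambda>x::real. \<bar>D\<bar> * ((1 + x) ^ m / cosh x)) \<longlongrightarrow> \<bar>D\<bar> * 0) at_top"
    by (intro tendsto_intros)
  then have "eventually (\<lambda>x::real. \<bar>D\<bar> * ((1 + x) ^ m / cosh x) < 1) at_top"
    by (rule order_tendstoD) simp
  then have "eventually (\<lambda>x::real. x \<ge> 0 \<and> \<bar>D\<bar> * ((1 + x) ^ m / cosh x) < 1) at_top"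
    using eventually_ge_at_top[of 0] by eventually_elim simp
  then obtain x :: real where x: "x \<ge> 0" "\<bar>D\<bar> * ((1 + x) ^ m / cosh x) < 1"
    using eventually_happens'[OF trivial_limit_at_top_linorder] by blast
  then have "\<bar>D\<bar> * (1 + x) ^ m < cosh x" by (simp add: divide_less_eq)
  moreover have "D * (1 + x) ^ m \<le> \<bar>D\<bar> * (1 + x) ^ m"
    using x(1) by (intro mult_right_mono) auto
  ultimately show ?thesis using x(1) by (intro exI[of _ x]) linarith
qed

text \<open>The parameter \<open>a\<close> stands for \<open>a * b ^ n\<close> of the original
  equation, since rescaling the variable by \<open>b\<close> moves \<open>b ^ n\<close> to the
  derivative term.\<close>

locale cosh_equation =
  fixes n :: nat and a :: complex and f :: "complex \<Rightarrow> complex"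
  assumes n2: "n \<ge> 2" and a0: "a \<noteq> 0" and hol: "f holomorphic_on UNIV"
    and eq: "\<And>z. f z ^ n + a * deriv f z ^ n = cosh z"
begin

lemma hol': "deriv f holomorphic_on UNIV" and hol'': "deriv (deriv f) holomorphic_on UNIV"
  by (intro entire_deriv hol)+

lemma D0: "(f has_field_derivative deriv f z) (at z)"
  and D1: "(deriv f has_field_derivative deriv (deriv f) z) (at z)"
  by (rule holomorphic_derivI[OF hol open_UNIV UNIV_I] holomorphic_derivI[OF hol' open_UNIV UNIV_I])+

lemma deriv_bound:
  obtains K where "K \<ge> 1" "\<And>z. norm (deriv f z) \<le> K * (norm (f z) + exp (norm z))"
proof -
  \<comment> \<open>\<open>K >= 1 / norm a\<close> absorbs the coefficient, and
    \<open>K >= 1\<close> gives \<open>K <= K ^ n\<close>, so that an \<open>n\<close>-th root can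
    be taken.\<close>
  define K where "K = max 1 (1 / norm a)"
  have K1: "K \<ge> 1" "K \<ge> 1 / norm a" by (auto simp: K_def)
  have "norm (deriv f z) \<le> K * (norm (f z) + exp (norm z))" for z
  proof -
    let ?w = "norm (f z) + exp (norm z)"
    have "a * deriv f z ^ n = cosh z - f z ^ n" using eq[of z] by (simp add: algebra_simps)
    then have "norm a * norm (deriv f z) ^ n = norm (cosh z - f z ^ n)"
      by (simp only: norm_mult[symmetric] norm_power[symmetric])
    also have "\<dots> \<le> norm (cosh z) + norm (f z ^ n)" by (rule norm_triangle_ineq4)
    also have "norm (cosh z) \<le> exp (norm z) ^ n"
    proof -
      have "exp (norm z) ^ 1 \<le> exp (norm z) ^ n" using n2 by (intro power_increasing) auto
      then show ?thesis using norm_cosh_sinh_le(1)[of z] by simp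
    qed
    also have "exp (norm z) ^ n + norm (f z ^ n) \<le> ?w ^ n"
    proof -
      obtain k where k: "n = Suc k" using n2 by (cases n) auto
      have "exp (norm z) ^ k \<le> ?w ^ k" "norm (f z) ^ k \<le> ?w ^ k" by (auto intro!: power_mono)
      then have "exp (norm z) * exp (norm z) ^ k + norm (f z) * norm (f z) ^ k
          \<le> exp (norm z) * ?w ^ k + norm (f z) * ?w ^ k"
        by (intro add_mono mult_left_mono) auto
      then show ?thesis by (simp add: k norm_power distrib_right norm_mult)
    qed
    finally have *: "norm a * norm (deriv f z) ^ n \<le> ?w ^ n" by simp
    have "norm (deriv f z) ^ n = 1 / norm a * (norm a * norm (deriv f z) ^ n)" using a0 by simp
    also have "\<dots> \<le> K * ?w ^ n" using K1 * by (intro mult_mono) auto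
    also have "\<dots> \<le> K ^ n * ?w ^ n"
      using K1(1) n2 power_increasing[of 1 n K] by (intro mult_right_mono) auto
    finally have "norm (deriv f z) ^ n \<le> (K * ?w) ^ n" by (simp add: power_mult_distrib)
    then show ?thesis
      using power_mono_iff[of "norm (deriv f z)" "K * ?w" n] n2 K1(1) by simp
  qed
  then show ?thesis using that K1(1) by blast
qed

section \<open>Growth of solutions\<close>

lemma exp_type_f: "exp_type f"
proof -
  obtain K where K: "K \<ge> 1" "\<And>z. norm (deriv f z) \<le> K * (norm (f z) + exp (norm z))"
    using deriv_bound by blast
  have bound: "norm (f z) ^ 2 \<le> exp (4 * K * norm z) * (norm (f 0) ^ 2 + 2 * K * norm z)" for z
  proof -
    obtain \<zeta> where \<zeta>: "norm \<zeta> = 1" "z = of_real (norm z) * \<zeta>"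
    proof (cases "z = 0")
      case False
      then show ?thesis by (intro that[of "z / of_real (norm z)"]) (auto simp: norm_divide)
    qed (use that[of 1] in auto)
    define \<phi> where "\<phi> = (\<lambda>x::real. f (of_real x * \<zeta>))"
    define \<phi>' where "\<phi>' = (\<lambda>x::real. deriv f (of_real x * \<zeta>) * \<zeta>)"
    \<comment> \<open>The squared modulus is used because the modulus itself need not be
      differentiable at zeros. By the bound on \<open>deriv f\<close>, the derivative of the square
      is at most \<open>3 * K\<close> times the square plus \<open>K * exp (2 * x)\<close>; the
      weight \<open>exp (- 4 * K * x)\<close> beats the first term, and the subtracted linear term
      absorbs the rest.\<close>
    define h where "h = (\<lambda>x. exp (- 4 * K * x) * (Re (\<phi> x) ^ 2 + Im (\<phi> x) ^ 2) - 2 * K * x)"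
    have vd: "(\<phi> has_vector_derivative \<phi>' x) (at x)" for x
    proof -
      have "((\<lambda>w. f (w * \<zeta>)) has_field_derivative \<phi>' x) (at (of_real x))"
        unfolding \<phi>'_def by (rule DERIV_chain2[OF D0]) (auto intro!: derivative_eq_intros)
      then show ?thesis unfolding \<phi>_def by (rule has_vector_derivative_real_field)
    qed
    have dRe: "((\<lambda>x. Re (\<phi> x)) has_real_derivative Re (\<phi>' x)) (at x)"
      and dIm: "((\<lambda>x. Im (\<phi> x)) has_real_derivative Im (\<phi>' x)) (at x)" for x
      using vd[of x] by (auto simp: has_real_derivative_iff_has_vector_derivative
          intro: bounded_linear.has_vector_derivative[OF bounded_linear_Re]
          bounded_linear.has_vector_derivative[OF bounded_linear_Im])
    have "h (norm z) \<le> h 0"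
    proof (rule DERIV_nonpos_imp_nonincreasing[of 0 "norm z" h])
      fix x :: real assume x: "0 \<le> x" "x \<le> norm z"
      let ?p = "norm (\<phi> x)"
      let ?d = "exp (- 4 * K * x) * (2 * (Re (\<phi> x) * Re (\<phi>' x) + Im (\<phi> x) * Im (\<phi>' x)) - 4 * K * ?p ^ 2) - 2 * K"
      have "(h has_real_derivative ?d) (at x)"
      proof -
        have "((\<lambda>x. Re (\<phi> x) ^ 2 + Im (\<phi> x) ^ 2) has_real_derivative
            2 * (Re (\<phi> x) * Re (\<phi>' x) + Im (\<phi> x) * Im (\<phi>' x))) (at x)"
          by (rule DERIV_cong[OF DERIV_add[OF DERIV_power[OF dRe, of 2] DERIV_power[OF dIm, of 2]]])
            (simp add: algebra_simps)
        moreover have "((\<lambda>x. exp (- 4 * K * x)) has_real_derivative - 4 * K * exp (- 4 * K * x)) (at x)"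
          by (auto intro!: derivative_eq_intros)
        ultimately have "((\<lambda>x. exp (- 4 * K * x) * (Re (\<phi> x) ^ 2 + Im (\<phi> x) ^ 2)) has_real_derivative
           - 4 * K * exp (- 4 * K * x) * (Re (\<phi> x) ^ 2 + Im (\<phi> x) ^ 2)
           + 2 * (Re (\<phi> x) * Re (\<phi>' x) + Im (\<phi> x) * Im (\<phi>' x)) * exp (- 4 * K * x)) (at x)"
          by (rule DERIV_mult[rotated])
        moreover have "((\<lambda>x. 2 * K * x) has_real_derivative 2 * K) (at x)"
          by (auto intro!: derivative_eq_intros)
        ultimately show ?thesis
          unfolding h_def cmod_power2 by (rule DERIV_cong[OF DERIV_diff]) (simp add: algebra_simps)
      qed
      moreover have "?d \<le> 0"
      proof -
        have n\<phi>': "norm (\<phi>' x) \<le> K * (?p + exp x)"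
          using K(2)[of "of_real x * \<zeta>"] x \<zeta>(1) by (simp add: \<phi>'_def \<phi>_def norm_mult)
        have "Re (\<phi> x) * Re (\<phi>' x) + Im (\<phi> x) * Im (\<phi>' x) = inner (\<phi> x) (\<phi>' x)"
          by (simp add: inner_complex_def)
        also have "\<dots> \<le> ?p * norm (\<phi>' x)" by (rule norm_cauchy_schwarz)
        also have "\<dots> \<le> ?p * (K * (?p + exp x))" using n\<phi>' by (intro mult_left_mono) auto
        finally have 1: "Re (\<phi> x) * Re (\<phi>' x) + Im (\<phi> x) * Im (\<phi>' x) \<le> K * ?p ^ 2 + K * (?p * exp x)"
          by (simp add: algebra_simps power2_eq_square)
        have "2 * (?p * exp x) \<le> ?p ^ 2 + exp x ^ 2"
          using sum_squares_bound[of ?p "exp x"] by simp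
        then have "K * (2 * (?p * exp x)) \<le> K * (?p ^ 2 + exp x ^ 2)"
          using K(1) by (intro mult_left_mono) auto
        then have "2 * (Re (\<phi> x) * Re (\<phi>' x) + Im (\<phi> x) * Im (\<phi>' x)) - 4 * K * ?p ^ 2
            \<le> K * exp x ^ 2 - K * ?p ^ 2"
          using 1 by (simp add: algebra_simps)
        also have "\<dots> \<le> K * exp x ^ 2" using K(1) by simp
        finally have "exp (- 4 * K * x) * (2 * (Re (\<phi> x) * Re (\<phi>' x) + Im (\<phi> x) * Im (\<phi>' x)) - 4 * K * ?p ^ 2)
            \<le> exp (- 4 * K * x) * (K * exp x ^ 2)" by (intro mult_left_mono) auto
        also have "\<dots> = K * exp (2 * x - 4 * K * x)"
          by (simp add: exp_double[symmetric] exp_add[symmetric])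
        also have "\<dots> \<le> K * 1"
        proof -
          have "1 * x \<le> K * x" using K(1) x(1) by (rule mult_right_mono)
          then have "2 * x - 4 * K * x \<le> 0" using x(1) by simp
          then show ?thesis using K(1) by (intro mult_left_mono) auto
        qed
        finally show ?thesis using K(1) by simp
      qed
      ultimately show "\<exists>y. (h has_real_derivative y) (at x) \<and> y \<le> 0" by blast
    qed simp
    then have "exp (- 4 * K * norm z) * norm (f z) ^ 2 \<le> norm (f 0) ^ 2 + 2 * K * norm z"
      using \<zeta>(2)[symmetric] by (simp add: h_def \<phi>_def cmod_power2)
    then have "exp (4 * K * norm z) * (exp (- 4 * K * norm z) * norm (f z) ^ 2)
        \<le> exp (4 * K * norm z) * (norm (f 0) ^ 2 + 2 * K * norm z)"
      by (intro mult_left_mono) auto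
    then show ?thesis by (simp add: mult.assoc[symmetric] exp_add[symmetric])
  qed
  define A where "A = 1 + norm (f 0) ^ 2 + 2 * K"
  have A1: "A \<ge> 1" using K(1) by (simp add: A_def)
  have "norm (f z) \<le> 2 * A * exp (5 * K * (1 + norm z))" for z
  proof -
    have nz: "norm z \<le> exp (norm z)" "norm z \<le> K * norm z"
      using exp_ge_add_one_self[of "norm z"] mult_right_mono[OF K(1), of "norm z"] by (linarith, simp)
    have "norm (f 0) ^ 2 + 2 * K * norm z \<le> norm (f 0) ^ 2 * exp (norm z) + 2 * K * exp (norm z)"
      using nz K(1) by (intro add_mono) (auto simp: mult_le_cancel_left1)
    also have "\<dots> \<le> A * exp (norm z)" by (simp add: A_def distrib_right)
    also have "\<dots> \<le> A * exp (K * norm z)" using nz A1 by simp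
    finally have "exp (4 * K * norm z) * (norm (f 0) ^ 2 + 2 * K * norm z)
        \<le> exp (4 * K * norm z) * (A * exp (K * norm z))" by (intro mult_left_mono) auto
    also have "\<dots> = A * exp (5 * K * norm z)" by (simp add: exp_add[symmetric] algebra_simps)
    also have "\<dots> \<le> A * exp (5 * K * (1 + norm z))"
      using A1 K(1) by (intro mult_left_mono) auto
    finally have *: "norm (f z) ^ 2 \<le> A * exp (5 * K * (1 + norm z))"
      using bound[of z] by linarith
    have "1 \<le> A * exp (5 * K * (1 + norm z))"
      using mult_mono[of 1 A 1 "exp (5 * K * (1 + norm z))"] A1 K(1) by simp
    moreover have "norm (f z) \<le> 1 + norm (f z) ^ 2"
    proof -
      have "2 * norm (f z) * 1 \<le> norm (f z) ^ 2 + 1 ^ 2" by (rule sum_squares_bound)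
      then show ?thesis using norm_ge_zero[of "f z"] unfolding power_one mult_1_right by linarith
    qed
    ultimately show ?thesis using * by linarith
  qed
  then show ?thesis by (rule exp_typeI)
qed

lemma exp_type_f': "exp_type (deriv f)"
  by (rule exp_type_deriv[OF hol exp_type_f])

section \<open>Critical points\<close>

definition G where "G z = of_nat n * (f z ^ (n - 1) + a * deriv f z ^ (n - 2) * deriv (deriv f) z)"

lemma G_hol: "G holomorphic_on UNIV"
  unfolding G_def by (intro holomorphic_intros hol hol' hol'')

lemma G_exp_type: "exp_type G"
  unfolding G_def
  by (intro exp_type_cmult exp_type_add exp_type_mult exp_type_power exp_type_const exp_type_f
      exp_type_f' exp_type_deriv hol')

lemma factor_sinh: "deriv f z * G z = sinh z"
proof -
  have "((\<lambda>z. f z ^ n + a * deriv f z ^ n) has_field_derivative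
     of_nat n * f z ^ (n - 1) * deriv f z + a * (of_nat n * deriv f z ^ (n - 1) * deriv (deriv f) z)) (at z)"
    by (auto intro!: derivative_eq_intros D0 D1)
  moreover have "((\<lambda>z. f z ^ n + a * deriv f z ^ n) has_field_derivative sinh z) (at z)"
    unfolding eq by (auto intro!: derivative_eq_intros)
  ultimately have "of_nat n * f z ^ (n - 1) * deriv f z + a * (of_nat n * deriv f z ^ (n - 1) * deriv (deriv f) z) = sinh z"
    by (rule DERIV_unique)
  moreover have "deriv f z ^ (n - 1) = deriv f z * deriv f z ^ (n - 2)"
  proof -
    have "n - 1 = Suc (n - 2)" using n2 by simp
    then show ?thesis by simp
  qed
  ultimately show ?thesis by (simp add: G_def algebra_simps)
qed

text \<open>Since \<open>G\<close> is entire and the zeros of sinh are simple, so are those of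
  \<open>deriv f\<close>. The value of \<open>deriv (deriv f) z * G z\<close> is the product rule
  applied to \<open>factor_sinh\<close> at the zero.\<close>

lemma zero_facts:
  assumes "deriv f z = 0"
  shows "sinh z = 0" "f z ^ n = cosh z" "cosh z \<noteq> 0" "deriv (deriv f) z * G z = cosh z"
    "deriv (deriv f) z \<noteq> 0"
proof -
  show "sinh z = 0" using factor_sinh[of z] assms by simp
  then have "cosh z ^ 2 = 1" by (simp add: cosh_square_eq)
  then show c: "cosh z \<noteq> 0" by auto
  show "f z ^ n = cosh z" using eq[of z] assms n2 by (simp add: power_0_left)
  have "deriv (\<lambda>z. deriv f z * G z) z = deriv f z * deriv G z + deriv (deriv f) z * G z"
    by (rule deriv_mult_entire[OF hol' G_hol])
  moreover have "deriv (\<lambda>z. deriv f z * G z) z = cosh z"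
    unfolding factor_sinh by (rule DERIV_imp_deriv) (auto intro!: derivative_eq_intros)
  ultimately show *: "deriv (deriv f) z * G z = cosh z" using assms by simp
  show "deriv (deriv f) z \<noteq> 0" using * c by auto
qed

text \<open>Integration from 0 would make \<open>f\<close> polynomially bounded on the positive axis
  as well, and through the equation also cosh.\<close>

lemma deriv_not_poly_bounded:
  assumes "\<And>x::real. x \<ge> 0 \<Longrightarrow> norm (deriv f (of_real x)) \<le> C * (1 + x) ^ k"
  shows False
proof -
  define B where "B = max 1 (max C (norm (f 0)))"
  have B: "B \<ge> 1" "B \<ge> C" "B \<ge> norm (f 0)" by (auto simp: B_def)
  have f': "norm (deriv f (of_real x)) \<le> B * (1 + x) ^ Suc k" if "x \<ge> 0" for x :: real
  proof -
    have "norm (deriv f (of_real x)) \<le> C * (1 + x) ^ k" using assms that by simp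
    also have "\<dots> \<le> B * (1 + x) ^ k" using B that by (intro mult_right_mono) auto
    also have "\<dots> \<le> B * (1 + x) ^ Suc k"
      using B that by (intro mult_left_mono power_increasing) auto
    finally show ?thesis .
  qed
  have fb: "norm (f (of_real x)) \<le> 2 * B * (1 + x) ^ Suc k" if x: "x \<ge> 0" for x :: real
  proof -
    have "norm (f (of_real x) - f (of_real 0)) \<le> B * (1 + x) ^ k * norm (of_real x - of_real 0 :: complex)"
    proof (rule field_differentiable_bound[of "closed_segment (of_real 0) (of_real x)"])
      fix w :: complex assume "w \<in> closed_segment (of_real 0) (of_real x)"
      then obtain t where t: "w = of_real t" "0 \<le> t" "t \<le> x"
        using x unfolding closed_segment_of_real by (auto simp: closed_segment_eq_real_ivl)
      show "(f has_field_derivative deriv f w) (at w within closed_segment (of_real 0) (of_real x))"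
        by (rule has_field_derivative_at_within[OF D0])
      have "norm (deriv f w) \<le> C * (1 + t) ^ k" using assms t by simp
      also have "\<dots> \<le> B * (1 + x) ^ k" using B t by (intro mult_mono power_mono) auto
      finally show "norm (deriv f w) \<le> B * (1 + x) ^ k" .
    qed auto
    then have 1: "norm (f (of_real x) - f 0) \<le> B * (1 + x) ^ k * x" using x by simp
    have "norm (f (of_real x)) \<le> norm (f (of_real x) - f 0) + norm (f 0)" by norm
    also have "\<dots> \<le> B * (1 + x) ^ k * x + B" using 1 B by linarith
    also have "\<dots> \<le> B * (1 + x) ^ k * (1 + x) + B * (1 + x) ^ Suc k"
    proof (intro add_mono)
      show "B * (1 + x) ^ k * x \<le> B * (1 + x) ^ k * (1 + x)"
        using B x by (intro mult_left_mono) auto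
      show "B \<le> B * (1 + x) ^ Suc k"
        using B x one_le_power[of "1 + x" "Suc k"] mult_left_mono[of 1 "(1 + x) ^ Suc k" B] by simp
    qed
    finally show ?thesis by simp
  qed
  have "cosh x \<le> ((2 * B) ^ n + norm a * B ^ n) * (1 + x) ^ (Suc k * n)" if "x \<ge> 0" for x :: real
  proof -
    have "cosh x = norm (cosh (of_real x :: complex))"
      by (simp add: cosh_complex_of_real)
    also have "\<dots> = norm (f (of_real x) ^ n + a * deriv f (of_real x) ^ n)" by (simp only: eq)
    also have "\<dots> \<le> norm (f (of_real x)) ^ n + norm a * norm (deriv f (of_real x)) ^ n"
      using norm_triangle_ineq[of "f (of_real x) ^ n" "a * deriv f (of_real x) ^ n"]
      by (simp add: norm_mult norm_power)
    also have "\<dots> \<le> (2 * B * (1 + x) ^ Suc k) ^ n + norm a * (B * (1 + x) ^ Suc k) ^ n"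
      using fb[OF that] f'[OF that] by (intro add_mono mult_left_mono power_mono) auto
    also have "\<dots> = ((2 * B) ^ n + norm a * B ^ n) * (1 + x) ^ (Suc k * n)"
      by (simp add: power_mult_distrib power_mult[symmetric] distrib_right del: power_Suc)
    finally show ?thesis .
  qed
  then show False
    using power_not_dominates_cosh[of "(2 * B) ^ n + norm a * B ^ n" "Suc k * n"] by force
qed

text \<open>cosh is even and the derivative picks up a sign, whence \<open>(-1) ^ n\<close>. This
  carries the growth statement over to the negative axis.\<close>

lemma reflect_zero: "cosh_equation n (a * (-1) ^ n) (\<lambda>z. f (- z))"
proof
  have "(\<lambda>z. f ((-1) * z + 0)) holomorphic_on UNIV" by (rule entire_affine[OF hol])
  then show "(\<lambda>z. f (- z)) holomorphic_on UNIV" by simp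
  fix z
  have "deriv (\<lambda>z. f ((-1) * z + 0)) z = (-1) * deriv f ((-1) * z + 0)" by (rule deriv_affine[OF hol])
  then have "deriv (\<lambda>z. f (- z)) z = - deriv f (- z)" by simp
  then show "f (- z) ^ n + a * (-1) ^ n * deriv (\<lambda>z. f (- z)) z ^ n = cosh z"
    using eq[of "-z"] by (simp add: mult.assoc power_mult_distrib[symmetric])
qed (use n2 a0 in auto)

lemma deriv_not_poly_bounded_left:
  assumes "\<And>x::real. x \<ge> 0 \<Longrightarrow> norm (deriv f (- of_real x)) \<le> C * (1 + x) ^ k"
  shows False
proof (rule cosh_equation.deriv_not_poly_bounded[OF reflect_zero])
  fix x :: real assume "x \<ge> 0"
  have "deriv (\<lambda>z. f ((-1) * z + 0)) (of_real x) = (-1) * deriv f ((-1) * of_real x + 0)"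
    by (rule deriv_affine[OF hol])
  then show "norm (deriv (\<lambda>z. f (- z)) (of_real x)) \<le> C * (1 + x) ^ k"
    using assms[OF \<open>x \<ge> 0\<close>] by simp
qed

lemma infinite_critical_points: "infinite {z. deriv f z = 0}"
proof
  assume "finite {z. deriv f z = 0}"
  then obtain C k l where b: "\<And>z. norm (deriv f z) \<le> C * (1 + norm z) ^ k * norm (exp (l * z))"
    using finite_zeros_bound[OF hol' exp_type_f'] zero_facts(5) by blast
  have C: "C \<ge> 0"
    using order_trans[OF norm_ge_zero b[of 0]] by simp
  show False
  \<comment> \<open>The sign of \<open>Re l\<close> decides on which half axis
    \<open>exp (l * z)\<close> has modulus at most 1.\<close>
  proof (cases "Re l \<le> 0")
    case True
    show False
    proof (rule deriv_not_poly_bounded)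
      fix x :: real assume x: "x \<ge> 0"
      have "norm (exp (l * of_real x)) \<le> 1" using True x by (simp add: mult_nonpos_nonneg)
      then have "C * (1 + x) ^ k * norm (exp (l * of_real x)) \<le> C * (1 + x) ^ k * 1"
        using C x by (intro mult_left_mono) auto
      then show "norm (deriv f (of_real x)) \<le> C * (1 + x) ^ k" using b[of "of_real x"] x by simp
    qed
  next
    case False
    show False
    proof (rule deriv_not_poly_bounded_left)
      fix x :: real assume x: "x \<ge> 0"
      have "norm (exp (l * - of_real x)) \<le> 1" using False x by simp
      then have "C * (1 + x) ^ k * norm (exp (l * - of_real x)) \<le> C * (1 + x) ^ k * 1"
        using C x by (intro mult_left_mono) auto
      then show "norm (deriv f (- of_real x)) \<le> C * (1 + x) ^ k" using b[of "- of_real x"] x by simp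
    qed
  qed
qed

end

section \<open>Symmetries coming from critical points\<close>

text \<open>\<open>D\<close> is the smallest gap in \<open>S\<close>. Repeated reflection of a pair
  at this distance produces a whole progression, and an element outside it would lie closer than
  \<open>D\<close> to one of its members.\<close>

lemma reflection_closed_int_set:
  fixes S :: "int set"
  assumes closed: "\<And>x y. x \<in> S \<Longrightarrow> y \<in> S \<Longrightarrow> 2 * x - y \<in> S"
    and two: "u \<in> S" "v \<in> S" "u \<noteq> v"
  obtains x0 :: int and D :: nat where "D > 0" "S = range (\<lambda>i. x0 + int D * i)"
proof -
  have ex: "\<exists>d. d > 0 \<and> (\<exists>x\<in>S. x + int d \<in> S)"
  proof (cases "u < v")
    case True
    then show ?thesis using two by (intro exI[of _ "nat (v - u)"] conjI bexI[of _ u]) auto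
  next
    case False
    then show ?thesis using two by (intro exI[of _ "nat (u - v)"] conjI bexI[of _ v]) auto
  qed
  define D where "D = (LEAST d. d > 0 \<and> (\<exists>x\<in>S. x + int d \<in> S))"
  have D: "D > 0" "\<exists>x\<in>S. x + int D \<in> S"
    using LeastI_ex[OF ex] unfolding D_def by auto
  have least: "D \<le> d" if "d > 0" "x \<in> S" "x + int d \<in> S" for d x
    unfolding D_def using that by (intro Least_le) auto
  obtain x0 where x0: "x0 \<in> S" "x0 + int D \<in> S" using D(2) by blast
  \<comment> \<open>Two neighbours are carried along, because the next term in either direction is
    the reflection of one in the other.\<close>
  have "x0 + int D * i \<in> S \<and> x0 + int D * (i + 1) \<in> S" for i
  proof (induction i rule: int_induct[of _ 0])
    case base
    then show ?case using x0 by simp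
  next
    case (step1 i)
    then have "2 * (x0 + int D * (i + 1)) - (x0 + int D * i) \<in> S" by (intro closed) auto
    then show ?case using step1 by (simp add: algebra_simps)
  next
    case (step2 i)
    then have "2 * (x0 + int D * i) - (x0 + int D * (i + 1)) \<in> S" by (intro closed) auto
    then show ?case using step2 by (simp add: algebra_simps)
  qed
  then have sub: "x0 + int D * i \<in> S" for i by blast
  have "y \<in> range (\<lambda>i. x0 + int D * i)" if y: "y \<in> S" for y
  proof -
    define i r where "i = (y - x0) div int D" and "r = (y - x0) mod int D"
    have y': "y = x0 + int D * i + r"
      using mult_div_mod_eq[of "int D" "y - x0"] by (simp add: i_def r_def)
    have r: "0 \<le> r" "r < int D" using D(1) by (auto simp: r_def)
    have "r = 0"
    proof (rule ccontr)
      assume "r \<noteq> 0"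
      then have "D \<le> nat r" using r y y' by (intro least[of _ "x0 + int D * i"] sub) auto
      then show False using r by simp
    qed
    then show ?thesis using y' by auto
  qed
  then have "S = range (\<lambda>i. x0 + int D * i)" using sub by blast
  then show ?thesis using that D(1) by blast
qed

lemma antiderivative_two_exp:
  assumes "\<And>z. (f has_field_derivative K1 * exp (s * z) + K2 * exp (t * z)) (at z)"
    and "s \<noteq> 0" "t \<noteq> (0::complex)"
  obtains C where "\<And>z. f z = K1 / s * exp (s * z) + K2 / t * exp (t * z) + C"
proof -
  define h where "h = (\<lambda>z. f z - (K1 / s * exp (s * z) + K2 / t * exp (t * z)))"
  have "(h has_field_derivative 0) (at z)" for z
    unfolding h_def using assms(2,3) by (auto intro!: derivative_eq_intros assms(1))
  then obtain C where "\<And>z. h z = C"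
    using has_field_derivative_zero_constant[of UNIV h] by auto
  then have "f z = K1 / s * exp (s * z) + K2 / t * exp (t * z) + C" for z
    unfolding h_def by (metis diff_eq_eq add.commute)
  then show ?thesis by (rule that)
qed

context cosh_equation
begin

text \<open>Closure under reflection makes the critical points an arithmetic progression of step
  \<open>\<i> * pi * D\<close>, and \<open>sinh ((z - z0) / D)\<close> is a function with precisely
  these simple zeros.\<close>

lemma critical_form:
  assumes refl: "\<And>z w. deriv f z = 0 \<Longrightarrow> deriv f w = 0 \<Longrightarrow> deriv f (2 * z - w) = 0"
  obtains D :: nat and z0 \<alpha> m where "D > 0" "deriv f z0 = 0" "deriv f (z0 + \<i> * of_real (of_nat D * pi)) = 0"
    "\<And>z. deriv f z = exp (\<alpha> * z + m) * sinh ((z - z0) / of_nat D)"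
proof -
  define p :: "int \<Rightarrow> complex" where "p = (\<lambda>k. \<i> * of_real (of_int k * pi))"
  have inj: "inj p" by (auto simp: p_def inj_def)
  define S where "S = {k. deriv f (p k) = 0}"
  have zeros: "{z. deriv f z = 0} = p ` S"
    using zero_facts(1) by (force simp: S_def p_def sinh_eq_0_iff)
  then have "infinite S" using infinite_critical_points by (metis finite_imageI)
  then obtain u v where uv: "u \<in> S" "v \<in> S" "u \<noteq> v"
    by (metis finite.simps infinite_imp_nonempty ex_in_conv insertI1 finite_subset subsetI insertE)
  have "2 * x - y \<in> S" if "x \<in> S" "y \<in> S" for x y
    using refl[of "p x" "p y"] that by (simp add: S_def p_def algebra_simps)
  then obtain x0 :: int and D :: nat where D: "D > 0" "S = range (\<lambda>i. x0 + int D * i)"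
    using reflection_closed_int_set[OF _ uv] by metis
  define z0 where "z0 = p x0"
  have "x0 + int D * 0 \<in> S" "x0 + int D * 1 \<in> S" unfolding D(2) by blast+
  then have z: "deriv f z0 = 0" "deriv f (z0 + \<i> * of_real (of_nat D * pi)) = 0"
    by (auto simp: S_def z0_def p_def algebra_simps)
  define P where "P = (\<lambda>z. sinh (1 / of_nat D * z + (- z0 / of_nat D)))"
  have P: "P z = sinh ((z - z0) / of_nat D)" for z
    by (simp add: P_def diff_divide_distrib)
  have P0: "P z = 0 \<longleftrightarrow> deriv f z = 0" for z
  proof -
    have "P z = 0 \<longleftrightarrow> (\<exists>i::int. (z - z0) / of_nat D = \<i> * of_real (of_int i * pi))"
      unfolding P sinh_eq_0_iff ..
    also have "\<dots> \<longleftrightarrow> (\<exists>i::int. z = p (x0 + int D * i))"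
      using D(1) by (simp add: field_simps z0_def p_def)
    also have "\<dots> \<longleftrightarrow> z \<in> p ` S" unfolding D(2) by auto
    also have "\<dots> \<longleftrightarrow> deriv f z = 0" using zeros by blast
    finally show ?thesis .
  qed
  have hP: "P holomorphic_on UNIV" unfolding P_def
    by (rule entire_affine) (auto simp: sinh_field_def[abs_def] intro!: holomorphic_intros)
  obtain l m where lm: "\<And>z. deriv f z = P z * exp (l * z + m)"
  \<comment> \<open>The comparison function is itself a sinh of an affine argument, so its cofactor
    is 1.\<close>
  proof (rule quotient_is_exp[OF hol' exp_type_f' hP exp_type_const[of 1]])
    show "P z * 1 = sinh (1 / of_nat D * z + (- z0 / of_nat D))" for z by (simp add: P_def)
    show "1 / of_nat D \<noteq> (0::complex)" using D(1) by simp
    show "deriv f z = 0 \<longleftrightarrow> P z = 0" for z by (simp add: P0)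
    fix z assume Pz: "P z = 0"
    have "(P has_field_derivative cosh (1 / of_nat D * z + (- z0 / of_nat D)) * (1 / of_nat D)) (at z)"
      unfolding P_def using D(1) by (auto intro!: derivative_eq_intros)
    then have "deriv P z = cosh (1 / of_nat D * z + (- z0 / of_nat D)) * (1 / of_nat D)"
      by (rule DERIV_imp_deriv)
    moreover have "cosh (1 / of_nat D * z + (- z0 / of_nat D)) ^ 2 = 1"
      using Pz by (simp add: P_def cosh_square_eq)
    ultimately show "deriv P z \<noteq> 0 \<and> deriv (deriv f) z \<noteq> 0"
      using D(1) zero_facts(5) Pz P0 by auto
  qed (blast intro: that)
  show ?thesis
    by (rule that[OF D(1) z, of l m]) (simp add: lm P)
qed

section \<open>Degree three and four: translations and exponential sums\<close>

text \<open>Both differences of \<open>n\<close>-th powers are factored, into \<open>u * U\<close>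
  and \<open>deriv u * V\<close>. \<open>V\<close> is homogeneous of degree
  \<open>n - 1 >= 2\<close> in the two derivatives, which vanish at \<open>z0\<close>, so
  \<open>deriv V z0 = 0\<close>. The balance of orders then forces
  \<open>U z0 = n * f z0 ^ (n - 1)\<close> to be 0, whereas \<open>f z0 ^ n = cosh z0\<close> is
  not.\<close>

lemma critical_uniqueness:
  assumes n3: "n \<ge> 3" and F: "cosh_equation n a F"
    and z0: "f z0 = F z0" "deriv f z0 = 0" "deriv F z0 = 0"
  shows "f z = F z"
proof (rule ccontr)
  assume ne: "f z \<noteq> F z"
  interpret F: cosh_equation n a F by (rule F)
  define u where "u = (\<lambda>z. f z - F z)"
  define U where "U = (\<lambda>z. \<Sum>i<n. F z ^ (n - Suc i) * f z ^ i)"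
  define V where "V = (\<lambda>z. \<Sum>i<n. deriv F z ^ (n - Suc i) * deriv f z ^ i)"
  have du: "deriv u z = deriv f z - deriv F z" for z
    unfolding u_def by (intro DERIV_imp_deriv DERIV_diff D0 F.D0)
  have dV: "(V has_field_derivative 0) (at z0)"
  proof -
    have "((\<lambda>z. deriv F z ^ (n - Suc i) * deriv f z ^ i) has_field_derivative 0) (at z0)"
      if i: "i < n" for i
    proof -
      have "((\<lambda>z. deriv F z ^ (n - Suc i) * deriv f z ^ i) has_field_derivative
          of_nat (n - Suc i) * deriv F z0 ^ (n - Suc i - 1) * deriv (deriv F) z0 * deriv f z0 ^ i
          + deriv F z0 ^ (n - Suc i) * (of_nat i * deriv f z0 ^ (i - 1) * deriv (deriv f) z0)) (at z0)"
        by (auto intro!: derivative_eq_intros D1 F.D1)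
      moreover have c: "i = 0 \<and> n - Suc i \<ge> 2 \<or> i = 1 \<and> n - Suc i \<ge> 1 \<or> i \<ge> 2"
        using n3 i by auto
      ultimately show ?thesis
        by (elim DERIV_cong) (use z0(2,3) c in \<open>auto simp: power_0_left\<close>)
    qed
    then have "(V has_field_derivative (\<Sum>i<n. 0)) (at z0)"
      unfolding V_def by (intro DERIV_sum) auto
    then show ?thesis by simp
  qed
  obtain p :: nat where p: "p \<ge> 1" "U z0 = - a * of_nat p * deriv V z0"
  proof (rule zero_order_balance[of u U V a z0 z])
    show "u holomorphic_on UNIV" "U holomorphic_on UNIV" "V holomorphic_on UNIV"
      unfolding u_def U_def V_def by (intro holomorphic_intros hol F.hol hol' F.hol')+
    show "u z * U z = - a * (deriv u z * V z)" for z
    proof -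
      have "u z * U z = f z ^ n - F z ^ n"
        unfolding u_def U_def power_diff_sumr2 ..
      moreover have "deriv u z * V z = deriv f z ^ n - deriv F z ^ n"
        unfolding du V_def power_diff_sumr2 ..
      moreover have "f z ^ n - F z ^ n = - a * (deriv f z ^ n - deriv F z ^ n)"
      proof -
        have "f z ^ n = cosh z - a * deriv f z ^ n" "F z ^ n = cosh z - a * deriv F z ^ n"
          using eq[of z] F.eq[of z] by (simp_all add: eq_diff_eq)
        then show ?thesis by (simp add: algebra_simps)
      qed
      ultimately show ?thesis by simp
    qed
    show "u z0 = 0" by (simp add: u_def z0)
    show "V z0 = 0"
      unfolding V_def z0(2,3) using n3 by (intro sum.neutral) (auto simp: power_0_left)
    show "u z \<noteq> 0" using ne by (simp add: u_def)
  qed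
  have "U z0 = of_nat n * f z0 ^ (n - 1)"
  proof -
    have "U z0 = (\<Sum>i<n. f z0 ^ (n - 1))"
      unfolding U_def z0(1)[symmetric] by (intro sum.cong) (auto simp: power_add[symmetric])
    then show ?thesis by simp
  qed
  moreover have "f z0 \<noteq> 0"
    using zero_facts(2,3)[OF z0(2)] n2 by (auto simp: power_0_left)
  ultimately show False using p dV n2 by (simp add: DERIV_imp_deriv)
qed

text \<open>Critical points differ by a multiple \<open>c\<close> of \<open>\<i> * pi\<close>, and
  this shift multiplies cosh by \<open>cosh c\<close>, which is 1 or -1. With
  \<open>\<eta> = f z2 / f z1\<close>, an \<open>n\<close>-th root of \<open>cosh c\<close>, the
  function \<open>f (z + c) / \<eta>\<close> is a solution that agrees with \<open>f\<close> at the
  critical point \<open>z1\<close>.\<close>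

lemma translation_symmetry:
  assumes n3: "n \<ge> 3" and z: "deriv f z1 = 0" "deriv f z2 = 0"
  obtains \<eta> where "norm \<eta> = 1" "\<And>z. f (z + (z2 - z1)) = \<eta> * f z" "\<And>z. deriv f (z + (z2 - z1)) = \<eta> * deriv f z"
proof -
  define c where "c = z2 - z1"
  have s: "sinh z1 = 0" "sinh z2 = 0" using zero_facts(1) z by auto
  then have sc: "sinh c = 0" by (simp add: c_def sinh_diff)
  then have cc: "cosh c ^ 2 = 1" by (simp add: cosh_square_eq)
  have cosh_c: "cosh (z + c) = cosh z * cosh c" for z by (simp add: cosh_add sc)
  have f0: "f z1 \<noteq> 0" "f z2 \<noteq> 0"
    using zero_facts(2,3)[OF z(1)] zero_facts(2,3)[OF z(2)] n2 by (auto simp: power_0_left)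
  define \<eta> where "\<eta> = f z2 / f z1"
  have \<eta>0: "\<eta> \<noteq> 0" using f0 by (simp add: \<eta>_def)
  have "\<eta> ^ n = cosh z2 / cosh z1"
    using zero_facts(2)[OF z(1)] zero_facts(2)[OF z(2)] by (simp add: \<eta>_def power_divide)
  also have "\<dots> = cosh c"
    using cosh_c[of z1] zero_facts(3)[OF z(1)] by (simp add: c_def)
  finally have \<eta>n: "\<eta> ^ n = cosh c" .
  have "norm (cosh c) ^ 2 = 1" using cc by (metis norm_one norm_power)
  then have nc: "norm (cosh c) = 1" using norm_ge_zero[of "cosh c"] by (simp add: power2_eq_1_iff)
  have "norm \<eta> ^ n = 1" using nc \<eta>n by (metis norm_power)
  then have \<eta>1: "norm \<eta> = 1" using n2 power_eq_iff_eq_base[of n "norm \<eta>" 1] by simp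
  define F where "F = (\<lambda>z. (1 / \<eta>) * f (1 * z + c))"
  have hF: "(\<lambda>z. f (1 * z + c)) holomorphic_on UNIV" by (rule entire_affine[OF hol])
  have "deriv F z = (1 / \<eta>) * deriv (\<lambda>z. f (1 * z + c)) z" for z
    unfolding F_def using hF by (intro deriv_cmult) (auto simp: holomorphic_on_def)
  then have dF: "deriv F z = (1 / \<eta>) * deriv f (z + c)" for z
    using deriv_affine[OF hol, of 1 c] by simp
  have "cosh_equation n a F"
  proof
    show "F holomorphic_on UNIV" unfolding F_def by (intro holomorphic_intros hF)
    fix z
    have "F z ^ n + a * deriv F z ^ n = (1 / \<eta> ^ n) * (f (z + c) ^ n + a * deriv f (z + c) ^ n)"
      unfolding dF by (simp add: F_def power_mult_distrib power_divide distrib_left)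
    also have "\<dots> = cosh z" using nc by (simp add: eq \<eta>n cosh_c) auto
    finally show "F z ^ n + a * deriv F z ^ n = cosh z" .
  qed (use n2 a0 in auto)
  then have fF: "f z = F z" for z
  proof (rule critical_uniqueness[OF n3, of F z1])
    show "f z1 = F z1" using f0 by (simp add: F_def c_def \<eta>_def)
    show "deriv F z1 = 0" unfolding dF c_def using z by simp
  qed (rule z)
  have f: "f (z + c) = \<eta> * f z" for z using fF[of z] \<eta>0 by (simp add: F_def)
  then have "(\<lambda>z. f (1 * z + c)) = (\<lambda>z. \<eta> * f z)" by simp
  then have "deriv (\<lambda>z. f (1 * z + c)) z = \<eta> * deriv f z" for z
    using hol by (simp add: holomorphic_on_def)
  then have "deriv f (z + c) = \<eta> * deriv f z" for z
    using deriv_affine[OF hol, of 1 c] by simp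
  then show ?thesis using that[of \<eta>] \<eta>1 f unfolding c_def by blast
qed

text \<open>Integrating the critical form gives two exponentials and a constant. Growth along both
  half axes separates the signs of the exponents, and the shift by one step of the progression
  excludes the constant.\<close>

lemma two_exponentials:
  assumes n3: "n \<ge> 3"
  obtains A B and s t :: real where "A \<noteq> 0" "B \<noteq> 0" "s > 0" "t < 0"
    "\<And>z. f z = A * exp (of_real s * z) + B * exp (of_real t * z)"
proof -
  \<comment> \<open>The reflection of \<open>w\<close> in \<open>z\<close> is \<open>z\<close>
    shifted by \<open>z - w\<close>, and this shift multiplies \<open>deriv f\<close> by a
    constant.\<close>
  have refl: "deriv f (2 * z - w) = 0" if zw: "deriv f z = 0" "deriv f w = 0" for z w
  proof -
    obtain \<eta> where "\<And>x. deriv f (x + (z - w)) = \<eta> * deriv f x"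
      using translation_symmetry[OF n3 zw(2,1)] by blast
    from this[of z] show ?thesis using zw by (simp add: algebra_simps)
  qed
  obtain D :: nat and z0 \<alpha> m where D: "D > 0" and z0: "deriv f z0 = 0"
      "deriv f (z0 + \<i> * of_real (of_nat D * pi)) = 0"
    and f': "\<And>z. deriv f z = exp (\<alpha> * z + m) * sinh ((z - z0) / of_nat D)"
    using critical_form[OF refl] by blast
  define c where "c = \<i> * of_real (of_nat D * pi)"
  obtain \<eta> where \<eta>: "norm \<eta> = 1" "\<And>z. f (z + c) = \<eta> * f z" "\<And>z. deriv f (z + c) = \<eta> * deriv f z"
    using translation_symmetry[OF n3 z0] by (auto simp: c_def)
  have expc: "exp (c / of_nat D) = -1" "exp (- (c / of_nat D)) = -1"
    using D by (auto simp: c_def exp_minus)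
  have \<alpha>\<eta>: "exp (\<alpha> * c) = - \<eta>"
  proof -
    \<comment> \<open>At this point the argument of sinh is 1, where sinh does not vanish and can be
      cancelled.\<close>
    define w where "w = z0 + of_nat D"
    have sw: "sinh ((w - z0) / of_nat D) \<noteq> 0"
    proof -
      have "sinh (1::complex) \<noteq> 0"
      proof
        assume "sinh (1::complex) = 0"
        then obtain k :: int where "1 = \<i> * of_real (of_int k * pi)"
          using sinh_eq_0_iff by blast
        then have "Re 1 = Re (\<i> * of_real (of_int k * pi))" by (simp only:)
        then show False by simp
      qed
      then show ?thesis using D by (simp add: w_def)
    qed
    have "(w + c - z0) / of_nat D = (w - z0) / of_nat D + c / of_nat D"
      by (simp add: add_divide_distrib diff_divide_distrib)
    moreover have "sinh (x + c / of_nat D) = - sinh x" for x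
      using expc by (simp add: sinh_field_def exp_add exp_diff field_simps)
    ultimately have "sinh ((w + c - z0) / of_nat D) = - sinh ((w - z0) / of_nat D)" by simp
    then have "exp (\<alpha> * (w + c) + m) * (- sinh ((w - z0) / of_nat D))
        = \<eta> * (exp (\<alpha> * w + m) * sinh ((w - z0) / of_nat D))"
      using \<eta>(3)[of w] by (simp add: f')
    moreover have "exp (\<alpha> * (w + c) + m) = exp (\<alpha> * w + m) * exp (\<alpha> * c)"
      by (simp add: exp_add[symmetric] algebra_simps)
    ultimately have "exp (\<alpha> * w + m) * sinh ((w - z0) / of_nat D) * (exp (\<alpha> * c) + \<eta>) = 0"
      by algebra
    then show ?thesis using sw by (simp add: eq_neg_iff_add_eq_0)
  qed
  \<comment> \<open>As \<open>c\<close> is purely imaginary and nonzero, unimodularity of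
    \<open>exp (\<alpha> * c)\<close> means that \<alpha> is real.\<close>
  then have "norm (exp (\<alpha> * c)) = 1" using \<eta>(1) by simp
  then have "Re (\<alpha> * c) = 0" by simp
  then have "Im \<alpha> = 0" using D by (simp add: c_def)
  then have \<alpha>: "\<alpha> = of_real (Re \<alpha>)" by (simp add: complex_eq_iff)
  define s t where "s = Re \<alpha> + 1 / real D" and "t = Re \<alpha> - 1 / real D"
  define K1 K2 where "K1 = exp (m - z0 / of_nat D) / 2" and "K2 = - exp (m + z0 / of_nat D) / 2"
  have st: "\<alpha> + 1 / of_nat D = of_real s" "\<alpha> - 1 / of_nat D = of_real t"
    unfolding s_def t_def using \<alpha>[symmetric] by simp_all
  have f'2: "deriv f z = K1 * exp (of_real s * z) + K2 * exp (of_real t * z)" for z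
  proof -
    have "exp (m - z0 / of_nat D) * exp (of_real s * z) = exp (\<alpha> * z + m) * exp ((z - z0) / of_nat D)"
      unfolding exp_add[symmetric] st[symmetric] using D by (intro arg_cong[of _ _ exp]) (simp add: field_simps)
    moreover have "exp (m + z0 / of_nat D) * exp (of_real t * z) = exp (\<alpha> * z + m) * exp (- ((z - z0) / of_nat D))"
      unfolding exp_add[symmetric] st[symmetric] using D by (intro arg_cong[of _ _ exp]) (simp add: field_simps)
    ultimately show ?thesis
      by (simp add: f' sinh_field_def K1_def K2_def right_diff_distrib diff_divide_distrib)
  qed
  have ts: "t < s" using D by (simp add: s_def t_def)
  have "t < 0"
  proof (rule ccontr)
    assume t: "\<not> t < 0"
    show False
    proof (rule deriv_not_poly_bounded_left)
      fix x :: real assume x: "x \<ge> 0"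
      have "norm (deriv f (- of_real x)) \<le> norm K1 * exp (s * - x) + norm K2 * exp (t * - x)"
        unfolding f'2 by (rule order_trans[OF norm_triangle_ineq]) (simp add: norm_mult)
      also have "\<dots> \<le> norm K1 * 1 + norm K2 * 1"
        using t ts x by (intro add_mono mult_left_mono) auto
      finally show "norm (deriv f (- of_real x)) \<le> (norm K1 + norm K2) * (1 + x) ^ 0" by simp
    qed
  qed
  have "s > 0"
  proof (rule ccontr)
    assume s: "\<not> s > 0"
    show False
    proof (rule deriv_not_poly_bounded)
      fix x :: real assume x: "x \<ge> 0"
      have "norm (deriv f (of_real x)) \<le> norm K1 * exp (s * x) + norm K2 * exp (t * x)"
        unfolding f'2 by (rule order_trans[OF norm_triangle_ineq]) (simp add: norm_mult)
      also have "\<dots> \<le> norm K1 * 1 + norm K2 * 1"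
        using s ts x by (intro add_mono mult_left_mono) (auto simp: mult_nonpos_nonneg)
      finally show "norm (deriv f (of_real x)) \<le> (norm K1 + norm K2) * (1 + x) ^ 0" by simp
    qed
  qed
  obtain C where C: "\<And>z. f z = K1 / of_real s * exp (of_real s * z) + K2 / of_real t * exp (of_real t * z) + C"
    using antiderivative_two_exp[of f K1 "of_real s" K2 "of_real t"] D0 \<open>s > 0\<close> \<open>t < 0\<close>
    unfolding f'2 by auto
  have e: "exp (of_real s * c) = \<eta>" "exp (of_real t * c) = \<eta>"
    unfolding st[symmetric] distrib_right left_diff_distrib using expc \<alpha>\<eta>
    by (simp_all add: exp_add exp_diff)
  \<comment> \<open>A nonzero constant would give \<open>\<eta> = 1\<close>, and
    \<open>s * D\<close> and \<open>t * D\<close> would be even integers of opposite sign at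
    distance 2, which do not exist.\<close>
  have "C = 0"
  proof (rule ccontr)
    assume "C \<noteq> 0"
    moreover have "\<eta> * C = C"
      using \<eta>(2)[of 0] unfolding C by (simp add: e distrib_left mult.commute[of \<eta>])
    ultimately have "\<eta> = 1" by simp
    then have e1: "exp (of_real s * c) = 1" "exp (of_real t * c) = 1" using e by simp_all
    obtain j :: int where j: "s * (real D * pi) = of_int (2 * j) * pi"
      using e1(1) unfolding exp_eq_1 by (auto simp: c_def)
    obtain k :: int where k: "t * (real D * pi) = of_int (2 * k) * pi"
      using e1(2) unfolding exp_eq_1 by (auto simp: c_def)
    have "s * real D = of_int (2 * j)" using j by simp
    moreover have "t * real D = of_int (2 * k)" using k by simp
    moreover have "s * real D - t * real D = 2" using D by (simp add: s_def t_def left_diff_distrib distrib_right)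
    moreover have "s * real D > 0" "t * real D < 0"
      using D \<open>s > 0\<close> \<open>t < 0\<close> by (auto simp: mult_neg_pos)
    ultimately have "real_of_int j > 0" "real_of_int k < 0" "real_of_int (j - k) = 1" by simp_all
    then have "j > 0" "k < 0" "j - k = 1" by linarith+
    then show False by simp
  qed
  show ?thesis
    by (rule that[of "K1 / of_real s" "K2 / of_real t" s t])
      (use \<open>s > 0\<close> \<open>t < 0\<close> C \<open>C = 0\<close> in \<open>auto simp: K1_def K2_def\<close>)
qed


text \<open>Binomial expansion yields exponents \<open>(n - k) * s + k * t\<close>, pairwise
  distinct as \<open>t < s\<close>. Only those equal to 1 and -1 may survive in cosh, so every other
  coefficient vanishes, and there the factor \<open>1 + a * s ^ (n - k) * t ^ k\<close> is
  responsible.\<close>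

lemma two_exponentials_exponents:
  fixes s t :: real
  assumes AB: "A \<noteq> 0" "B \<noteq> 0" and st: "s > 0" "t < 0"
    and f: "\<And>z. f z = A * exp (of_real s * z) + B * exp (of_real t * z)"
  obtains i j where "i \<le> n" "j \<le> n" "real (n - i) * s + real i * t = 1" "real (n - j) * s + real j * t = -1"
    "\<And>k. k \<le> n \<Longrightarrow> k \<noteq> i \<Longrightarrow> k \<noteq> j \<Longrightarrow> 1 + a * of_real (s ^ (n - k) * t ^ k) = 0"
proof -
  have f': "deriv f z = A * of_real s * exp (of_real s * z) + B * of_real t * exp (of_real t * z)" for z
  proof -
    have "f = (\<lambda>z. A * exp (of_real s * z) + B * exp (of_real t * z))" using f by blast
    then have "(f has_field_derivative A * of_real s * exp (of_real s * z) + B * of_real t * exp (of_real t * z)) (at z)"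
      by (auto intro!: derivative_eq_intros)
    then show ?thesis by (rule DERIV_imp_deriv)
  qed
  define e where "e = (\<lambda>k. real (n - k) * s + real k * t)"
  define c where "c = (\<lambda>k. 1 + a * of_real (s ^ (n - k) * t ^ k))"
  define b where "b = (\<lambda>k. of_nat (n choose k) * B ^ k * A ^ (n - k) * c k)"
  define L where "L = map (\<lambda>k. (b k, complex_of_real (e k))) [0..<Suc n] @ [(-1/2, of_real 1), (-1/2, of_real (-1))]"
  have binom: "(B * y + A * x) ^ n + a * (B * of_real t * y + A * of_real s * x) ^ n
      = (\<Sum>k\<le>n. b k * (y ^ k * x ^ (n - k)))" for x y
    unfolding binomial_ring b_def c_def sum_distrib_left sum.distrib[symmetric]
    by (intro sum.cong) (simp_all add: power_mult_distrib algebra_simps)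
  have ex: "exp (of_real t * z) ^ k * exp (of_real s * z) ^ (n - k) = exp (of_real (e k) * z)" for z :: complex and k
    by (simp add: e_def exp_of_nat_mult[symmetric] exp_add[symmetric] algebra_simps)
  have eqL: "(\<Sum>(c, l)\<leftarrow>L. c * exp (l * z)) = 0" for z
  proof -
    have "(\<Sum>k\<le>n. b k * exp (of_real (e k) * z)) = cosh z"
      using eq[of z] unfolding f' unfolding f ex[symmetric] binom[symmetric]
      by (simp add: add.commute)
    moreover have "(\<Sum>(c, l)\<leftarrow>L. c * exp (l * z)) = (\<Sum>k\<le>n. b k * exp (of_real (e k) * z)) - cosh z"
      by (simp add: L_def o_def cosh_field_def interv_sum_list_conv_sum_set_nat atLeast0LessThan
          lessThan_Suc_atMost field_simps del: upt_Suc)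
    ultimately show ?thesis by simp
  qed
  have ind: "(\<Sum>k\<le>n. if e k = m then b k else 0) = (if m = 1 then 1/2 else 0) + (if m = -1 then 1/2 else 0)" for m
  proof -
    have "(\<Sum>(c, l)\<leftarrow>L. if l = of_real m then c else 0) = 0"
      by (rule exp_independent[OF eqL])
    moreover have "(\<Sum>(c, l)\<leftarrow>L. if l = of_real m then c else 0) =
       (\<Sum>k\<le>n. if e k = m then b k else 0) - (if m = 1 then 1/2 else 0) - (if m = -1 then 1/2 else 0)"
      by (auto simp: L_def o_def interv_sum_list_conv_sum_set_nat atLeast0LessThan
          lessThan_Suc_atMost of_real_eq_iff simp del: upt_Suc of_real_minus of_real_1)
    ultimately show ?thesis by (simp add: algebra_simps)
  qed
  have e_inj: "e k = e l \<longleftrightarrow> k = l" if "k \<le> n" "l \<le> n" for k l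
  proof -
    have "e k = real n * s - real k * (s - t)" if "k \<le> n" for k
      using that by (simp add: e_def of_nat_diff algebra_simps)
    then show ?thesis using that st by auto
  qed
  have bz: "b k = (if e k = 1 then 1/2 else 0) + (if e k = -1 then 1/2 else 0)" if k: "k \<le> n" for k
  proof -
    have "(\<Sum>l\<le>n. if e l = e k then b l else 0) = (\<Sum>l\<le>n. if l = k then b l else 0)"
      by (intro sum.cong) (use e_inj k in auto)
    then show ?thesis using ind[of "e k"] k by simp
  qed
  have "\<exists>i\<le>n. e i = m" if "m = 1 \<or> m = -1" for m
  proof (rule ccontr)
    assume "\<not> (\<exists>i\<le>n. e i = m)"
    then have "(\<Sum>k\<le>n. if e k = m then b k else 0) = 0" by (intro sum.neutral) auto
    then show False using ind[of m] that by auto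
  qed
  then obtain i j where ij: "i \<le> n" "e i = 1" "j \<le> n" "e j = -1" by blast
  have "c k = 0" if "k \<le> n" "k \<noteq> i" "k \<noteq> j" for k
  proof -
    have "b k = 0" using bz[OF that(1)] e_inj[OF that(1) ij(1)] e_inj[OF that(1) ij(3)] that ij by auto
    then show ?thesis using AB that(1) by (simp add: b_def)
  qed
  then show ?thesis using that[of i j] ij by (simp add: e_def c_def)
qed

text \<open>Both products equal \<open>- 1 / a\<close>; since \<open>t < 0 < s\<close>, their sign
  records the parity of the exponent of \<open>t\<close>.\<close>

lemma exponents_same_parity:
  fixes s t :: real
  assumes st: "s > 0" "t < 0"
    and k: "1 + a * of_real (s ^ (n - k) * t ^ k) = 0" and l: "1 + a * of_real (s ^ (n - l) * t ^ l) = 0"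
  shows "s ^ (n - k) * t ^ k = s ^ (n - l) * t ^ l" "even k = even l"
proof -
  have "a * of_real (s ^ (n - k) * t ^ k) = a * of_real (s ^ (n - l) * t ^ l)"
    using k l by (metis add_left_cancel)
  then show eq: "s ^ (n - k) * t ^ k = s ^ (n - l) * t ^ l"
    using a0 by (simp only: mult_cancel_left of_real_eq_iff) simp
  have "s ^ (n - i) * t ^ i > 0 \<longleftrightarrow> even i" for i
    using st by (auto simp: zero_less_mult_iff zero_less_power_eq)
  then show "even k = even l" using eq by metis
qed

lemma degree_ge_3:
  assumes "n = 3 \<or> n = 4"
  shows "n = 4" "a = -16" "\<exists>A B. \<forall>z. f z = A * exp (z / 2) + B * exp (- z / 2)"
proof -
  have n3: "n \<ge> 3" using assms by auto
  obtain A B and s t :: real where AB: "A \<noteq> 0" "B \<noteq> 0" and st: "s > 0" "t < 0"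
    and f: "\<And>z. f z = A * exp (of_real s * z) + B * exp (of_real t * z)"
    using two_exponentials[OF n3] by blast
  obtain i j where ij: "i \<le> n" "j \<le> n" "real (n - i) * s + real i * t = 1" "real (n - j) * s + real j * t = -1"
    and z: "\<And>k. k \<le> n \<Longrightarrow> k \<noteq> i \<Longrightarrow> k \<noteq> j \<Longrightarrow> 1 + a * of_real (s ^ (n - k) * t ^ k) = 0"
    using two_exponentials_exponents[OF AB st f] by blast
  have par: "even k = even l"
      and vals: "s ^ (n - k) * t ^ k = s ^ (n - l) * t ^ l"
    if "k \<le> n" "k \<noteq> i" "k \<noteq> j" "l \<le> n" "l \<noteq> i" "l \<noteq> j" for k l
    using exponents_same_parity[OF st z z] that by blast+
  \<comment> \<open>All indices other than \<open>i\<close> and \<open>j\<close> have the same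
    parity. Among 0, ..., n this leaves only the listed pairs.\<close>
  have ijp: "even i = even j \<and> (i, j) \<in> {(0,2),(2,0),(1,3),(3,1)}"
  proof -
    have "i \<in> {0,1,2,3,4}" "j \<in> {0,1,2,3,4}" using ij assms by auto
    then show ?thesis
      using assms par[of 0 1] par[of 1 2] par[of 2 3] par[of 3 4] par[of 0 3] par[of 1 4] par[of 0 4] ij
      by auto
  qed
  \<comment> \<open>Two vanishing factors whose indices differ by 2 give
    \<open>s\<^sup>2 = t\<^sup>2\<close>, hence \<open>t = - s\<close>.\<close>
  have "\<exists>k. k + 2 \<le> n \<and> k \<noteq> i \<and> k \<noteq> j \<and> k + 2 \<noteq> i \<and> k + 2 \<noteq> j"
  proof (cases "even i")
    case True
    then show ?thesis using ijp n3 by (intro exI[of _ 1]) auto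
  next
    case False
    then show ?thesis using ijp n3 by (intro exI[of _ 0]) auto
  qed
  then obtain k where k: "k + 2 \<le> n" "k \<noteq> i" "k \<noteq> j" "k + 2 \<noteq> i" "k + 2 \<noteq> j" by blast
  then have "s ^ (n - k) * t ^ k = s ^ (n - (k + 2)) * t ^ (k + 2)" by (intro vals) auto
  moreover have "n - k = (n - (k + 2)) + 2" using k(1) by simp
  ultimately have "s ^ (n - (k + 2)) * t ^ k * s\<^sup>2 = s ^ (n - (k + 2)) * t ^ k * t\<^sup>2"
    by (simp only: power_add mult_ac)
  then have "s\<^sup>2 = t\<^sup>2" using st by simp
  then have ts: "t = - s" using st by (auto simp: power2_eq_iff)
  \<comment> \<open>With \<open>t = - s\<close> the exponents are \<open>(n - 2 * k) * s\<close>, so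
    1 and -1 sit at complementary indices. The sum of two indices of equal parity is even, which
    excludes \<open>n = 3\<close>.\<close>
  have ijn: "i + j = n"
  proof -
    have "(real n - 2 * real i) * s = 1" "(real n - 2 * real j) * s = -1"
      using ij by (simp_all add: ts of_nat_diff algebra_simps)
    then have "((real n - 2 * real i) + (real n - 2 * real j)) * s = 0"
      unfolding distrib_right[of "real n - 2 * real i" "real n - 2 * real j"] by simp
    then have "real (i + j) = real n" using st by simp
    then show ?thesis by (simp only: of_nat_eq_iff)
  qed
  show n4: "n = 4" using ijn ijp assms by auto
  then have "(i, j) \<in> {(1,3),(3,1)}" using ijn ijp by auto
  then have s: "s = 1/2" using ij n4 ts st by auto
  have "1 + a * of_real (s ^ (n - 0) * t ^ 0) = 0"
    using ijn n4 ijp by (intro z) auto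
  then have "1 + a / 16 = 0" by (simp add: n4 s power_divide)
  moreover have "a = 16 * (1 + a / 16) - 16" by simp
  ultimately show "a = -16" by simp
  have "\<forall>z. f z = A * exp (z / 2) + B * exp (- z / 2)" using f s ts by simp
  then show "\<exists>A B. \<forall>z. f z = A * exp (z / 2) + B * exp (- z / 2)" by blast
qed


section \<open>Degree two with a coefficient that is not a negative real\<close>

text \<open>Suppose \<open>f\<close> and its reflection \<open>F\<close> differ, with contact of
  order \<open>p\<close> at \<open>z0\<close>. They share value and second derivative there, so the
  balance of orders reads \<open>w = - a * p * s\<close> with \<open>w = f z0\<close> and
  \<open>s\<close> the second derivative. Together with \<open>zero_facts\<close> this yields
  \<open>a * p\<^sup>2 = 2 * (1 - p)\<close>, and a nonzero \<open>a\<close> of this kind is a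
  negative real.\<close>

lemma reflection_symmetry:
  assumes n: "n = 2" and a: "\<not> (\<exists>r<0. a = of_real r)" and z0: "deriv f z0 = 0"
  shows "f (2 * z0 - z) = f z"
proof (rule ccontr)
  assume ne: "f (2 * z0 - z) \<noteq> f z"
  define F where "F = (\<lambda>z. f ((-1) * z + 2 * z0))"
  have hF: "F holomorphic_on UNIV" unfolding F_def by (rule entire_affine[OF hol])
  have dF: "deriv F = (\<lambda>z. - deriv f ((-1) * z + 2 * z0))"
    unfolding F_def deriv_affine[OF hol] by simp
  have DF: "(F has_field_derivative deriv F z) (at z)" for z
    by (rule holomorphic_derivI[OF hF open_UNIV UNIV_I])
  have D2F: "(deriv F has_field_derivative deriv (deriv f) ((-1) * z + 2 * z0)) (at z)" for z
    unfolding dF by (rule DERIV_cong[OF DERIV_minus[OF DERIV_chain2[OF D1]]])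
      (auto intro!: derivative_eq_intros)
  have eqF: "F z ^ 2 + a * deriv F z ^ 2 = cosh z" for z
  proof -
    have "sinh (2 * z0) = 0" using zero_facts(1)[OF z0] by (simp add: sinh_double)
    moreover have "cosh (2 * z0) = 1"
      using zero_facts(1)[OF z0] by (simp add: cosh_double cosh_square_eq)
    ultimately have "cosh (2 * z0 - z) = cosh z" by (simp add: cosh_diff)
    then show ?thesis using eq[of "2 * z0 - z"] unfolding dF by (simp add: n F_def)
  qed
  define u where "u = (\<lambda>z. f z - F z)"
  define U where "U = (\<lambda>z. f z + F z)"
  define V where "V = (\<lambda>z. deriv f z + deriv F z)"
  have du: "deriv u z = deriv f z - deriv F z" for z
    unfolding u_def by (intro DERIV_imp_deriv DERIV_diff D0 DF)
  have dV: "deriv V z0 = 2 * deriv (deriv f) z0"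
    unfolding V_def by (rule DERIV_imp_deriv[OF DERIV_cong[OF DERIV_add[OF D1 D2F]]]) simp
  obtain p :: nat where p: "p \<ge> 1" "U z0 = - a * of_nat p * deriv V z0"
  proof (rule zero_order_balance[of u U V a z0 z])
    show "u holomorphic_on UNIV" "U holomorphic_on UNIV" "V holomorphic_on UNIV"
      unfolding u_def U_def V_def by (intro holomorphic_intros hol hF hol' entire_deriv)+
    show "u z * U z = - a * (deriv u z * V z)" for z
    proof -
      have "(f z - F z) * (f z + F z) = - a * ((deriv f z - deriv F z) * (deriv f z + deriv F z))"
      proof -
        have e: "(f z)\<^sup>2 = cosh z - a * (deriv f z)\<^sup>2" "(F z)\<^sup>2 = cosh z - a * (deriv F z)\<^sup>2"
          using eq[of z] eqF[of z] unfolding n by (simp_all add: eq_diff_eq)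
        have "(f z - F z) * (f z + F z) = (f z)\<^sup>2 - (F z)\<^sup>2"
          by (simp add: algebra_simps power2_eq_square)
        also have "\<dots> = - a * ((deriv f z)\<^sup>2 - (deriv F z)\<^sup>2)" unfolding e by (simp add: algebra_simps)
        finally show ?thesis by (simp add: algebra_simps power2_eq_square)
      qed
      then show ?thesis unfolding du by (simp add: u_def U_def V_def)
    qed
    show "u z0 = 0" by (simp add: u_def F_def)
    show "V z0 = 0" using z0 by (simp add: V_def dF)
    show "u z \<noteq> 0" using ne by (simp add: u_def F_def)
  qed
  define w s where "w = f z0" and "s = deriv (deriv f) z0"
  have "2 * w = 2 * (- a * of_nat p * s)"
    using p(2) unfolding dV by (simp add: U_def F_def w_def s_def)
  then have w: "w = - a * of_nat p * s" by simp
  \<comment> \<open>For \<open>n = 2\<close> the values of \<open>deriv (deriv f) z0 * G z0\<close>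
    and of \<open>f z0 ^ 2\<close> are both \<open>cosh z0\<close>.\<close>
  have "s * (2 * (w + a * s)) = w ^ 2"
    using zero_facts(2)[OF z0] zero_facts(4)[OF z0, unfolded G_def] by (simp add: n w_def s_def mult_ac distrib_left)
  then have "s * s * (a * (2 * (1 - of_nat p))) = s * s * (a * (a * of_nat p ^ 2))"
    unfolding w by (simp add: algebra_simps power2_eq_square)
  moreover have "s \<noteq> 0" using zero_facts(5)[OF z0] by (simp add: s_def)
  ultimately have pa: "2 * (1 - of_nat p) = a * of_nat p ^ 2" using a0 by simp
  have "a = of_real (2 * (1 - real p) / real p ^ 2)"
    using pa p(1) by (simp add: field_simps)
  moreover have "2 * (1 - real p) / real p ^ 2 < 0"
  proof -
    have "p \<noteq> 1" using pa a0 by auto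
    then show ?thesis using p(1) by (intro divide_neg_pos) auto
  qed
  ultimately show False using a by blast
qed

text \<open>Now \<open>deriv f\<close> is odd about each critical point, which removes the
  exponential factor from the critical form. The square then has exponents 0, \<open>1/D\<close>,
  \<open>2/D\<close> up to sign, and to produce \<open>exp z\<close> one of them must be 1, so
  \<open>D\<close> is 1 or 2; \<open>D = 1\<close> would give \<open>a = -1\<close>.\<close>

lemma symmetric_case:
  assumes n: "n = 2" and a: "\<not> (\<exists>r<0. a = of_real r)"
  shows "a = 4 \<and> (\<exists>A B. \<forall>z. f z = A * exp (z / 2) + B * exp (- z / 2))"
proof -
  have f'_odd: "deriv f (2 * z0 - z) = - deriv f z" if "deriv f z0 = 0" for z0 z
  proof -
    have "(\<lambda>z. f ((-1) * z + 2 * z0)) = f"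
      using reflection_symmetry[OF n a that] by (simp add: fun_eq_iff)
    then have "deriv f z = (-1) * deriv f ((-1) * z + 2 * z0)"
      using deriv_affine[OF hol, of "-1" "2 * z0" z] by simp
    then show ?thesis by simp
  qed
  then have refl: "deriv f (2 * z - w) = 0" if "deriv f z = 0" "deriv f w = 0" for z w
    using that by simp
  obtain D :: nat and z0 \<alpha> m where D: "D > 0" and z0: "deriv f z0 = 0"
    and f': "\<And>z. deriv f z = exp (\<alpha> * z + m) * sinh ((z - z0) / of_nat D)"
    using critical_form[OF refl] by metis
  define d :: complex where "d = 1 / of_nat D"
  have d0: "d \<noteq> 0" using D by (simp add: d_def)
  \<comment> \<open>sinh is already odd about \<open>z0\<close>, so the exponential factor would
    have to be even about \<open>z0\<close>.\<close>
  have "\<alpha> = 0"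
  proof (rule ccontr)
    assume \<alpha>: "\<alpha> \<noteq> 0"
    have "(\<Sum>(c, l)\<leftarrow>[(1, \<alpha> + d), (-1, \<alpha> - d), (-1, d - \<alpha>), (1, - \<alpha> - d)]. c * exp (l * w)) = 0" for w
    proof -
      have "exp (\<alpha> * (z0 - w) + m) * sinh (- (w * d)) = - (exp (\<alpha> * (z0 + w) + m) * sinh (w * d))"
        using f'_odd[OF z0, of "z0 + w"] by (simp add: f' d_def)
      then have "exp (\<alpha> * z0 + m) * sinh (w * d) * (exp (\<alpha> * w) - exp (- (\<alpha> * w))) = 0"
        by (auto simp: algebra_simps exp_add exp_diff exp_minus divide_inverse)
      then have "(exp (w * d) - exp (- (w * d))) * (exp (\<alpha> * w) - exp (- (\<alpha> * w))) = 0"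
        by (auto simp: sinh_field_def)
      then show ?thesis
        by (simp add: algebra_simps exp_add exp_diff exp_minus divide_inverse)
    qed
    from exp_independent[OF this, of "\<alpha> + d"] show False
      using \<alpha> d0 by (auto split: if_splits)
  qed
  define K where "K = exp (m - z0 * d) / 2"
  define M where "M = - exp (m + z0 * d) / 2"
  have KM: "K \<noteq> 0" "M \<noteq> 0" by (auto simp: K_def M_def)
  have f'2: "deriv f z = K * exp (d * z) + M * exp ((- d) * z)" for z
  proof -
    have "exp (m - z0 * d) * exp (d * z) = exp m * exp ((z - z0) / of_nat D)"
      "exp (m + z0 * d) * exp ((- d) * z) = exp m * exp (- ((z - z0) / of_nat D))"
      unfolding exp_add[symmetric] by (simp_all add: d_def diff_divide_distrib algebra_simps)
    then show ?thesis
      by (simp add: f' \<open>\<alpha> = 0\<close> sinh_field_def K_def M_def right_diff_distrib diff_divide_distrib)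
  qed
  obtain C where C: "\<And>z. f z = K / d * exp (d * z) + M / (- d) * exp ((- d) * z) + C"
    using antiderivative_two_exp[of f K d M "- d"] D0 d0 unfolding f'2 by auto
  define A B where "A = K / d" and "B = M / (- d)"
  have AB: "A \<noteq> 0" "B \<noteq> 0" using KM d0 by (auto simp: A_def B_def)
  have f: "f z = A * exp (d * z) + B * exp (- (d * z)) + C" for z
    using C[of z] by (simp add: A_def B_def)
  have f'3: "deriv f z = d * (A * exp (d * z) - B * exp (- (d * z)))" for z
    using f'2[of z] d0 by (simp add: A_def B_def algebra_simps)
  define L where "L = [(A\<^sup>2 * (1 + a * d\<^sup>2), of_real (2 / real D)), (2 * A * C, of_real (1 / real D)),
    (2 * A * B * (1 - a * d\<^sup>2) + C\<^sup>2, of_real 0), (2 * B * C, of_real (- 1 / real D)),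
    (B\<^sup>2 * (1 + a * d\<^sup>2), of_real (- 2 / real D)), (- 1 / 2, of_real 1), (- 1 / 2, of_real (- 1) :: complex)]"
  have Lz: "(\<Sum>(c, l)\<leftarrow>L. c * exp (l * z)) = 0" for z
  proof -
    define x where "x = exp (d * z)"
    define y where "y = exp (- (d * z))"
    have xy: "x * y = 1" by (simp add: x_def y_def exp_minus)
    have x2: "exp (of_real (2 / real D) * z) = x\<^sup>2" "exp (of_real (- 2 / real D) * z) = y\<^sup>2"
      by (simp_all add: x_def y_def exp_double[symmetric] d_def)
    have x1: "exp (of_real (1 / real D) * z) = x" "exp (of_real (- 1 / real D) * z) = y"
      by (simp_all add: x_def y_def d_def)
    have "(A * x + B * y + C)\<^sup>2 + a * (d * (A * x - B * y))\<^sup>2 = cosh z"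
      using eq[of z] unfolding n f f'3 x_def y_def .
    then have "A\<^sup>2 * (1 + a * d\<^sup>2) * x\<^sup>2 + 2 * A * C * x + (2 * A * B * (1 - a * d\<^sup>2) * (x * y) + C\<^sup>2)
       + 2 * B * C * y + B\<^sup>2 * (1 + a * d\<^sup>2) * y\<^sup>2 = cosh z"
      by (simp add: algebra_simps power2_eq_square)
    then show ?thesis
      unfolding L_def xy list.map prod.case sum_list.Cons sum_list.Nil x1 x2
      by (simp add: cosh_field_def field_simps)
  qed
  note ind = exp_independent[OF Lz, unfolded L_def, of "of_real m" for m]
  have simps: "complex_of_real x = complex_of_real y \<longleftrightarrow> x = y" for x y by (rule of_real_eq_iff)
  consider "D = 1" | "D = 2" | "D \<ge> 3" using D by linarith
  then show ?thesis
  proof cases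
    case 1
    have "A\<^sup>2 * (1 + a * d\<^sup>2) = 0"
      using ind[of 2] by (simp add: 1)
    then have "a = of_real (-1)" using AB 1 by (simp add: d_def add_eq_0_iff)
    then show ?thesis using a by (metis neg_less_0_iff_less zero_less_one)
  next
    case 2
    have "2 * A * C = 0"
      using ind[of "1/2"] by (simp add: 2)
    then have C0: "C = 0" using AB by simp
    have "2 * A * B * (1 - a * d\<^sup>2) + C\<^sup>2 = 0"
      using ind[of 0] by (simp add: 2)
    then have "a = 4" using AB C0 2 by (simp add: d_def power2_eq_square)
    moreover have "\<forall>z. f z = A * exp (z / 2) + B * exp (- z / 2)" using f 2 C0 by (simp add: d_def)
    ultimately show ?thesis by blast
  next
    case 3
    have "1 / real D < 1" "2 / real D < 1" "0 < 1 / real D" "0 < 2 / real D" using 3 by simp_all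
    then have "1 / real D < 1" "2 / real D < 1" "- 1 / real D < 1" "- 2 / real D < 1"
      unfolding minus_divide_left[symmetric] by linarith+
    then have "1 / real D \<noteq> 1" "2 / real D \<noteq> 1" "- 1 / real D \<noteq> 1" "- 2 / real D \<noteq> 1" by linarith+
    then have False
      using ind[of 1] 3
      by (auto simp: simps simp del: of_real_numeral of_real_divide of_real_minus of_real_1 of_real_0 split: if_splits)
    then show ?thesis ..
  qed
qed

end

section \<open>Reflection in the imaginary axis\<close>

lemma entire_mult_eq_0:
  assumes "p holomorphic_on UNIV" "q holomorphic_on UNIV" "\<And>z. p z * q z = 0" "p w \<noteq> 0"
  shows "q z = (0::complex)"
proof -
  have "open {z. p z \<noteq> 0}"
    using assms(1) by (auto intro!: open_Collect_neq holomorphic_on_imp_continuous_on)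
  then show ?thesis
    by (rule analytic_continuation_open[of "{z. p z \<noteq> 0}" UNIV q "\<lambda>_. 0"])
      (use assms in \<open>auto simp: mult_eq_0_iff\<close>)
qed

text \<open>Schwarz reflection in the imaginary axis: the outer conjugation restores holomorphy
  after the antiholomorphic map \<open>z |-> - cnj z\<close>.\<close>

definition conj_reflect :: "(complex \<Rightarrow> complex) \<Rightarrow> complex \<Rightarrow> complex" where
  "conj_reflect f z = cnj (f (- cnj z))"

lemma conj_reflect_DERIV:
  assumes "f holomorphic_on UNIV"
  shows "(conj_reflect f has_field_derivative - conj_reflect (deriv f) z) (at z)"
proof -
  have "(f has_field_derivative deriv f (cnj (- z))) (at (cnj (- z)))"
    by (rule holomorphic_derivI[OF assms]) auto
  from has_field_derivative_cnj_cnj[OF this]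
  have "((cnj \<circ> f \<circ> cnj) has_field_derivative cnj (deriv f (cnj (- z)))) (at (- z))" .
  then have "((\<lambda>z. (cnj \<circ> f \<circ> cnj) (- z)) has_field_derivative cnj (deriv f (cnj (- z))) * (-1)) (at z)"
    by (rule DERIV_chain2) (auto intro!: derivative_eq_intros)
  then show ?thesis by (simp add: conj_reflect_def[abs_def])
qed

lemma conj_reflect_entire:
  assumes "f holomorphic_on UNIV"
  shows "conj_reflect f holomorphic_on UNIV"
  using conj_reflect_DERIV[OF assms] by (auto simp: holomorphic_on_def field_differentiable_def)

lemma exp_type_conj_reflect: "exp_type f \<Longrightarrow> exp_type (conj_reflect f)"
  unfolding exp_type_def conj_reflect_def by (metis complex_mod_cnj norm_minus_cancel)

text \<open>The zeros of \<open>P\<close> lie on the imaginary axis, which the reflection fixes pointwise.\<close>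

lemma conj_reflect_quotient:
  assumes hol: "P holomorphic_on UNIV" "K holomorphic_on UNIV" and et: "exp_type P" "exp_type K"
    and PK: "\<And>z. P z * K z = sinh (z + \<beta>)" and \<beta>: "Re \<beta> = 0"
  obtains l m :: real where "\<And>z. conj_reflect P z = P z * exp (of_real l * z + \<i> * of_real m)"
proof -
  have cosh_sq: "cosh (z + \<beta>) ^ 2 = 1" if "sinh (z + \<beta>) = 0" for z
    using that by (simp add: cosh_square_eq)
  have fixed: "- cnj z = z" if "sinh (z + \<beta>) = 0" for z
  proof -
    obtain k :: int where "z + \<beta> = \<i> * of_real (of_int k * pi)"
      using \<open>sinh (z + \<beta>) = 0\<close> unfolding sinh_eq_0_iff by blast
    then have "Re (z + \<beta>) = 0" by simp
    then show ?thesis using \<beta> by (simp add: complex_eq_iff)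
  qed
  have simple: "deriv P z \<noteq> 0" if "P z = 0" for z
  proof -
    have "deriv (\<lambda>z. P z * K z) z = P z * deriv K z + deriv P z * K z"
      by (rule deriv_mult_entire[OF hol])
    moreover have "deriv (\<lambda>z. P z * K z) z = cosh (z + \<beta>)"
      unfolding PK by (rule DERIV_imp_deriv) (auto intro!: derivative_eq_intros)
    ultimately have "deriv P z * K z = cosh (z + \<beta>)" using that by simp
    moreover have "sinh (z + \<beta>) = 0" using PK[of z] that by simp
    ultimately show ?thesis using cosh_sq by fastforce
  qed
  have iff: "conj_reflect P z = 0 \<longleftrightarrow> P z = 0" for z
  proof
    assume "conj_reflect P z = 0"
    then have *: "P (- cnj z) = 0" by (simp add: conj_reflect_def)
    then have "sinh (- cnj z + \<beta>) = 0" using PK[of "- cnj z"] by simp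
    then have "- cnj (- cnj z) = - cnj z" by (rule fixed)
    then show "P z = 0" using * by simp
  next
    assume P: "P z = 0"
    then have "sinh (z + \<beta>) = 0" using PK[of z] by simp
    then show "conj_reflect P z = 0" using P fixed by (simp add: conj_reflect_def)
  qed
  obtain l m where lm: "\<And>z. conj_reflect P z = P z * exp (l * z + m)"
  proof (rule quotient_is_exp[OF conj_reflect_entire[OF hol(1)] exp_type_conj_reflect[OF et(1)] hol(1) et(2)])
    show "P z * K z = sinh (1 * z + \<beta>)" for z using PK by simp
    show "conj_reflect P z = 0 \<longleftrightarrow> P z = 0" for z by (rule iff)
    show "deriv P z \<noteq> 0 \<and> deriv (conj_reflect P) z \<noteq> 0" if "P z = 0" for z
    proof -
      have "deriv (conj_reflect P) z = - conj_reflect (deriv P) z"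
        by (rule DERIV_imp_deriv[OF conj_reflect_DERIV[OF hol(1)]])
      moreover have "- cnj z = z" using PK[of z] that by (intro fixed) simp
      ultimately show ?thesis using simple[OF that] by (simp add: conj_reflect_def)
    qed
  qed (auto intro: that)
  \<comment> \<open>On the imaginary axis the reflection preserves the modulus, so the multiplier is
    unimodular at every point of the axis where \<open>P\<close> does not vanish.\<close>
  have re: "Re (l * z + m) = 0" if "- cnj z = z" "P z \<noteq> 0" for z
  proof -
    have "norm (conj_reflect P z) = norm (P z)" using that(1) by (simp add: conj_reflect_def)
    then have "norm (exp (l * z + m)) = 1" using that(2) unfolding lm by (simp add: norm_mult)
    then show ?thesis by simp
  qed
  have Py: "P (\<i> * of_real y - \<beta>) \<noteq> 0" if "0 < y" "y < pi" for y
  proof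
    assume "P (\<i> * of_real y - \<beta>) = 0"
    then have "sinh (\<i> * of_real y) = 0" using PK[of "\<i> * of_real y - \<beta>"] by simp
    then obtain k :: int where "\<i> * of_real y = \<i> * of_real (of_int k * pi)"
      unfolding sinh_eq_0_iff by blast
    then have y: "y = of_int k * pi" by (simp only: mult_cancel_left of_real_eq_iff) simp
    then have "of_int k > (0::real)" "of_int k < (1::real)"
      using that by (auto simp: zero_less_mult_iff)
    then show False by simp
  qed
  have fx: "- cnj (\<i> * of_real y - \<beta>) = \<i> * of_real y - \<beta>" for y
    using \<beta> by (simp add: complex_eq_iff)
  have e: "Re (l * (\<i> * of_real y - \<beta>) + m) = 0" if "0 < y" "y < pi" for y
    using re[OF fx Py[OF that]] .
  \<comment> \<open>Both 1 and 2 lie strictly between 0 and pi, hence between consecutive zeros; two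
    such points determine the affine exponent on the axis.\<close>
  have "Im l * 1 = Im l * 2"
    using e[of 1] e[of 2] pi_gt3 \<beta> by (simp add: algebra_simps)
  then have il: "Im l = 0" by simp
  then have "Re m = 0" using e[of 1] pi_gt3 \<beta> by simp
  then have "l = of_real (Re l)" "m = \<i> * of_real (Im m)" using il by (simp_all add: complex_eq_iff)
  then have "conj_reflect P z = P z * exp (of_real (Re l) * z + \<i> * of_real (Im m))" for z
    using lm[of z] by metis
  then show ?thesis by (rule that)
qed

text \<open>The multipliers are \<open>A = V * exp (l1 * z)\<close>, \<open>B = U * exp (- l1 * z)\<close> and \<open>D = W * exp (l * z)\<close>, by which the
  reflection multiplies \<open>g\<close>, \<open>h\<close> and \<open>f'\<close>. The list spells out the identity of \<open>multiplier_relation\<close> below,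
  with \<open>k = 1 / c\<close>; comparing its extreme exponents leaves few possibilities.\<close>

lemma multiplier_exponents:
  fixes l l1 \<kappa> :: real and W V U k q p :: complex
  assumes nz: "W \<noteq> 0" and UV: "U * V = 1" and norm: "norm W = 1" "norm V = 1"
    and kqp: "k = of_real \<kappa>" "p = of_real l" "q = of_real l1"
    and eq: "\<And>z. (\<Sum>(c, x)\<leftarrow>
       [(-(2*k + 2*q + 1) * V, of_real (l1 + 1)), ((2*k + 2*q - 1) * U, of_real (-l1 + 1)),
        ((2*p + 4) * W, of_real (l + 1)), ((1 - p + q + 2*k) * (W * V\<^sup>2), of_real (l + 2*l1 + 1)),
        ((1 - p - q - 2*k) * (W * U\<^sup>2), of_real (l - 2*l1 + 1)), ((-2*k - 3) * (W\<^sup>2 * V), of_real (2*l + l1 + 1)),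
        ((2*k - 3) * (W\<^sup>2 * U), of_real (2*l - l1 + 1)), (2 * W ^ 3, of_real (3*l + 1)),
        ((1 - 2*k - 2*q) * V, of_real (l1 - 1)), ((2*k + 2*q + 1) * U, of_real (-l1 - 1)),
        ((2*p - 4) * W, of_real (l - 1)), ((-1 - p + q + 2*k) * (W * V\<^sup>2), of_real (l + 2*l1 - 1)),
        ((-1 - p - q - 2*k) * (W * U\<^sup>2), of_real (l - 2*l1 - 1)), ((3 - 2*k) * (W\<^sup>2 * V), of_real (2*l + l1 - 1)),
        ((2*k + 3) * (W\<^sup>2 * U), of_real (2*l - l1 - 1)), (-2 * W ^ 3, of_real (3*l - 1))].
       c * exp (x * z)) = (0::complex)"
  shows "l = 0 \<or> l = l1 \<and> (W = V \<or> l\<^sup>2 = 1 \<and> \<kappa> = - 3/2 * l \<and> W = - V)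
     \<or> l = - l1 \<and> (W = U \<or> l\<^sup>2 = 1 \<and> \<kappa> = 3/2 * l \<and> W = - U)"
proof -
  note ind = exp_independent[OF eq, of "of_real m" for m, unfolded list.map prod.case sum_list.Cons sum_list.Nil of_real_eq_iff]
  have UV0: "U \<noteq> 0" "V \<noteq> 0" using UV by auto
  have "norm U * norm V = 1" using UV by (metis norm_mult norm_one)
  then have nU: "norm U = 1" using norm by simp
  \<comment> \<open>The position of \<open>l\<close> relative to \<open>l1\<close> and
    \<open>- l1\<close> decides which terms have the largest and the smallest exponent. In the first
    four cases the extreme term is unique, so its coefficient vanishes; when \<open>l\<close> equals
    \<open>l1\<close> or \<open>- l1\<close>, several terms meet there.\<close>
  consider "l1 < l" "- l1 < l" | "l < l1" "l < - l1" | "l < l1" "- l1 < l" | "l1 < l" "l < - l1"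
    | "l = 0" | "l = l1" "l > 0" | "l = l1" "l < 0" | "l = - l1" "l > 0" | "l = - l1" "l < 0"
    by linarith
  then show ?thesis
  proof cases
    case 1
    have r: "2 * W ^ 3 = 0"
      using ind[of "3*l + 1"] 1 by (simp add: if_not_P)
    then show ?thesis using nz by simp
  next
    case 2
    have r: "-2 * W ^ 3 = 0"
      using ind[of "3*l - 1"] 2 by (simp add: if_not_P)
    then show ?thesis using nz by simp
  next
    case 3
    have r1: "(1 - p + q + 2*k) * (W * V\<^sup>2) = 0"
      using ind[of "l + 2*l1 + 1"] 3 by (simp add: if_not_P)
    have r2: "(-1 - p - q - 2*k) * (W * U\<^sup>2) = 0"
      using ind[of "l - 2*l1 - 1"] 3 by (simp add: if_not_P)
    have "p = 0" using r1 r2 nz UV0 by auto algebra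
    then show ?thesis by (simp add: kqp)
  next
    case 4
    have r1: "(1 - p - q - 2*k) * (W * U\<^sup>2) = 0"
      using ind[of "l - 2*l1 + 1"] 4 by (simp add: if_not_P)
    have r2: "(-1 - p + q + 2*k) * (W * V\<^sup>2) = 0"
      using ind[of "l + 2*l1 - 1"] 4 by (simp add: if_not_P)
    have "p = 0" using r1 r2 nz UV0 by auto algebra
    then show ?thesis by (simp add: kqp)
  next
    case 5
    then show ?thesis by simp
  next
    case 6
    have r1: "(1 - p + q + 2*k) * (W * V\<^sup>2) + ((-2*k - 3) * (W\<^sup>2 * V) + (2 * W ^ 3)) = 0"
      using ind[of "3*l + 1"] 6 by (simp add: if_not_P)
    have r2: "(2*k + 2*q + 1) * U + ((-1 - p - q - 2*k) * (W * U\<^sup>2)) = 0"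
      using ind[of "-l1 - 1"] 6 by (simp add: if_not_P)
    have qp: "q = p" using 6 by (simp add: kqp)
    \<comment> \<open>The sum of the coefficients that meet at the extreme exponent factors, with
      \<open>W = V\<close> as one root. The other root becomes \<open>W = - p * V\<close>, and as
      \<open>W\<close> and \<open>V\<close> are unimodular, \<open>\<bar>l\<bar> = 1\<close>. The
      three remaining cases are analogous.\<close>
    have r1': "W * ((W - V) * (2 * W - (1 + 2 * k) * V)) = 0" using r1 unfolding qp by algebra
    have r2': "(2 * k + 2 * p + 1) * (U * (1 - W * U)) = 0" using r2 unfolding qp by algebra
    show ?thesis
    proof (cases "W = V")
      case True
      then show ?thesis using 6 by simp
    next
      case False
      have "W - V = V * (W * U - 1)" using UV by algebra
      then have "1 - W * U \<noteq> 0" using False by auto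
      then have k: "2 * k + 2 * p + 1 = 0" using r2' UV0 by simp
      have "2 * W - (1 + 2 * k) * V = 0" using r1' nz False by simp
      then have W: "W = - p * V" using k by algebra
      then have "\<bar>l\<bar> = 1" using norm UV nU by (simp add: norm_mult kqp)
      then have l: "l = 1" using 6 by simp
      moreover have "\<kappa> = - 3/2" using arg_cong[OF k, of Re] l by (simp add: kqp)
      ultimately show ?thesis using 6 W by (simp add: kqp)
    qed
  next
    case 7
    have r1: "(-1 - p + q + 2*k) * (W * V\<^sup>2) + ((3 - 2*k) * (W\<^sup>2 * V) + (-2 * W ^ 3)) = 0"
      using ind[of "3*l - 1"] 7 by (simp add: if_not_P)
    have r2: "(2*k + 2*q - 1) * U + ((1 - p - q - 2*k) * (W * U\<^sup>2)) = 0"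
      using ind[of "-l1 + 1"] 7 by (simp add: if_not_P)
    have qp: "q = p" using 7 by (simp add: kqp)
    have r1': "W * ((W - V) * ((1 - 2 * k) * V - 2 * W)) = 0" using r1 unfolding qp by algebra
    have r2': "(2 * k + 2 * p - 1) * (U * (1 - W * U)) = 0" using r2 unfolding qp by algebra
    show ?thesis
    proof (cases "W = V")
      case True
      then show ?thesis using 7 by simp
    next
      case False
      have "W - V = V * (W * U - 1)" using UV by algebra
      then have "1 - W * U \<noteq> 0" using False by auto
      then have k: "2 * k + 2 * p - 1 = 0" using r2' UV0 by simp
      have "(1 - 2 * k) * V - 2 * W = 0" using r1' nz False by simp
      then have W: "W = p * V" using k by algebra
      then have "\<bar>l\<bar> = 1" using norm UV nU by (simp add: norm_mult kqp)
      then have l: "l = - 1" using 7 by simp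
      moreover have "\<kappa> = 3/2" using arg_cong[OF k, of Re] l by (simp add: kqp)
      ultimately show ?thesis using 7 W by (simp add: kqp)
    qed
  next
    case 8
    have r1: "(1 - p - q - 2*k) * (W * U\<^sup>2) + ((2*k - 3) * (W\<^sup>2 * U) + (2 * W ^ 3)) = 0"
      using ind[of "3*l + 1"] 8 by (simp add: if_not_P)
    have r2: "(1 - 2*k - 2*q) * V + ((-1 - p + q + 2*k) * (W * V\<^sup>2)) = 0"
      using ind[of "l1 - 1"] 8 by (simp add: if_not_P)
    have qp: "q = - p" using 8 by (simp add: kqp)
    have r1': "W * ((W - U) * (2 * W + (2 * k - 1) * U)) = 0" using r1 unfolding qp by algebra
    have r2': "(1 - 2 * k + 2 * p) * (V * (1 - W * V)) = 0" using r2 unfolding qp by algebra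
    show ?thesis
    proof (cases "W = U")
      case True
      then show ?thesis using 8 by simp
    next
      case False
      have "W - U = U * (W * V - 1)" using UV by algebra
      then have "1 - W * V \<noteq> 0" using False by auto
      then have k: "1 - 2 * k + 2 * p = 0" using r2' UV0 by simp
      have "2 * W + (2 * k - 1) * U = 0" using r1' nz False by simp
      then have W: "W = - p * U" using k by algebra
      then have "\<bar>l\<bar> = 1" using norm UV nU by (simp add: norm_mult kqp)
      then have l: "l = 1" using 8 by simp
      moreover have "\<kappa> = 3/2" using arg_cong[OF k, of Re] l by (simp add: kqp)
      ultimately show ?thesis using 8 W by (simp add: kqp)
    qed
  next
    case 9
    have r1: "(-1 - p - q - 2*k) * (W * U\<^sup>2) + ((2*k + 3) * (W\<^sup>2 * U) + (-2 * W ^ 3)) = 0"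
      using ind[of "3*l - 1"] 9 by (simp add: if_not_P)
    have r2: "-(2*k + 2*q + 1) * V + ((1 - p + q + 2*k) * (W * V\<^sup>2)) = 0"
      using ind[of "l1 + 1"] 9 by (simp add: if_not_P)
    have qp: "q = - p" using 9 by (simp add: kqp)
    have r1': "W * ((W - U) * ((1 + 2 * k) * U - 2 * W)) = 0" using r1 unfolding qp by algebra
    have r2': "(1 - 2 * p + 2 * k) * (V * (1 - W * V)) = 0" using r2 unfolding qp by algebra
    show ?thesis
    proof (cases "W = U")
      case True
      then show ?thesis using 9 by simp
    next
      case False
      have "W - U = U * (W * V - 1)" using UV by algebra
      then have "1 - W * V \<noteq> 0" using False by auto
      then have k: "1 - 2 * p + 2 * k = 0" using r2' UV0 by simp
      have "(1 + 2 * k) * U - 2 * W = 0" using r1' nz False by simp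
      then have W: "W = p * U" using k by algebra
      then have "\<bar>l\<bar> = 1" using norm UV nU by (simp add: norm_mult kqp)
      then have l: "l = - 1" using 9 by simp
      moreover have "\<kappa> = - 3/2" using arg_cong[OF k, of Re] l by (simp add: kqp)
      ultimately show ?thesis using 9 W by (simp add: kqp)
    qed
  qed
qed

text \<open>At a zero of the bracket in \<open>sq\<close> the right-hand side forces a zero of cosh,
  which gives \<open>U\<^sup>2 = 1\<close> and \<open>U = V\<close>. The bracket is then
  \<open>2 * U * cosh z\<close>, and cancelling cosh leaves
  \<open>(p z)\<^sup>2 = exp (l * z)\<close>.\<close>

lemma explicit_factor:
  fixes U V l :: complex
  assumes hol: "p holomorphic_on UNIV" "q holomorphic_on UNIV" and pq: "\<And>z. p z * q z = cosh z"
    and UV: "U * V = 1" and l: "l = 1 \<or> l = -1"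
    and sq: "\<And>z. (p z)\<^sup>2 * (U * exp (- (l * z)) + V * exp (l * z)) = 2 * V * exp (l * z) * cosh z"
  obtains e where "e\<^sup>2 = 1" "\<And>z. p z = e * exp (l * z / 2)" "\<And>z. q z = e * exp (- (l * z / 2)) * cosh z"
proof -
  have UV0: "U \<noteq> 0" "V \<noteq> 0" using UV by auto
  have l2: "l * l = 1" "l \<noteq> 0" using l by auto
  \<comment> \<open>Chosen so that \<open>exp (2 * l * z0) = - U\<^sup>2\<close>, which makes
    \<open>U + V * exp (2 * l * z0)\<close> vanish because \<open>U * V = 1\<close>.\<close>
  define z0 where "z0 = Ln (- (U\<^sup>2)) / (2 * l)"
  have ez0: "exp (2 * (l * z0)) = - (U\<^sup>2)"
  proof -
    have "2 * (l * z0) = Ln (- (U\<^sup>2))" using l2 by (simp add: z0_def)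
    then show ?thesis using UV0 exp_Ln[of "- (U\<^sup>2)"] by simp
  qed
  have "U * exp (- (l * z0)) + V * exp (l * z0) = exp (- (l * z0)) * (U + V * exp (2 * (l * z0)))"
    by (simp add: distrib_left exp_add[symmetric] mult.left_commute)
  also have "U + V * exp (2 * (l * z0)) = 0" unfolding ez0 using UV by algebra
  finally have "2 * V * exp (l * z0) * cosh z0 = 0" using sq[of z0] by simp
  then have "exp z0 ^ 2 = -1" using UV0 by (simp add: cosh_zero_iff)
  then have e: "exp (2 * z0) = -1" by (simp add: exp_double)
  have "exp (2 * (l * z0)) = -1" using l e by (auto simp: exp_minus)
  then have U2: "U\<^sup>2 = 1" using ez0 by (metis minus_equation_iff)
  then have VU: "V = U" using UV by algebra
  have "cosh z * ((p z)\<^sup>2 - exp (l * z)) = 0" for z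
  proof -
    have "exp (- (l * z)) + exp (l * z) = 2 * cosh z" using l by (auto simp: cosh_field_def)
    then have "U * exp (- (l * z)) + V * exp (l * z) = U * (2 * cosh z)"
      unfolding VU by (metis distrib_left)
    then have "U * (2 * (cosh z * ((p z)\<^sup>2 - exp (l * z)))) = 0"
      using sq[of z] unfolding VU by (simp add: algebra_simps)
    then show ?thesis using UV0 by simp
  qed
  then have "(p z)\<^sup>2 - exp (l * z) = 0" for z
    by (rule entire_mult_eq_0[where w=0 and p=cosh, rotated 2])
      (auto simp: cosh_field_def[abs_def] intro!: holomorphic_intros hol)
  then have p2: "(p z)\<^sup>2 = exp (l * z)" for z by simp
  \<comment> \<open>The square of \<open>r\<close> is 1, so \<open>r\<close> has derivative 0 and
    the sign of the square root is the same everywhere.\<close>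
  define r where "r = (\<lambda>z. p z * exp (- (l * z / 2)))"
  have r2: "(r z)\<^sup>2 = 1" for z
  proof -
    have "(r z)\<^sup>2 = exp (l * z) * (exp (- (l * z / 2)))\<^sup>2" by (simp add: r_def power_mult_distrib p2)
    also have "\<dots> = 1" by (simp add: exp_double[symmetric] exp_add[symmetric])
    finally show ?thesis .
  qed
  have hr: "r holomorphic_on UNIV" unfolding r_def by (intro holomorphic_intros hol) simp
  have "deriv r z = 0" for z
  proof -
    have "((\<lambda>z. (r z)\<^sup>2) has_field_derivative 2 * r z * deriv r z) (at z)"
      by (rule DERIV_cong[OF DERIV_power[OF holomorphic_derivI[OF hr open_UNIV UNIV_I], of 2]]) simp
    moreover have "((\<lambda>z. (r z)\<^sup>2) has_field_derivative 0) (at z)" unfolding r2 by simp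
    ultimately have "2 * r z * deriv r z = 0" by (rule DERIV_unique)
    moreover have "r z \<noteq> 0" using r2[of z] by auto
    ultimately show ?thesis by simp
  qed
  then obtain e where re: "\<And>z. r z = e"
    using has_field_derivative_zero_constant[of UNIV r] holomorphic_derivI[OF hr open_UNIV UNIV_I]
    by (metis UNIV_I at_within_open convex_UNIV open_UNIV)
  have e2: "e\<^sup>2 = 1" using r2[of 0] re by simp
  have p: "p z = e * exp (l * z / 2)" for z
    unfolding re[of z, symmetric] r_def by (simp add: mult.assoc exp_add[symmetric])
  have "q z = e * exp (- (l * z / 2)) * cosh z" for z
  proof -
    have "e * exp (- (l * z / 2)) * (p z * q z) = e\<^sup>2 * (exp (- (l * z / 2)) * exp (l * z / 2)) * q z"
      by (simp add: p power2_eq_square)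
    also have "\<dots> = q z" by (simp add: e2 exp_add[symmetric])
    finally show ?thesis by (simp add: pq)
  qed
  with e2 p show ?thesis by (rule that)
qed

text \<open>\<open>J\<close> expanded modulo \<open>A * B = 1\<close> and collected by monomials.
  With exponentials for \<open>A\<close>, \<open>B\<close>, \<open>D\<close> and
  \<open>x = exp z\<close>, \<open>y = exp (- z)\<close>, each monomial becomes a single
  exponential.\<close>

lemma multiplier_relation:
  fixes A B D x y k p q M N :: complex
  assumes AB: "A * B = 1"
    and J: "(B - A) * (2 * k * ((A - D) * (B - D)) + (q * A - p * D) * (B - D) - (A - D) * (- q * B - p * D)) * (x + y)
       = (x - y) * (A + B - 2 * D) * ((A - D) * (B - D))"
  shows "-(2*k + 2*q + 1) * (A * x) + (2*k + 2*q - 1) * (B * x) + (2*p + 4) * (D * x) + (1 - p + q + 2*k) * (D * A\<^sup>2 * x)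
      + (1 - p - q - 2*k) * (D * B\<^sup>2 * x) + (-2*k - 3) * (D\<^sup>2 * A * x) + (2*k - 3) * (D\<^sup>2 * B * x) + 2 * (D ^ 3 * x)
      + (1 - 2*k - 2*q) * (A * y) + (2*k + 2*q + 1) * (B * y) + (2*p - 4) * (D * y) + (-1 - p + q + 2*k) * (D * A\<^sup>2 * y)
      + (-1 - p - q - 2*k) * (D * B\<^sup>2 * y) + (3 - 2*k) * (D\<^sup>2 * A * y) + (2*k + 3) * (D\<^sup>2 * B * y) + -2 * (D ^ 3 * y) = 0"
  using assms by algebra

text \<open>By the first relation \<open>g\<close> and \<open>h\<close> are proportional to
  \<open>M\<close> and \<open>N\<close>. The fourth and fifth relations determine
  \<open>g' * (M + N)\<close>, and the product relations then remove the factor of proportionality,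
  leaving \<open>M\<close>, \<open>N\<close>, their derivatives, \<open>C\<close> and
  \<open>S\<close>.\<close>

lemma derivative_elimination:
  fixes g h g' h' M N M' N' C S \<kappa> :: complex
  assumes 1: "h * M = g * N" and 2: "g * h = C" and 3: "g' * h + g * h' = S" and 4: "g' + h' = \<kappa> * (g - h)"
    and 5: "h' * M + h * M' = g' * N + g * N'"
  shows "(M - N) * (2 * \<kappa> * (N * M) + N' * M - N * M') * C = S * (M + N) * (N * M)"
proof (cases "M = 0")
  case True
  then have "g * N = 0" using 1 by simp
  then show ?thesis using True 2 by auto
next
  case False
  define t where "t = g / M"
  have g: "g = t * M" using False by (simp add: t_def)
  have h: "h = t * N"
  proof -
    have "h * M = (t * N) * M" using 1 g by simp
    then show ?thesis using False by simp
  qed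
  have h': "h' = \<kappa> * (g - h) - g'" using 4 by (simp add: eq_diff_eq add.commute)
  have g'MN: "g' * (M + N) = \<kappa> * (g - h) * M + h * M' - g * N'"
    using 5 unfolding h' by (simp add: algebra_simps)
  have "S * (M + N) = (g' * (M + N)) * (h - g) + g * (\<kappa> * (g - h)) * (M + N)"
    unfolding 3[symmetric] h' by (simp add: algebra_simps)
  also have "\<dots> = t\<^sup>2 * (M - N) * (2 * \<kappa> * (N * M) + N' * M - N * M')"
    unfolding g'MN unfolding g h by (simp add: algebra_simps power2_eq_square)
  finally show ?thesis using 2 unfolding g h by algebra
qed


section \<open>Degree two with a negative real coefficient\<close>

context cosh_equation
begin

text \<open>The three multipliers are tied by \<open>g - h = 2 * c * deriv f\<close>, whose
  reflection gives \<open>h * (B - D) = g * (A - D)\<close>. Differentiating this and eliminating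
  \<open>g\<close> and \<open>h\<close> leaves an identity between exponentials only, which
  \<open>multiplier_exponents\<close> evaluates.\<close>

lemma negative_case:
  fixes c :: real
  assumes n: "n = 2" and c: "c > 0" and a: "a = - (of_real c)\<^sup>2"
  shows "(a = -1 \<and> (\<exists>A B C. \<forall>z. f z = A * exp z + B * exp (- z) + C))
    \<or> (a = - 4 / 9 \<and> (\<exists>A B. (\<forall>z. f z = A * exp (- 3 / 2 * z) + B * exp (1 / 2 * z))
         \<or> (\<forall>z. f z = A * exp (3 / 2 * z) + B * exp (- 1 / 2 * z))))"
proof -
  define k :: complex where "k = 1 / of_real c"
  have ck: "of_real c * k = 1" using c by (simp add: k_def)
  define g where "g = (\<lambda>z. f z + of_real c * deriv f z)"
  define h where "h = (\<lambda>z. f z - of_real c * deriv f z)"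
  have hol_g: "g holomorphic_on UNIV" and hol_h: "h holomorphic_on UNIV"
    unfolding g_def h_def by (intro holomorphic_intros hol hol')+
  have et: "exp_type g" "exp_type h"
    unfolding g_def h_def by (intro exp_type_add exp_type_diff exp_type_cmult exp_type_f exp_type_f')+
  have gh: "g z * h z = cosh z" for z
    unfolding eq[of z, symmetric] n a g_def h_def by (simp add: algebra_simps power2_eq_square)
  \<comment> \<open>A shift by \<open>\<i> * pi / 2\<close> turns the divisors \<open>g\<close> and
    \<open>h\<close> of cosh into divisors of a shifted sinh.\<close>
  have sinh_shift: "sinh (z + \<i> * of_real (pi / 2)) = \<i> * cosh z" for z :: complex
  proof -
    have "exp (\<i> * of_real (pi / 2)) = \<i>" by (metis cis_conv_exp cis_pi_half)
    moreover from this have "exp (- (\<i> * of_real (pi / 2))) = - \<i>" by (simp add: exp_minus)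
    ultimately have "sinh (\<i> * of_real (pi / 2)) = \<i>" "cosh (\<i> * of_real (pi / 2)) = 0"
      by (simp_all add: sinh_field_def cosh_field_def)
    then show ?thesis by (simp add: sinh_add)
  qed
  obtain l m where E: "\<And>z. conj_reflect (deriv f) z = deriv f z * exp (of_real l * z + \<i> * of_real m)"
    using conj_reflect_quotient[OF hol' G_hol exp_type_f' G_exp_type, of 0] factor_sinh by auto
  obtain l1 m1 where E1: "\<And>z. conj_reflect g z = g z * exp (of_real l1 * z + \<i> * of_real m1)"
  proof (rule conj_reflect_quotient[of g "\<lambda>z. \<i> * h z" "\<i> * of_real (pi / 2)"])
    show "g z * (\<i> * h z) = sinh (z + \<i> * of_real (pi / 2))" for z
      unfolding sinh_shift gh[symmetric] by simp
  qed (use hol_g hol_h et in \<open>auto intro!: holomorphic_intros exp_type_cmult intro: that\<close>)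
  obtain l2 m2 where E2: "\<And>z. conj_reflect h z = h z * exp (of_real l2 * z + \<i> * of_real m2)"
  proof (rule conj_reflect_quotient[of h "\<lambda>z. \<i> * g z" "\<i> * of_real (pi / 2)"])
    show "h z * (\<i> * g z) = sinh (z + \<i> * of_real (pi / 2))" for z
      unfolding sinh_shift gh[symmetric] by simp
  qed (use hol_g hol_h et in \<open>auto intro!: holomorphic_intros exp_type_cmult intro: that\<close>)
  define W V U where "W = exp (\<i> * of_real m)" and "V = exp (\<i> * of_real m1)" and "U = exp (\<i> * of_real m2)"
  have normWV: "norm W = 1" "norm V = 1" by (simp_all add: W_def V_def)
  define D A B where "D = (\<lambda>z. W * exp (of_real l * z))" and "A = (\<lambda>z. V * exp (of_real l1 * z))"
    and "B = (\<lambda>z. U * exp (of_real l2 * z))"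
  have ED: "conj_reflect (deriv f) z = deriv f z * D z" "conj_reflect g z = g z * A z"
    "conj_reflect h z = h z * B z" for z
    unfolding E E1 E2 D_def A_def B_def W_def V_def U_def by (simp_all add: exp_add)
  have conj_cosh: "cnj (cosh (- cnj z)) = cosh z" for z
    by (simp add: cosh_field_def exp_cnj)
  have "(A z * B z) * cosh z = cosh z" for z
  proof -
    have "conj_reflect g z * conj_reflect h z = cnj (g (- cnj z) * h (- cnj z))"
      by (simp add: conj_reflect_def)
    also have "\<dots> = cosh z" unfolding gh by (rule conj_cosh)
    finally show ?thesis unfolding ED gh[symmetric] by (simp add: mult_ac)
  qed
  \<comment> \<open>cosh has no real zeros, so it cancels on the real axis; the points 0 and 1
    suffice to obtain \<open>U * V = 1\<close> and \<open>l2 = - l1\<close>.\<close>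
  then have AB_real: "A (of_real x) * B (of_real x) = 1" for x
    by (metis cosh_real_nonzero mult_cancel_right1 cosh_complex_of_real of_real_eq_0_iff)
  have UV: "U * V = 1" using AB_real[of 0] by (simp add: A_def B_def mult.commute)
  have l2: "l2 = - l1"
  proof -
    have "norm (A 1 * B 1) = exp (l1 + l2)"
      by (simp add: A_def B_def V_def U_def norm_mult exp_add)
    then show ?thesis using AB_real[of 1] by simp
  qed
  have AB: "A z * B z = 1" for z
  proof -
    have "A z * B z = (U * V) * (exp (of_real l1 * z) * exp (- (of_real l1 * z)))"
      by (simp add: A_def B_def l2)
    then show ?thesis by (simp add: UV exp_add[symmetric])
  qed
  have gh_rel: "h z * (B z - D z) = g z * (A z - D z)" for z
  proof -
    have "conj_reflect g z - conj_reflect h z = 2 * of_real c * conj_reflect (deriv f) z"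
      by (simp add: conj_reflect_def g_def h_def algebra_simps)
    then have "g z * A z - h z * B z = (2 * of_real c * deriv f z) * D z" unfolding ED by simp
    also have "2 * of_real c * deriv f z = g z - h z" by (simp add: g_def h_def)
    finally show ?thesis by (simp add: algebra_simps)
  qed
  have dA: "(A has_field_derivative of_real l1 * A z) (at z)"
    and dB: "(B has_field_derivative - of_real l1 * B z) (at z)"
    and dD: "(D has_field_derivative of_real l * D z) (at z)" for z
    unfolding A_def B_def D_def l2 by (auto intro!: derivative_eq_intros)
  have dg: "(g has_field_derivative deriv g z) (at z)" and dh: "(h has_field_derivative deriv h z) (at z)" for z
    using hol_g hol_h by (auto intro: holomorphic_derivI[OF _ open_UNIV UNIV_I])
  have J: "((B z - D z) - (A z - D z)) * (2 * k * ((A z - D z) * (B z - D z)) +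
       (of_real l1 * A z - of_real l * D z) * (B z - D z) - (A z - D z) * (- of_real l1 * B z - of_real l * D z)) * cosh z
     = sinh z * ((B z - D z) + (A z - D z)) * ((A z - D z) * (B z - D z))" for z
  proof (rule derivative_elimination[of "h z" _ "g z" _ _ "deriv g z" "deriv h z"])
    show "h z * (B z - D z) = g z * (A z - D z)" by (rule gh_rel)
    show "g z * h z = cosh z" by (rule gh)
    have "((\<lambda>z. g z * h z) has_field_derivative deriv g z * h z + g z * deriv h z) (at z)"
      by (rule DERIV_cong[OF DERIV_mult[OF dg dh]]) simp
    moreover have "((\<lambda>z. g z * h z) has_field_derivative sinh z) (at z)"
      unfolding gh by (auto intro!: derivative_eq_intros)
    ultimately show "deriv g z * h z + g z * deriv h z = sinh z" by (rule DERIV_unique)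
    have "((\<lambda>z. g z + h z) has_field_derivative deriv g z + deriv h z) (at z)"
      by (intro DERIV_add dg dh)
    moreover have "((\<lambda>z. g z + h z) has_field_derivative 2 * deriv f z) (at z)"
      unfolding g_def h_def by (auto intro!: derivative_eq_intros D0)
    ultimately have "deriv g z + deriv h z = 2 * deriv f z" by (rule DERIV_unique)
    also have "\<dots> = k * (g z - h z)" using ck by (simp add: g_def h_def algebra_simps) 
    finally show "deriv g z + deriv h z = k * (g z - h z)" .
    have "((\<lambda>z. h z * (B z - D z)) has_field_derivative
        deriv h z * (B z - D z) + h z * (- of_real l1 * B z - of_real l * D z)) (at z)"
      by (rule DERIV_cong[OF DERIV_mult[OF dh DERIV_diff[OF dB dD]]]) simp
    moreover have "((\<lambda>z. h z * (B z - D z)) has_field_derivative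
        deriv g z * (A z - D z) + g z * (of_real l1 * A z - of_real l * D z)) (at z)"
      unfolding gh_rel by (rule DERIV_cong[OF DERIV_mult[OF dg DERIV_diff[OF dA dD]]]) simp
    ultimately show "deriv h z * (B z - D z) + h z * (- of_real l1 * B z - of_real l * D z)
      = deriv g z * (A z - D z) + g z * (of_real l1 * A z - of_real l * D z)" by (rule DERIV_unique)
  qed
  define p q where "p = complex_of_real l" and "q = complex_of_real l1"
  have cases: "l = 0 \<or> l = l1 \<and> (W = V \<or> l\<^sup>2 = 1 \<and> 1 / c = - 3/2 * l \<and> W = - V)
     \<or> l = - l1 \<and> (W = U \<or> l\<^sup>2 = 1 \<and> 1 / c = 3/2 * l \<and> W = - U)"
  proof (rule multiplier_exponents[OF _ UV normWV _ p_def q_def])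
    show "W \<noteq> 0" by (simp add: W_def)
    show "k = complex_of_real (1 / c)" by (simp add: k_def)
    fix z
    have J': "(B z - A z) * (2 * k * ((A z - D z) * (B z - D z)) + (q * A z - p * D z) * (B z - D z)
        - (A z - D z) * (- q * B z - p * D z)) * (exp z + exp (- z))
      = (exp z - exp (- z)) * (A z + B z - 2 * D z) * ((A z - D z) * (B z - D z))"
    proof -
      have "exp z + exp (- z) = 2 * cosh z" "exp z - exp (- z) = 2 * sinh z"
        by (simp_all add: cosh_field_def sinh_field_def)
      moreover have "B z - A z = (B z - D z) - (A z - D z)" "A z + B z - 2 * D z = (B z - D z) + (A z - D z)"
        by simp_all
      ultimately show ?thesis using J[of z] unfolding p_def q_def by (simp only: mult.left_commute mult.assoc)
    qed
    note rel = multiplier_relation[OF AB[of z] J']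
    have ee: "exp (w * 2) = exp w * exp w" "exp (w * 3) = exp w * (exp w * exp w)" for w :: complex
      by (simp_all add: exp_add[symmetric] algebra_simps)
    have e: "V * exp (of_real (l1 + r) * z) = A z * exp (of_real r * z)"
      "U * exp (of_real (- l1 + r) * z) = B z * exp (of_real r * z)"
      "W * exp (of_real (l + r) * z) = D z * exp (of_real r * z)"
      "W * (V\<^sup>2 * exp (of_real (l + 2*l1 + r) * z)) = D z * ((A z)\<^sup>2 * exp (of_real r * z))"
      "W * (U\<^sup>2 * exp (of_real (l - 2*l1 + r) * z)) = D z * ((B z)\<^sup>2 * exp (of_real r * z))"
      "W\<^sup>2 * (V * exp (of_real (2*l + l1 + r) * z)) = (D z)\<^sup>2 * (A z * exp (of_real r * z))"
      "W\<^sup>2 * (U * exp (of_real (2*l - l1 + r) * z)) = (D z)\<^sup>2 * (B z * exp (of_real r * z))"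
      "W ^ 3 * exp (of_real (3*l + r) * z) = D z ^ 3 * exp (of_real r * z)" for r
      by (simp_all add: A_def B_def D_def l2 exp_add exp_diff exp_minus distrib_right left_diff_distrib
          field_simps eval_nat_numeral)
        (simp_all add: ee mult.assoc[symmetric])
    note ep = e[of 1, unfolded of_real_1 mult_1_left add.assoc]
    note em = e[of "-1", unfolded add_uminus_conv_diff of_real_minus of_real_1 mult_minus1]
    show "(\<Sum>(c, x)\<leftarrow>
       [(-(2*k + 2*q + 1) * V, of_real (l1 + 1)), ((2*k + 2*q - 1) * U, of_real (-l1 + 1)),
        ((2*p + 4) * W, of_real (l + 1)), ((1 - p + q + 2*k) * (W * V\<^sup>2), of_real (l + 2*l1 + 1)),
        ((1 - p - q - 2*k) * (W * U\<^sup>2), of_real (l - 2*l1 + 1)), ((-2*k - 3) * (W\<^sup>2 * V), of_real (2*l + l1 + 1)),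
        ((2*k - 3) * (W\<^sup>2 * U), of_real (2*l - l1 + 1)), (2 * W ^ 3, of_real (3*l + 1)),
        ((1 - 2*k - 2*q) * V, of_real (l1 - 1)), ((2*k + 2*q + 1) * U, of_real (-l1 - 1)),
        ((2*p - 4) * W, of_real (l - 1)), ((-1 - p + q + 2*k) * (W * V\<^sup>2), of_real (l + 2*l1 - 1)),
        ((-1 - p - q - 2*k) * (W * U\<^sup>2), of_real (l - 2*l1 - 1)), ((3 - 2*k) * (W\<^sup>2 * V), of_real (2*l + l1 - 1)),
        ((2*k + 3) * (W\<^sup>2 * U), of_real (2*l - l1 - 1)), (-2 * W ^ 3, of_real (3*l - 1))].
       c * exp (x * z)) = (0::complex)"
      using rel
      by (simp only: list.map prod.case sum_list.Cons sum_list.Nil mult.assoc ep em add.assoc add_0_right)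
  qed
  \<comment> \<open>The two cases \<open>l = l1\<close> and \<open>l = - l1\<close> exchange
    \<open>g\<close> and \<open>h\<close> and produce the same sum, so both end here; the value of
    \<open>1 / c\<close> gives \<open>c\<^sup>2 = 4/9\<close>.\<close>
  have exp_form: ?thesis
    if e: "\<And>z. f z = e / 2 * (exp (of_real l * z / 2) + exp (- (of_real l * z / 2)) * cosh z)"
      and l2: "l\<^sup>2 = 1" and cl: "(1 / c)\<^sup>2 = 9 / 4 * l\<^sup>2" for e
  proof -
    have "c\<^sup>2 = 4 / 9" using cl l2 c by (simp add: power_divide field_simps)
    moreover have "a = - of_real (c\<^sup>2)" by (simp add: a)
    ultimately have "a = - of_real (4 / 9)" by (simp only:)
    then have a': "a = - 4 / 9" by simp
    consider "l = 1" | "l = -1" using l2 by (auto simp: power2_eq_1_iff)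
    then show ?thesis
    proof cases
      case 1
      have "f z = e / 4 * exp (- 3 / 2 * z) + 3 / 4 * e * exp (1 / 2 * z)" for z
      proof -
        have "f z = e / 2 * (exp (z / 2) + (exp (- (z / 2)) * exp z + exp (- (z / 2)) * exp (- z)) / 2)"
          by (simp add: e 1 cosh_field_def distrib_left)
        also have "exp (- (z / 2)) * exp z = exp (z / 2)"
          unfolding exp_add[symmetric] by simp
        also have "exp (- (z / 2)) * exp (- z) = exp (- 3 / 2 * z)"
          unfolding exp_add[symmetric] by (rule arg_cong[of _ _ exp]) simp
        finally show ?thesis by (simp add: field_simps)
      qed
      then show ?thesis using a' by blast
    next
      case 2
      have "f z = e / 4 * exp (3 / 2 * z) + 3 / 4 * e * exp (- 1 / 2 * z)" for z
      proof -
        have "f z = e / 2 * (exp (- (z / 2)) + (exp (z / 2) * exp z + exp (z / 2) * exp (- z)) / 2)"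
          by (simp add: e 2 cosh_field_def distrib_left)
        also have "exp (z / 2) * exp z = exp (3 / 2 * z)"
          unfolding exp_add[symmetric] by (rule arg_cong[of _ _ exp]) simp
        also have "exp (z / 2) * exp (- z) = exp (- (z / 2))"
          unfolding exp_add[symmetric] by simp
        finally show ?thesis by (simp add: field_simps)
      qed
      then show ?thesis using a' by blast
    qed
  qed
  have f_gh: "f z = (g z + h z) / 2" for z by (simp add: g_def h_def)
  have no_zero: "g 1 \<noteq> 0" "h 1 \<noteq> 0"
    using gh[of 1] cosh_complex_of_real[of 1] cosh_real_nonzero[of 1] by auto
  have norm1: "norm (A 1) = exp l1" "norm (B 1) = exp (- l1)" "norm (D 1) = exp l"
    using normWV AB_real by (simp_all add: A_def B_def D_def U_def norm_mult l2)
  \<comment> \<open>Here \<open>A = D\<close>, so \<open>gh_rel\<close> at a point where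
    \<open>h\<close> is nonzero gives \<open>B = D\<close> as well. The moduli
    \<open>exp (- l)\<close> and \<open>exp l\<close> then agree.\<close>
  have "l = 0" if "l = l1" "W = V"
  proof -
    have "A 1 = D 1" using that by (simp add: A_def D_def)
    then have "B 1 = D 1" using gh_rel[of 1] no_zero by simp
    then show ?thesis using norm1 that by simp
  qed
  moreover have "l = 0" if "l = - l1" "W = U"
  proof -
    have "B 1 = D 1" using that by (simp add: B_def D_def l2)
    then have "A 1 = D 1" using gh_rel[of 1] no_zero by simp
    then show ?thesis using norm1 that by simp
  qed
  ultimately consider "l = 0" | "l = l1" "l\<^sup>2 = 1" "1 / c = - 3/2 * l" "W = - V"
    | "l = - l1" "l\<^sup>2 = 1" "1 / c = 3/2 * l" "W = - U"
    using cases by blast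
  then show ?thesis
  proof cases
    case l0: 1
    then have Dz: "D z = W" for z by (simp add: D_def)
    have dF: "((\<lambda>z. conj_reflect f z + W * f z) has_field_derivative 0) (at z)" for z
      by (rule DERIV_cong[OF DERIV_add[OF conj_reflect_DERIV[OF hol] DERIV_cmult[OF D0]]]) (simp add: ED Dz)
    \<comment> \<open>The reflection reverses the sign of derivatives, so a constant multiplier
      \<open>W\<close> of \<open>deriv f\<close> becomes \<open>- W\<close> for \<open>f\<close>, up
      to an additive constant.\<close>
    then obtain C0 where C0: "\<And>z. conj_reflect f z + W * f z = C0"
      using has_field_derivative_zero_constant[of UNIV "\<lambda>z. conj_reflect f z + W * f z"] by auto
    have F_eq: "(conj_reflect f z)\<^sup>2 + a * (conj_reflect (deriv f) z)\<^sup>2 = cosh z" for z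
    proof -
      have "cnj a = a" by (simp add: a)
      then have "(conj_reflect f z)\<^sup>2 + a * (conj_reflect (deriv f) z)\<^sup>2
          = cnj (f (- cnj z) ^ n + a * deriv f (- cnj z) ^ n)"
        by (simp add: conj_reflect_def n)
      then show ?thesis unfolding eq conj_cosh .
    qed
    \<comment> \<open>\<open>f\<close> and its reflection satisfy the same equation, and eliminating
      \<open>(deriv f z)\<^sup>2\<close> between them leaves a relation that is linear in
      \<open>f\<close>.\<close>
    have rel: "W\<^sup>2 * cosh z - 2 * W * C0 * f z + C0\<^sup>2 = cosh z" for z
    proof -
      have F: "conj_reflect f z = C0 - W * f z" using C0[of z] by (simp add: eq_diff_eq)
      have "cosh z = (C0 - W * f z)\<^sup>2 + a * (deriv f z * W)\<^sup>2"
        using F_eq[of z] unfolding F ED Dz by simp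
      moreover have "cosh z = (f z)\<^sup>2 + a * (deriv f z)\<^sup>2" using eq[of z] by (simp add: n)
      ultimately show ?thesis by algebra
    qed
    have W0: "W \<noteq> 0" by (simp add: W_def)
    show ?thesis
    proof (cases "C0 = 0")
      case True
      then have "W\<^sup>2 = 1" using rel[of 0] by simp
      then have W: "W * W = 1" by (simp add: power2_eq_square)
      \<comment> \<open>With \<open>C0 = 0\<close>, on the imaginary axis the two squares in the
        equation become \<open>- W\<close> times nonnegative reals. There cosh would never change
        sign, but it is 1 at 0 and -1 at \<open>\<i> * pi\<close>.\<close>
      have sgn: "- W * of_real ((norm (f z))\<^sup>2 + c\<^sup>2 * (norm (deriv f z))\<^sup>2) = cosh z" if "- cnj z = z" for z
      proof -
        have "cnj (f z) = - W * f z" using C0[of z] True that by (simp add: conj_reflect_def eq_neg_iff_add_eq_0)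
        moreover have "cnj (deriv f z) = W * deriv f z"
          using ED(1)[of z] that by (simp add: conj_reflect_def Dz mult.commute)
        ultimately have "of_real ((norm (f z))\<^sup>2 + c\<^sup>2 * (norm (deriv f z))\<^sup>2)
            = - W * (f z)\<^sup>2 + (of_real c)\<^sup>2 * (W * (deriv f z)\<^sup>2)"
          unfolding of_real_add of_real_mult complex_norm_square by (simp add: power2_eq_square)
        then have "- W * of_real ((norm (f z))\<^sup>2 + c\<^sup>2 * (norm (deriv f z))\<^sup>2)
            = (W * W) * ((f z)\<^sup>2 + a * (deriv f z)\<^sup>2)"
          by (simp only: a) (simp add: algebra_simps)
        then show ?thesis using eq[of z] unfolding W n by simp
      qed
      have pos: "(norm (f z))\<^sup>2 + c\<^sup>2 * (norm (deriv f z))\<^sup>2 \<ge> 0" for z by simp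
      have c\<pi>: "cosh (\<i> * of_real pi) = -1"
      proof -
        have "exp (\<i> * of_real pi) = -1" by (metis cis_conv_exp cis_pi)
        then show ?thesis by (simp add: cosh_field_def exp_minus)
      qed
      consider "W = 1" | "W = -1" using \<open>W\<^sup>2 = 1\<close> by (auto simp: power2_eq_1_iff)
      then have False
      proof cases
        case 1
        then have "- ((norm (f 0))\<^sup>2 + c\<^sup>2 * (norm (deriv f 0))\<^sup>2) = 1"
          using arg_cong[OF sgn[of 0], of Re] by simp
        then show False using pos[of 0] by linarith
      next
        case 2
        then have "(norm (f (\<i> * of_real pi)))\<^sup>2 + c\<^sup>2 * (norm (deriv f (\<i> * of_real pi)))\<^sup>2 = -1"
          using arg_cong[OF sgn[of "\<i> * of_real pi"], of Re] unfolding c\<pi> by simp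
        then show False using pos[of "\<i> * of_real pi"] by linarith
      qed
      then show ?thesis ..
    next
      case False
      define \<alpha> \<beta> where "\<alpha> = (W\<^sup>2 - 1) / (2 * W * C0)" and "\<beta> = C0 / (2 * W)"
      have f\<alpha>: "f z = \<alpha> * cosh z + \<beta>" for z
      proof -
        have "2 * W * C0 * f z = W\<^sup>2 * cosh z + C0\<^sup>2 - cosh z"
          using arg_cong[OF rel[of z], of "\<lambda>t. W\<^sup>2 * cosh z + C0\<^sup>2 - t"] by simp
        also have "\<dots> = (W\<^sup>2 - 1) * cosh z + C0\<^sup>2" by (simp add: algebra_simps)
        finally have "2 * W * C0 * f z = (W\<^sup>2 - 1) * cosh z + C0\<^sup>2" .
        then have "f z = ((W\<^sup>2 - 1) * cosh z + C0\<^sup>2) / (2 * W * C0)"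
          using W0 False by (simp add: field_simps)
        then show ?thesis
          using W0 False by (simp add: \<alpha>_def \<beta>_def add_divide_distrib power2_eq_square)
      qed
      have f'\<alpha>: "deriv f z = \<alpha> * sinh z" for z
      proof -
        have "f = (\<lambda>z. \<alpha> * cosh z + \<beta>)" using f\<alpha> by blast
        then have "(f has_field_derivative \<alpha> * sinh z) (at z)" by (auto intro!: derivative_eq_intros)
        then show ?thesis by (rule DERIV_imp_deriv)
      qed
      have L: "(\<Sum>(c, l)\<leftarrow>[(\<alpha>\<^sup>2 * (1 + a), 2), (4 * (\<alpha> * \<beta>), 1), (2 * \<alpha>\<^sup>2 * (1 - a) + 4 * \<beta>\<^sup>2, 0),
          (4 * (\<alpha> * \<beta>), -1), (\<alpha>\<^sup>2 * (1 + a), -2), (-2, 1), (-2, -1)]. c * exp (l * z)) = 0" for z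
      proof -
        define x where "x = exp z"
        define y where "y = exp (- z)"
        have xy: "x * y = 1" by (simp add: x_def y_def exp_minus)
        have e2: "exp (2 * z) = x * x" "exp (- 2 * z) = y * y"
          unfolding x_def y_def by (simp_all add: exp_add[symmetric])
        have e1: "exp (1 * z) = x" "exp (- 1 * z) = y" "exp (0 * z) = 1" by (simp_all add: x_def y_def)
        have half: "(\<alpha> * ((x + y) / 2) + \<beta>)\<^sup>2 + a * (\<alpha> * ((x - y) / 2))\<^sup>2 = (x + y) / 2"
          using eq[of z] unfolding n f'\<alpha> unfolding f\<alpha> cosh_field_def sinh_field_def x_def y_def .
        have "(\<alpha> * (x + y) + 2 * \<beta>)\<^sup>2 + a * (\<alpha> * (x - y))\<^sup>2
            = 4 * ((\<alpha> * ((x + y) / 2) + \<beta>)\<^sup>2 + a * (\<alpha> * ((x - y) / 2))\<^sup>2)"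
          by (simp add: field_simps power2_eq_square)
        also have "\<dots> = 2 * (x + y)" unfolding half by simp
        finally have sum: "\<alpha>\<^sup>2 * (1 + a) * (x * x) + 4 * (\<alpha> * \<beta>) * x + (2 * \<alpha>\<^sup>2 * (1 - a) + 4 * \<beta>\<^sup>2) + 4 * (\<alpha> * \<beta>) * y
            + \<alpha>\<^sup>2 * (1 + a) * (y * y) - 2 * x - 2 * y = 0" using xy by algebra
        then show ?thesis
          unfolding list.map prod.case sum_list.Cons sum_list.Nil e1 e2 by (simp add: algebra_simps)
      qed
      \<comment> \<open>The exponent 1 shows that \<alpha> is nonzero; the exponent 2 then gives
        \<open>a = -1\<close>.\<close>
      have "4 * (\<alpha> * \<beta>) - 2 = 0" using exp_independent[OF L, of 1] by simp
      then have "\<alpha> \<noteq> 0" by auto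
      moreover have "\<alpha>\<^sup>2 * (1 + a) = 0" using exp_independent[OF L, of 2] by simp
      ultimately have "1 + a = 0" by simp
      then have "a = -1" by (simp add: add_eq_0_iff)
      moreover have "\<forall>z. f z = \<alpha> / 2 * exp z + \<alpha> / 2 * exp (- z) + \<beta>"
        by (simp add: f\<alpha> cosh_field_def field_simps)
      ultimately show ?thesis by blast
    qed
  next
    case *: 2
    have AD: "A z = V * exp (of_real l * z)" "D z = - A z" "B z = U * exp (- (of_real l * z))" for z
      using * by (simp_all add: A_def B_def D_def l2)
    obtain e where e: "e\<^sup>2 = 1" "\<And>z. h z = e * exp (of_real l * z / 2)"
      "\<And>z. g z = e * exp (- (of_real l * z / 2)) * cosh z"
    proof (rule explicit_factor[OF hol_h hol_g _ UV, of "of_real l"])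
      show "h z * g z = cosh z" for z using gh[of z] by (simp add: mult.commute)
      show "complex_of_real l = 1 \<or> complex_of_real l = -1" using *(2) by (auto simp: power2_eq_1_iff)
      show "(h z)\<^sup>2 * (U * exp (- (of_real l * z)) + V * exp (of_real l * z)) = 2 * V * exp (of_real l * z) * cosh z" for z
      proof -
        \<comment> \<open>\<open>W = - V\<close> means \<open>D = - A\<close>. Multiplying by
          \<open>h\<close> brings in \<open>g * h = cosh\<close> and leaves a relation for the
          square of \<open>h\<close> alone.\<close>
        have "h z * (B z + A z) = 2 * g z * A z" using gh_rel[of z] by (simp add: AD(2) mult_ac)
        then have "(h z)\<^sup>2 * (B z + A z) = 2 * A z * (g z * h z)" by algebra
        then show ?thesis unfolding gh by (simp add: AD(1,3) mult_ac)
      qed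
    qed (rule that)
    show ?thesis
    proof (rule exp_form[of e])
      show "f z = e / 2 * (exp (of_real l * z / 2) + exp (- (of_real l * z / 2)) * cosh z)" for z
        unfolding f_gh e(2,3) by (simp add: algebra_simps)
      show "(1 / c)\<^sup>2 = 9 / 4 * l\<^sup>2" unfolding *(3) by (simp add: power2_eq_square)
    qed (rule *)
  next
    case *: 3
    have AD: "B z = U * exp (of_real l * z)" "D z = - B z" "A z = V * exp (- (of_real l * z))" for z
      using * by (simp_all add: A_def B_def D_def l2)
    obtain e where e: "e\<^sup>2 = 1" "\<And>z. g z = e * exp (of_real l * z / 2)"
      "\<And>z. h z = e * exp (- (of_real l * z / 2)) * cosh z"
    proof (rule explicit_factor[OF hol_g hol_h gh, of V U "of_real l"])
      show "V * U = 1" using UV by (simp add: mult.commute)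
      show "complex_of_real l = 1 \<or> complex_of_real l = -1" using *(2) by (auto simp: power2_eq_1_iff)
      show "(g z)\<^sup>2 * (V * exp (- (of_real l * z)) + U * exp (of_real l * z)) = 2 * U * exp (of_real l * z) * cosh z" for z
      proof -
        have "g z * (A z + B z) = 2 * h z * B z" using gh_rel[of z] by (simp add: AD(2) mult_ac)
        then have "(g z)\<^sup>2 * (A z + B z) = 2 * B z * (g z * h z)" by algebra
        then show ?thesis unfolding gh by (simp add: AD(1,3) mult_ac)
      qed
    qed (rule that)
    show ?thesis
    proof (rule exp_form[of e])
      show "f z = e / 2 * (exp (of_real l * z / 2) + exp (- (of_real l * z / 2)) * cosh z)" for z
        unfolding f_gh e(2,3) by (simp add: algebra_simps)
      show "(1 / c)\<^sup>2 = 9 / 4 * l\<^sup>2" unfolding *(3) by (simp add: power2_eq_square)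
    qed (rule *)
  qed
qed

end

section \<open>Solutions of the original equation\<close>

text \<open>The shift \<open>t\<close> is half a logarithm of \<open>p1 / p2\<close>, so that
  \<open>p1 * exp (- t)\<close> and \<open>p2 * exp t\<close> have a common value \<open>q\<close>;
  division by an \<open>n\<close>-th root of \<open>2 * q\<close> then leaves cosh.\<close>

lemma entire_solution_normalise:
  assumes sol: "entire_solution n a p1 p2 b f" and n: "n \<ge> 2"
    and nz: "a \<noteq> 0" "p1 \<noteq> 0" "p2 \<noteq> 0" "b \<noteq> 0"
  obtains \<rho> t h where "cosh_equation n (a * b ^ n) h" "\<And>z. f z = \<rho> * h (b * z + t)"
proof -
  have hol: "f holomorphic_on UNIV"
    and eq: "\<And>z. (f z) ^ n + a * (deriv f z) ^ n = p1 * exp (b * z) + p2 * exp (- (b * z))"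
    using sol by (auto simp: entire_solution_def)
  define t where "t = Ln (p1 / p2) / 2"
  define q where "q = p1 * exp (- t)"
  have "exp (t + t) = p1 / p2" using nz by (simp add: t_def)
  then have "exp t * exp t = p1 / p2" by (simp only: exp_add)
  then have "exp t * exp t * p2 = p1" using nz by simp
  then have q2: "q = p2 * exp t" using nz by (simp add: q_def exp_minus field_simps)
  have q0: "q \<noteq> 0" using nz by (simp add: q_def)
  define \<rho> where "\<rho> = exp (Ln (2 * q) / of_nat n)"
  have \<rho>0: "\<rho> \<noteq> 0" by (simp add: \<rho>_def)
  have \<rho>n: "\<rho> ^ n = 2 * q"
    using q0 n by (simp add: \<rho>_def exp_of_nat_mult[symmetric])
  define h where "h = (\<lambda>w. 1 / \<rho> * f (1 / b * w + (- t / b)))"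
  have hf: "(\<lambda>w. f (1 / b * w + (- t / b))) holomorphic_on UNIV" by (rule entire_affine[OF hol])
  have "deriv h w = 1 / \<rho> * deriv (\<lambda>w. f (1 / b * w + (- t / b))) w" for w
    unfolding h_def using hf by (intro deriv_cmult) (auto simp: holomorphic_on_def)
  then have dh: "deriv h w = 1 / \<rho> * (1 / b * deriv f (1 / b * w + (- t / b)))" for w
    unfolding deriv_affine[OF hol] .
  have "cosh_equation n (a * b ^ n) h"
  proof
    show "h holomorphic_on UNIV" unfolding h_def by (intro holomorphic_intros hf)
    fix w
    define z where "z = 1 / b * w + (- t / b)"
    have bz: "b * z = w - t" using nz by (simp add: z_def field_simps)
    have "h w ^ n + a * b ^ n * deriv h w ^ n = (f z ^ n + a * deriv f z ^ n) / \<rho> ^ n"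
      unfolding dh unfolding h_def z_def[symmetric] using nz(4)
      by (simp add: power_mult_distrib power_divide add_divide_distrib)
    also have "\<dots> = (p1 * exp (w - t) + p2 * exp (- (w - t))) / (2 * q)"
      unfolding eq \<rho>n bz ..
    also have "p1 * exp (w - t) = q * exp w" by (simp add: q_def exp_diff exp_minus field_simps)
    also have "p2 * exp (- (w - t)) = q * exp (- w)" by (simp add: q2 exp_diff exp_minus field_simps)
    also have "(q * exp w + q * exp (- w)) / (2 * q) = cosh w"
      using q0 by (simp add: cosh_field_def add_divide_distrib)
    finally show "h w ^ n + a * b ^ n * deriv h w ^ n = cosh w" .
  qed (use n nz in auto)
  moreover have "f z = \<rho> * h (b * z + t)" for z
    using nz \<rho>0 by (simp add: h_def add_divide_distrib)
  ultimately show ?thesis by (rule that)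
qed

text \<open>The implication about \<open>C\<close> records that no constant term appears when the
  normalised solution has none.\<close>

lemma rescale_exponentials:
  assumes "\<And>w. h w = A * exp (\<alpha> * w) + B * exp (\<beta> * w) + C" "\<And>z. f z = \<rho> * h (b * z + t)"
  shows "\<exists>A' B' C'. (C = 0 \<longrightarrow> C' = 0) \<and> (\<forall>z. f z = A' * exp (\<alpha> * (b * z)) + B' * exp (\<beta> * (b * z)) + (C'::complex))"
proof -
  have "f z = (\<rho> * A * exp (\<alpha> * t)) * exp (\<alpha> * (b * z)) + (\<rho> * B * exp (\<beta> * t)) * exp (\<beta> * (b * z)) + \<rho> * C" for z
    unfolding assms by (simp add: exp_add algebra_simps)
  moreover have "C = 0 \<longrightarrow> \<rho> * C = 0" by simp
  ultimately show ?thesis by blast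
qed

lemma exp_coefficients:
  fixes b :: complex
  assumes b: "b \<noteq> 0"
    and eq: "\<And>z. c4 * exp (2 * b * z) + c1 * exp (b * z) + c0 + c2 * exp (- (b * z)) + c5 * exp (- 2 * b * z)
      = p1 * exp (b * z) + p2 * exp (- (b * z))"
  shows "c1 = p1" "c2 = p2" "c0 = 0"
proof -
  have L: "(\<Sum>(c, l)\<leftarrow>[(c4, 2 * b), (c1 - p1, b), (c0, 0), (c2 - p2, - b), (c5, - 2 * b)]. c * exp (l * z)) = 0" for z
    using eq[of z] by (simp add: algebra_simps)
  have "b \<noteq> - b" "- b \<noteq> b" "2 * b \<noteq> - b" "- b \<noteq> 2 * b" "- (2 * b) \<noteq> b" "b \<noteq> - (2 * b)"
    using b by (auto simp: eq_neg_iff_add_eq_0 neg_eq_iff_add_eq_0 simp flip: mult_2 distrib_right)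
  then show "c1 = p1" "c2 = p2" "c0 = 0"
    using exp_independent[OF L, of b] exp_independent[OF L, of "- b"] exp_independent[OF L, of 0] b by simp_all
qed

lemma deriv_exponentials:
  assumes "\<And>z. f z = A * exp (\<alpha> * z) + B * exp (\<beta> * z) + C"
  shows "deriv f z = A * \<alpha> * exp (\<alpha> * z) + B * \<beta> * exp (\<beta> * z)"
proof -
  have "f = (\<lambda>z. A * exp (\<alpha> * z) + B * exp (\<beta> * z) + C)" using assms by blast
  then have "(f has_field_derivative A * \<alpha> * exp (\<alpha> * z) + B * \<beta> * exp (\<beta> * z)) (at z)"
    by (auto intro!: derivative_eq_intros)
  then show ?thesis by (rule DERIV_imp_deriv)
qed

lemma quadratic_expansion:
  fixes A B C \<alpha> \<beta> z :: complex
  shows "(A * exp (\<alpha> * z) + B * exp (\<beta> * z) + C)\<^sup>2 + a * (A * \<alpha> * exp (\<alpha> * z) + B * \<beta> * exp (\<beta> * z))\<^sup>2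
    = A\<^sup>2 * (1 + a * \<alpha>\<^sup>2) * exp (2 * \<alpha> * z) + B\<^sup>2 * (1 + a * \<beta>\<^sup>2) * exp (2 * \<beta> * z)
      + 2 * A * B * (1 + a * \<alpha> * \<beta>) * exp ((\<alpha> + \<beta>) * z) + 2 * A * C * exp (\<alpha> * z) + 2 * B * C * exp (\<beta> * z) + C\<^sup>2"
proof -
  have "exp (2 * \<alpha> * z) = (exp (\<alpha> * z))\<^sup>2" "exp (2 * \<beta> * z) = (exp (\<beta> * z))\<^sup>2"
    "exp ((\<alpha> + \<beta>) * z) = exp (\<alpha> * z) * exp (\<beta> * z)"
    by (simp_all add: power2_eq_square exp_add[symmetric] algebra_simps)
  then show ?thesis by (simp add: power2_eq_square algebra_simps)
qed

section \<open>Coefficients of the solutions in degrees four and two\<close>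

lemma solution_degree_4:
  assumes sol: "entire_solution n a p1 p2 b f" and n: "n = 3 \<or> n = 4"
    and nz: "a \<noteq> 0" "p1 \<noteq> 0" "p2 \<noteq> 0" "b \<noteq> 0"
  shows "n = 4" "a * (b / 2) ^ 4 = -1"
    "\<exists>k1 k2. 8 * k1 ^ 3 * k2 = p1 \<and> 8 * k2 ^ 3 * k1 = p2 \<and>
       (\<forall>z. f z = k1 * exp (b / 2 * z) + k2 * exp (- (b / 2 * z)))"
proof -
  have n2: "n \<ge> 2" using n by auto
  obtain \<rho> t h where h: "cosh_equation n (a * b ^ n) h" and f: "\<And>z. f z = \<rho> * h (b * z + t)"
    using entire_solution_normalise[OF sol n2 nz] by blast
  show n4: "n = 4" using cosh_equation.degree_ge_3(1)[OF h n] .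
  have "a * b ^ 4 = -16" using cosh_equation.degree_ge_3(2)[OF h n] n4 by simp
  then show ab: "a * (b / 2) ^ 4 = -1" by (simp add: power_divide)
  obtain A0 B0 where "\<And>w. h w = A0 * exp (w / 2) + B0 * exp (- w / 2)"
    using cosh_equation.degree_ge_3(3)[OF h n] by blast
  then have h0: "h w = A0 * exp (1/2 * w) + B0 * exp (-1/2 * w) + 0" for w by simp
  obtain A B where "\<And>z. f z = A * exp (1/2 * (b * z)) + B * exp (-1/2 * (b * z)) + 0"
    using rescale_exponentials[OF h0 f] by auto
  then have fz: "f z = A * exp (b / 2 * z) + B * exp (- (b / 2) * z) + 0" for z by simp
  have "8 * A ^ 3 * B = p1 \<and> 8 * B ^ 3 * A = p2"
  proof -
    have "0 * exp (2 * b * z) + (8 * A ^ 3 * B) * exp (b * z) + 0 + (8 * B ^ 3 * A) * exp (- (b * z)) + 0 * exp (- 2 * b * z)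
      = p1 * exp (b * z) + p2 * exp (- (b * z))" for z
    proof -
      define x where "x = exp (b / 2 * z)"
      define y where "y = exp (- (b / 2) * z)"
      have xy: "x * y = 1" by (simp add: x_def y_def exp_add[symmetric])
      have x2: "exp (b * z) = x * x" "exp (- (b * z)) = y * y"
        by (simp_all add: x_def y_def exp_add[symmetric])
      have "(A * x + B * y) ^ 4 + a * (A * (b / 2) * x + B * - (b / 2) * y) ^ 4 = p1 * (x * x) + p2 * (y * y)"
        using sol unfolding entire_solution_def n4 deriv_exponentials[OF fz] x2[symmetric]
        unfolding fz x_def y_def by simp
      also have "(A * (b / 2) * x + B * - (b / 2) * y) = b / 2 * (A * x - B * y)" by (simp add: algebra_simps)
      finally have "(A * x + B * y) ^ 4 + (a * (b / 2) ^ 4) * (A * x - B * y) ^ 4 = p1 * (x * x) + p2 * (y * y)"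
        by (simp only: power_mult_distrib mult.assoc)
      \<comment> \<open>The difference keeps only the odd terms
        \<open>8 * A ^ 3 * B * x ^ 3 * y\<close> and \<open>8 * A * B ^ 3 * x * y ^ 3\<close>, and
        \<open>x * y = 1\<close> reduces them to \<open>x\<^sup>2\<close> and
        \<open>y\<^sup>2\<close>.\<close>
      then have "(A * x + B * y) ^ 4 - (A * x - B * y) ^ 4 = p1 * (x * x) + p2 * (y * y)" unfolding ab by simp
      moreover have "(A * x + B * y) ^ 4 - (A * x - B * y) ^ 4 = 8 * A ^ 3 * B * (x * x) + 8 * B ^ 3 * A * (y * y)"
        using xy by algebra
      ultimately show ?thesis unfolding x2 by simp
    qed
    from exp_coefficients[OF nz(4) this] show ?thesis by blast
  qed
  moreover have "\<forall>z. f z = A * exp (b / 2 * z) + B * exp (- (b / 2 * z))" using fz by simp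
  ultimately show "\<exists>k1 k2. 8 * k1 ^ 3 * k2 = p1 \<and> 8 * k2 ^ 3 * k1 = p2 \<and>
       (\<forall>z. f z = k1 * exp (b / 2 * z) + k2 * exp (- (b / 2 * z)))" by blast
qed

lemma solution_degree_2:
  assumes sol: "entire_solution 2 a p1 p2 b f"
    and nz: "a \<noteq> 0" "p1 \<noteq> 0" "p2 \<noteq> 0" "b \<noteq> 0"
  shows "(a * b\<^sup>2 = 4 \<and> (\<exists>l1 l2. l1 ^ 2 = p1 / 2 \<and> l2 ^ 2 = p2 / 2 \<and>
                   (\<forall>z. f z = l1 * exp (b * z / 2) + l2 * exp (- (b * z / 2))))) \<or>
    (a * b\<^sup>2 = -1 \<and> (\<exists>t1 t2 r. r ^ 4 = - (p1 * p2) \<and> 2 * t1 * r = p1 \<and> 2 * t2 * r = p2 \<and>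
                   (\<forall>z. f z = t1 * exp (b * z) + t2 * exp (- (b * z)) + r))) \<or>
    (a * b\<^sup>2 = - 4 / 9 \<and> ((\<exists>l1 l2. l2 ^ 2 = 9 / 8 * p1 \<and> l1 ^ 2 = p2 ^ 2 / (8 * p1) \<and>
                (\<forall>z. f z = l1 * exp (- (3 / 2 * b * z)) + l2 * exp (1 / 2 * b * z))) \<or>
             (\<exists>l3 l4. l4 ^ 2 = 9 / 8 * p2 \<and> l3 ^ 2 = p1 ^ 2 / (8 * p2) \<and>
                (\<forall>z. f z = l3 * exp (3 / 2 * b * z) + l4 * exp (- (1 / 2 * b * z))))))"
proof -
  obtain \<rho> t h where h: "cosh_equation 2 (a * b\<^sup>2) h" and f: "\<And>z. f z = \<rho> * h (b * z + t)"
    using entire_solution_normalise[OF sol order_refl nz] by blast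
  interpret cosh_equation 2 "a * b\<^sup>2" h by (rule h)
  have eqf: "(f z)\<^sup>2 + a * (deriv f z)\<^sup>2 = p1 * exp (b * z) + p2 * exp (- (b * z))" for z
    using sol by (simp add: entire_solution_def)
  have "(a * b\<^sup>2 = 4 \<and> (\<exists>A B. \<forall>z. h z = A * exp (z / 2) + B * exp (- z / 2))) \<or>
    (a * b\<^sup>2 = -1 \<and> (\<exists>A B C. \<forall>z. h z = A * exp z + B * exp (- z) + C)) \<or>
    (a * b\<^sup>2 = - 4 / 9 \<and> (\<exists>A B. (\<forall>z. h z = A * exp (- 3 / 2 * z) + B * exp (1 / 2 * z))
         \<or> (\<forall>z. h z = A * exp (3 / 2 * z) + B * exp (- 1 / 2 * z))))"
  \<comment> \<open>Negative real coefficients go to the conjugate reflection, all others to the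
    point reflections.\<close>
  proof (cases "\<exists>r<0. a * b\<^sup>2 = of_real r")
    case True
    then obtain r where r: "r < 0" "a * b\<^sup>2 = of_real r" by blast
    define c where "c = sqrt (- r)"
    have "c > 0" using r(1) by (simp add: c_def)
    moreover have "of_real r = - (complex_of_real c)\<^sup>2"
    proof -
      have "c\<^sup>2 = - r" using r(1) by (simp add: c_def)
      then have "(complex_of_real c)\<^sup>2 = of_real (- r)" by (metis of_real_power)
      then show ?thesis by simp
    qed
    ultimately show ?thesis using negative_case[of c] r(2) by simp
  next
    case False
    then show ?thesis using symmetric_case by blast
  qed
  then consider (half) A B where "a * b\<^sup>2 = 4" "\<And>z. h z = A * exp (z / 2) + B * exp (- z / 2)"
    | (one) A B C where "a * b\<^sup>2 = -1" "\<And>z. h z = A * exp z + B * exp (- z) + C"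
    | (left) A B where "a * b\<^sup>2 = - 4 / 9" "\<And>z. h z = A * exp (- 3 / 2 * z) + B * exp (1 / 2 * z)"
    | (right) A B where "a * b\<^sup>2 = - 4 / 9" "\<And>z. h z = A * exp (3 / 2 * z) + B * exp (- 1 / 2 * z)"
    by blast
  then show ?thesis
  proof cases
    case (half A0 B0)
    then have "h w = A0 * exp (1/2 * w) + B0 * exp (-1/2 * w) + 0" for w by simp
    from rescale_exponentials[OF this f] obtain A B where
      "\<And>z. f z = A * exp (1/2 * (b * z)) + B * exp (-1/2 * (b * z)) + 0" by auto
    then have fz: "f z = A * exp (b / 2 * z) + B * exp (- (b / 2) * z) + 0" for z by simp
    have "0 * exp (2 * b * z) + 2 * A\<^sup>2 * exp (b * z) + 0 + 2 * B\<^sup>2 * exp (- (b * z)) + 0 * exp (- 2 * b * z)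
      = p1 * exp (b * z) + p2 * exp (- (b * z))" for z
      using eqf[of z] half(1) unfolding deriv_exponentials[OF fz] unfolding fz quadratic_expansion
      by (simp add: power_divide power2_eq_square mult_ac)
    note co = exp_coefficients[OF nz(4) this]
    have "A ^ 2 = p1 / 2" "B ^ 2 = p2 / 2" using co by auto
    moreover have "\<forall>z. f z = A * exp (b * z / 2) + B * exp (- (b * z / 2))" using fz by simp
    ultimately show ?thesis using half(1) by blast
  next
    case (one A0 B0 C0)
    then have "h w = A0 * exp (1 * w) + B0 * exp (-1 * w) + C0" for w by simp
    from rescale_exponentials[OF this f] obtain A B C where
      "\<And>z. f z = A * exp (1 * (b * z)) + B * exp (-1 * (b * z)) + C" by blast
    then have fz: "f z = A * exp (b * z) + B * exp (- b * z) + C" for z by simp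
    have "0 * exp (2 * b * z) + 2 * A * C * exp (b * z) + (4 * A * B + C\<^sup>2) + 2 * B * C * exp (- (b * z)) + 0 * exp (- 2 * b * z)
      = p1 * exp (b * z) + p2 * exp (- (b * z))" for z
    proof -
      have "1 + a * b\<^sup>2 = 0" "1 + a * (- b)\<^sup>2 = 0" "1 + a * b * - b = 2"
        using one(1) by (simp_all add: power2_eq_square mult.assoc)
      then show ?thesis
        using eqf[of z] unfolding deriv_exponentials[OF fz] unfolding fz quadratic_expansion
        by (simp add: mult_ac add_ac)
    qed
    note co = exp_coefficients[OF nz(4) this]
    \<comment> \<open>The constant term gives \<open>C\<^sup>2 = - 4 * A * B\<close>; multiplication
      by \<open>C\<^sup>2\<close> turns the right-hand side into
      \<open>- (2 * A * C) * (2 * B * C)\<close>.\<close>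
    have "C ^ 4 = - (p1 * p2)"
    proof -
      have "C\<^sup>2 = - (4 * A * B)" using co(3) by (simp add: eq_neg_iff_add_eq_0 add.commute)
      moreover have "C ^ 4 = C\<^sup>2 * C * C" by (simp add: eval_nat_numeral)
      ultimately show ?thesis unfolding co(1,2)[symmetric] by simp
    qed
    moreover have "\<forall>z. f z = A * exp (b * z) + B * exp (- (b * z)) + C" using fz by simp
    ultimately show ?thesis using one(1) co by blast
  next
    case (left A0 B0)
    then have "h w = A0 * exp (-3/2 * w) + B0 * exp (1/2 * w) + 0" for w by simp
    from rescale_exponentials[OF this f] obtain A B where
      "\<And>z. f z = A * exp (-3/2 * (b * z)) + B * exp (1/2 * (b * z)) + 0" by auto
    then have fz: "f z = A * exp (- 3 / 2 * b * z) + B * exp (b / 2 * z) + 0" for z by (simp add: mult.assoc)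
    have "0 * exp (2 * b * z) + 8 / 9 * B\<^sup>2 * exp (b * z) + 0 + 8 / 3 * A * B * exp (- (b * z)) + 0 * exp (- 2 * b * z)
      = p1 * exp (b * z) + p2 * exp (- (b * z))" for z
    proof -
      have "1 + a * (- 3 / 2 * b)\<^sup>2 = 1 + 9 / 4 * (a * b\<^sup>2)" "1 + a * (b / 2)\<^sup>2 = 1 + 1 / 4 * (a * b\<^sup>2)"
        "1 + a * (- 3 / 2 * b) * (b / 2) = 1 - 3 / 4 * (a * b\<^sup>2)"
        by (simp_all add: power2_eq_square)
      then have co: "1 + a * (- 3 / 2 * b)\<^sup>2 = 0" "1 + a * (b / 2)\<^sup>2 = 8 / 9" "1 + a * (- 3 / 2 * b) * (b / 2) = 4 / 3"
        by (simp_all add: left(1))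
      have ex: "- 3 / 2 * b + b / 2 = - b" by (simp add: field_simps)
      show ?thesis
        using eqf[of z] unfolding deriv_exponentials[OF fz] unfolding fz quadratic_expansion co ex
        by (simp add: mult_ac add_ac)
    qed
    note co = exp_coefficients[OF nz(4) this]
    have "B ^ 2 = 9 / 8 * p1" unfolding co(1)[symmetric] by simp
    \<comment> \<open>The cross term has exponent \<open>- b\<close>, so
      \<open>p2 = 8/3 * A * B\<close>; squaring and inserting \<open>p1 = 8/9 * B\<^sup>2\<close>
      eliminates \<open>B\<close>.\<close>
    moreover have "A ^ 2 = p2 ^ 2 / (8 * p1)"
    proof -
      have "p2 ^ 2 = A ^ 2 * (8 * p1)" unfolding co(1,2)[symmetric] by (simp add: power2_eq_square)
      then show ?thesis using nz by simp
    qed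
    moreover have "\<forall>z. f z = A * exp (- (3 / 2 * b * z)) + B * exp (1 / 2 * b * z)" using fz by simp
    ultimately show ?thesis using left(1) by blast
  next
    case (right A0 B0)
    then have "h w = A0 * exp (3/2 * w) + B0 * exp (-1/2 * w) + 0" for w by simp
    from rescale_exponentials[OF this f] obtain A B where
      "\<And>z. f z = A * exp (3/2 * (b * z)) + B * exp (-1/2 * (b * z)) + 0" by auto
    then have fz: "f z = A * exp (3 / 2 * b * z) + B * exp (- (b / 2) * z) + 0" for z by (simp add: mult.assoc)
    have "0 * exp (2 * b * z) + 8 / 3 * A * B * exp (b * z) + 0 + 8 / 9 * B\<^sup>2 * exp (- (b * z)) + 0 * exp (- 2 * b * z)
      = p1 * exp (b * z) + p2 * exp (- (b * z))" for z
    proof -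
      have "1 + a * (3 / 2 * b)\<^sup>2 = 1 + 9 / 4 * (a * b\<^sup>2)" "1 + a * (- (b / 2))\<^sup>2 = 1 + 1 / 4 * (a * b\<^sup>2)"
        "1 + a * (3 / 2 * b) * (- (b / 2)) = 1 - 3 / 4 * (a * b\<^sup>2)"
        by (simp_all add: power2_eq_square)
      then have co: "1 + a * (3 / 2 * b)\<^sup>2 = 0" "1 + a * (- (b / 2))\<^sup>2 = 8 / 9" "1 + a * (3 / 2 * b) * (- (b / 2)) = 4 / 3"
        by (simp_all add: right(1))
      have ex: "3 / 2 * b + - (b / 2) = b" by (simp add: field_simps)
      show ?thesis
        using eqf[of z] unfolding deriv_exponentials[OF fz] unfolding fz quadratic_expansion co ex
        by (simp add: mult_ac add_ac)
    qed
    note co = exp_coefficients[OF nz(4) this]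
    have "B ^ 2 = 9 / 8 * p2" unfolding co(2)[symmetric] by simp
    moreover have "A ^ 2 = p1 ^ 2 / (8 * p2)"
    proof -
      have "p1 ^ 2 = A ^ 2 * (8 * p2)" unfolding co(1,2)[symmetric] by (simp add: power2_eq_square)
      then show ?thesis using nz by simp
    qed
    moreover have "\<forall>z. f z = A * exp (3 / 2 * b * z) + B * exp (- (1 / 2 * b * z))" using fz by simp
    ultimately show ?thesis using right(1) by blast
  qed
qed

text \<open>The witnesses are read off from the necessary forms; by
  \<open>quadratic_expansion\<close> only a comparison of exponentials has to be checked.\<close>

lemma solution_exists:
  assumes nz: "p1 \<noteq> 0" "p2 \<noteq> 0" and ab: "a * b\<^sup>2 = -1 \<or> a * b\<^sup>2 = (4::complex)"
  shows "\<exists>f. entire_solution 2 a p1 p2 b f"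
proof -
  have sol: ?thesis
    if *: "\<And>z. A\<^sup>2 * (1 + a * \<alpha>\<^sup>2) * exp (2 * \<alpha> * z) + B\<^sup>2 * (1 + a * (- \<alpha>)\<^sup>2) * exp (2 * (- \<alpha>) * z)
      + 2 * A * B * (1 + a * \<alpha> * (- \<alpha>)) * exp ((\<alpha> + (- \<alpha>)) * z) + 2 * A * C * exp (\<alpha> * z)
      + 2 * B * C * exp ((- \<alpha>) * z) + C\<^sup>2 = p1 * exp (b * z) + p2 * exp (- (b * z))" for A B C \<alpha>
  proof -
    define f where "f = (\<lambda>z. A * exp (\<alpha> * z) + B * exp ((- \<alpha>) * z) + C)"
    have fz: "f z = A * exp (\<alpha> * z) + B * exp ((- \<alpha>) * z) + C" for z by (simp add: f_def)
    have "entire_solution 2 a p1 p2 b f"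
      unfolding entire_solution_def deriv_exponentials[OF fz]
    proof
      show "f holomorphic_on UNIV" unfolding f_def by (intro holomorphic_intros)
    qed (simp only: fz quadratic_expansion *, simp)
    then show ?thesis by blast
  qed
  show ?thesis
    using ab
  proof
    assume ab: "a * b\<^sup>2 = -1"
    define r where "r = exp (Ln (- (p1 * p2)) / 4)"
    have "r ^ 4 = exp (4 * (Ln (- (p1 * p2)) / 4))"
      unfolding r_def by (simp add: exp_of_nat_mult[symmetric])
    then have r4: "r ^ 4 = - (p1 * p2)" using nz by simp
    have r0: "r \<noteq> 0" by (simp add: r_def)
    \<comment> \<open>The choice of \<open>r\<close> as a fourth root of \<open>- (p1 * p2)\<close>
      is what cancels the constant term.\<close>
    have "2 * (p1 / (2 * r)) * (p2 / (2 * r)) * 2 + r\<^sup>2 = 0"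
      using r4 r0 by (simp add: field_simps power2_eq_square eval_nat_numeral)
    then show ?thesis
      by (intro sol[of "p1 / (2 * r)" b "p2 / (2 * r)" r])
        (use ab r0 in \<open>simp add: power2_eq_square mult.assoc\<close>)
  next
    assume ab: "a * b\<^sup>2 = 4"
    show ?thesis
      by (rule sol[of "csqrt (p1 / 2)" "b / 2" "csqrt (p2 / 2)" 0])
        (use ab in \<open>simp add: power_divide power2_eq_square[of b] mult.assoc\<close>)
  qed
qed

theorem theorem1p4:
  fixes n :: nat and a p1 p2 b :: complex
  assumes "2 \<le> n" and "n \<le> 4"
    and "a \<noteq> 0" and "p1 \<noteq> 0" and "p2 \<noteq> 0" and "b \<noteq> 0"
  shows
    "(\<forall>f. entire_solution n a p1 p2 b f \<longrightarrow>
        (n = 2 \<or> n = 4) \<and>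
        (n = 4 \<longrightarrow>
          a * (b / 2) ^ 4 = -1 \<and>
          (\<exists>k1 k2. 8 * k1 ^ 3 * k2 = p1 \<and> 8 * k2 ^ 3 * k1 = p2 \<and>
             (\<forall>z. f z = k1 * exp (b / 2 * z) + k2 * exp (- (b / 2 * z))))) \<and>
        (n = 2 \<longrightarrow>
          (9 * a * b ^ 2 \<noteq> -4 \<longrightarrow>
             (a * b ^ 2 + 1 = 0 \<longrightarrow>
                (\<exists>t1 t2 r. r ^ 4 = - (p1 * p2) \<and> 2 * t1 * r = p1 \<and> 2 * t2 * r = p2 \<and>
                   (\<forall>z. f z = t1 * exp (b * z) + t2 * exp (- (b * z)) + r))) \<and>
             (a * b ^ 2 - 4 = 0 \<longrightarrow>
                (\<exists>l1 l2. l1 ^ 2 = p1 / 2 \<and> l2 ^ 2 = p2 / 2 \<and>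
                   (\<forall>z. f z = l1 * exp (b * z / 2) + l2 * exp (- (b * z / 2)))))) \<and>
          (9 * a * b ^ 2 = -4 \<longrightarrow>
             (\<exists>l1 l2. l2 ^ 2 = 9 / 8 * p1 \<and> l1 ^ 2 = p2 ^ 2 / (8 * p1) \<and>
                (\<forall>z. f z = l1 * exp (- (3 / 2 * b * z)) + l2 * exp (1 / 2 * b * z))) \<or>
             (\<exists>l3 l4. l4 ^ 2 = 9 / 8 * p2 \<and> l3 ^ 2 = p1 ^ 2 / (8 * p2) \<and>
                (\<forall>z. f z = l3 * exp (3 / 2 * b * z) + l4 * exp (- (1 / 2 * b * z))))))) \<and>
     (n = 2 \<longrightarrow> 9 * a * b ^ 2 \<noteq> -4 \<longrightarrow>
        ((\<exists>f. entire_solution 2 a p1 p2 b f) \<longleftrightarrow> a * b ^ 2 + 1 = 0 \<or> a * b ^ 2 - 4 = 0))"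
proof -
  note nz = assms(3-6)
  define s where "s = a * b\<^sup>2"
  have s: "9 * a * b\<^sup>2 = -4 \<longleftrightarrow> s = - 4 / 9" "a * b\<^sup>2 + 1 = 0 \<longleftrightarrow> s = -1" "a * b\<^sup>2 - 4 = 0 \<longleftrightarrow> s = 4"
    by (auto simp: s_def add_eq_0_iff mult.assoc field_simps)
  \<comment> \<open>The three values of \<open>a * b\<^sup>2\<close> in
    \<open>solution_degree_2\<close> exclude each other, so each hypothesis on
    \<open>a * b\<^sup>2\<close> selects one alternative.\<close>
  have distinct: "(-1::complex) \<noteq> 4" "(-1::complex) \<noteq> - 4 / 9" "(4::complex) \<noteq> - 4 / 9" by (simp_all add: complex_eq_iff)
  note sol2 = solution_degree_2[OF _ nz, folded s_def]
  have n: "n = 2 \<or> n = 3 \<or> n = 4" using assms(1,2) by auto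
  show ?thesis
  proof (intro conjI allI impI)
    fix f assume sol: "entire_solution n a p1 p2 b f"
    show "n = 2 \<or> n = 4" using n solution_degree_4(1)[OF sol _ nz] by blast
  next
    fix f assume "entire_solution n a p1 p2 b f" "n = 4"
    then show "a * (b / 2) ^ 4 = -1" using solution_degree_4(2)[of n a p1 p2 b f] nz by blast
  next
    fix f assume "entire_solution n a p1 p2 b f" "n = 4"
    then show "\<exists>k1 k2. 8 * k1 ^ 3 * k2 = p1 \<and> 8 * k2 ^ 3 * k1 = p2 \<and>
             (\<forall>z. f z = k1 * exp (b / 2 * z) + k2 * exp (- (b / 2 * z)))"
      using solution_degree_4(3)[of n a p1 p2 b f] nz by blast
  next
    fix f assume "entire_solution n a p1 p2 b f" "n = 2" "a * b ^ 2 + 1 = 0"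
    then show "\<exists>t1 t2 r. r ^ 4 = - (p1 * p2) \<and> 2 * t1 * r = p1 \<and> 2 * t2 * r = p2 \<and>
                   (\<forall>z. f z = t1 * exp (b * z) + t2 * exp (- (b * z)) + r)"
      unfolding s using sol2[of f] distinct by auto
  next
    fix f assume "entire_solution n a p1 p2 b f" "n = 2" "a * b ^ 2 - 4 = 0"
    then show "\<exists>l1 l2. l1 ^ 2 = p1 / 2 \<and> l2 ^ 2 = p2 / 2 \<and>
                   (\<forall>z. f z = l1 * exp (b * z / 2) + l2 * exp (- (b * z / 2)))"
      unfolding s using sol2[of f] distinct by auto
  next
    fix f assume "entire_solution n a p1 p2 b f" "n = 2" "9 * a * b ^ 2 = -4"
    then show "(\<exists>l1 l2. l2 ^ 2 = 9 / 8 * p1 \<and> l1 ^ 2 = p2 ^ 2 / (8 * p1) \<and>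
                (\<forall>z. f z = l1 * exp (- (3 / 2 * b * z)) + l2 * exp (1 / 2 * b * z))) \<or>
             (\<exists>l3 l4. l4 ^ 2 = 9 / 8 * p2 \<and> l3 ^ 2 = p1 ^ 2 / (8 * p2) \<and>
                (\<forall>z. f z = l3 * exp (3 / 2 * b * z) + l4 * exp (- (1 / 2 * b * z))))"
      unfolding s using sol2[of f] distinct by auto
  next
    assume "9 * a * b ^ 2 \<noteq> -4"
    then show "(\<exists>f. entire_solution 2 a p1 p2 b f) \<longleftrightarrow> a * b ^ 2 + 1 = 0 \<or> a * b ^ 2 - 4 = 0"
      unfolding s using sol2 solution_exists[OF nz(2,3), of a b, folded s_def] by blast
  qed
qed

end
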